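(* (Classical mathematics.) Let $A$ be a commutative ring. Then $A$ admits the structure of a real closed ring (in the equational sense given in the context) if and only if $A$ is real closed in the sense of Schwartz, i.e. $A$ is a reduced ring such that: (1) the set of squares of $A$ is the set of elements $\ge 0$ for a partial order which makes $A$ an $f$-ring; (2) if $0\le a\le b$ in $A$, there exists $z\in A$ with $zb=a^2$; (3) for every prime ideal $\mathfrak p$ of $A$, the residual ring $A/\mathfrak p$ is integrally closed and its field of fractions is a real closed field.
   Context: Rings are commutative with $1$. An $f$-ring is a ring $A$ with a binary operation $\vee$ that is idempotent, commutative and associative, with $x+(y\vee z)=(x+y)\vee(x+z)$ and $x^+(y\vee z)=(x^+y)\vee(x^+z)$, where $x^+=x\vee 0$. One writes $x\ge y$ for $x\vee y=x$, $x\wedge y=-((-x)\vee(-y))$, $|x|=x\vee(-x)$. A real closed ring (equational sense) is an $f$-ring $A$ with a map $\mathrm{Fr}:A^2\to A$ and maps $\rho_{d,j}:A^d\to A$ ($1\le j\le d$) satisfying: (F) $\mathrm{Fr}(a,b)\,|b|=(|a|\wedge|b|)^2$ and $0\le \mathrm{Fr}(a,b)\le |a|\wedge|b|$ for all $a,b$ (this forces $A$ to be a $\mathbb Q$-algebra). For a monic $f=X^d-(a_{d-1}X^{d-1}+\dots+a_0)\in A[X]$ write $\rho_{d,j}(f)=\rho_{d,j}(a_{d-1},\dots,a_0)$ (the virtual roots of $f$). (V1) $\rho_{1,1}(X-a)=a$. (V2) For $d\ge2$, $1\le j\le d$, $f$ monic of degree $d$, let $g=f'/d$, $\sigma=(-1)^{d-j}$,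 $x=\rho_{d,j}(f)$. If $j\ge2$, with $u=\rho_{d-1,j-1}(g)$: $u\le x$, $\sigma(x-u)f(u)\le0$, $\sigma(x-u)f(x)\le0$. If $j\le d-1$, with $v=\rho_{d-1,j}(g)$: $x\le v$, $\sigma(v-x)f(v)\ge0$, $\sigma(v-x)f(x)\ge0$. If $j=d$: $f(x)\ge0$. If $j=1$: $(-1)^d f(x)\ge0$. (V3) $\rho_{2,2}(a+b,-ab)=a\vee b$ for all $a,b$. *)

theory Defs
  imports "HOL-Algebra.Polynomials" "HOL-Algebra.QuotRing"
begin

section \<open>f-rings\<close>

text \<open>HOL-Algebra's \<^locale>\<open>cring\<close> does not exclude the zero ring, so neither does anything below
  that is not stated for domains or fields.\<close>

locale f_ring = cring A for A (structure) +
  fixes join :: "'a \<Rightarrow> 'a \<Rightarrow> 'a"  (infixl "\<curlyvee>" 65)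
  assumes join_closed: "\<lbrakk> x \<in> carrier A; y \<in> carrier A \<rbrakk> \<Longrightarrow> x \<curlyvee> y \<in> carrier A"
    and join_idem: "x \<in> carrier A \<Longrightarrow> x \<curlyvee> x = x"
    and join_comm: "\<lbrakk> x \<in> carrier A; y \<in> carrier A \<rbrakk> \<Longrightarrow> x \<curlyvee> y = y \<curlyvee> x"
    and join_assoc:
      "\<lbrakk> x \<in> carrier A; y \<in> carrier A; z \<in> carrier A \<rbrakk> \<Longrightarrow> (x \<curlyvee> y) \<curlyvee> z = x \<curlyvee> (y \<curlyvee> z)"
    and add_join:
      "\<lbrakk> x \<in> carrier A; y \<in> carrier A; z \<in> carrier A \<rbrakk> \<Longrightarrow>
         x \<oplus> (y \<curlyvee> z) = (x \<oplus> y) \<curlyvee> (x \<oplus> z)"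
    and pos_mult_join:
      "\<lbrakk> x \<in> carrier A; y \<in> carrier A; z \<in> carrier A \<rbrakk> \<Longrightarrow>
         (x \<curlyvee> \<zero>) \<otimes> (y \<curlyvee> z) = ((x \<curlyvee> \<zero>) \<otimes> y) \<curlyvee> ((x \<curlyvee> \<zero>) \<otimes> z)"
begin

definition le :: "'a \<Rightarrow> 'a \<Rightarrow> bool"  (infix "\<preceq>" 50)
  where "y \<preceq> x \<longleftrightarrow> x \<curlyvee> y = x"

definition meet :: "'a \<Rightarrow> 'a \<Rightarrow> 'a"  (infixl "\<curlywedge>" 65)
  where "x \<curlywedge> y = \<ominus> ((\<ominus> x) \<curlyvee> (\<ominus> y))"

definition abs_val :: "'a \<Rightarrow> 'a"
  where "abs_val x = x \<curlyvee> (\<ominus> x)"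

end


section \<open>Real closed rings, equationally\<close>

text \<open>Polynomials are coefficient lists with the leading coefficient first, as in
  \<^theory>\<open>HOL-Algebra.Polynomials\<close>. A monic polynomial is a list beginning with \<open>\<one>\<close>; over the
  zero ring such a list is not in the library's normal form, hence the separate predicate.\<close>

definition monic_poly :: "('a, 'm) ring_scheme \<Rightarrow> nat \<Rightarrow> 'a list \<Rightarrow> bool"
  where "monic_poly R d f \<longleftrightarrow>
    (\<exists>cs. f = \<one>\<^bsub>R\<^esub> # cs \<and> length cs = d \<and> set cs \<subseteq> carrier R)"

fun poly_deriv :: "('a, 'm) ring_scheme \<Rightarrow> 'a list \<Rightarrow> 'a list"
  where
    "poly_deriv R [] = []"
  | "poly_deriv R [c] = []"
  | "poly_deriv R (c # c' # cs) =
       ([(length (c' # cs))] \<cdot>\<^bsub>R\<^esub> c) # poly_deriv R (c' # cs)"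

text \<open>\<open>f'/d\<close> with \<open>d = deg f\<close>. It is only used where \<open>d\<close> is invertible.\<close>

definition monic_deriv :: "('a, 'm) ring_scheme \<Rightarrow> 'a list \<Rightarrow> 'a list"
  where "monic_deriv R f =
    map (\<lambda>c. inv\<^bsub>R\<^esub> ([degree f] \<cdot>\<^bsub>R\<^esub> \<one>\<^bsub>R\<^esub>) \<otimes>\<^bsub>R\<^esub> c) (poly_deriv R f)"

text \<open>\<open>rho d j [a\<^bsub>d-1\<^esub>, \<dots>, a\<^bsub>0\<^esub>]\<close> stands for \<open>\<rho>\<^bsub>d,j\<^esub>(a\<^bsub>d-1\<^esub>, \<dots>, a\<^bsub>0\<^esub>)\<close>; the polynomial it is
  attached to is \<open>X\<^sup>d - (a\<^bsub>d-1\<^esub>X\<^bsup>d-1\<^esup> + \<dots> + a\<^bsub>0\<^esub>)\<close>, whence the change of sign.\<close>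

definition virtual_root ::
    "('a, 'm) ring_scheme \<Rightarrow> (nat \<Rightarrow> nat \<Rightarrow> 'a list \<Rightarrow> 'a) \<Rightarrow> nat \<Rightarrow> nat \<Rightarrow> 'a list \<Rightarrow> 'a"
  where "virtual_root R rho d j f = rho d j (map (\<lambda>c. \<ominus>\<^bsub>R\<^esub> c) (tl f))"

definition (in f_ring) virtual_root_bounds :: "(nat \<Rightarrow> nat \<Rightarrow> 'a list \<Rightarrow> 'a) \<Rightarrow> bool"
  where "virtual_root_bounds rho \<longleftrightarrow>
    (\<forall>d j f. 2 \<le> d \<longrightarrow> 1 \<le> j \<longrightarrow> j \<le> d \<longrightarrow> monic_poly A d f \<longrightarrow>
      (let g = monic_deriv A f;
           \<sigma> = (\<ominus> \<one>) [^] (d - j);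
           x = virtual_root A rho d j f;
           u = virtual_root A rho (d - 1) (j - 1) g;
           v = virtual_root A rho (d - 1) j g
       in (2 \<le> j \<longrightarrow>
             u \<preceq> x \<and>
             \<sigma> \<otimes> (x \<ominus> u) \<otimes> eval f u \<preceq> \<zero> \<and>
             \<sigma> \<otimes> (x \<ominus> u) \<otimes> eval f x \<preceq> \<zero>) \<and>
          (j \<le> d - 1 \<longrightarrow>
             x \<preceq> v \<and>
             \<zero> \<preceq> \<sigma> \<otimes> (v \<ominus> x) \<otimes> eval f v \<and>
             \<zero> \<preceq> \<sigma> \<otimes> (v \<ominus> x) \<otimes> eval f x) \<and>
          (j = d \<longrightarrow> \<zero> \<preceq> eval f x) \<and>
          (j = 1 \<longrightarrow> \<zero> \<preceq> (\<ominus> \<one>) [^] d \<otimes> eval f x)))"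

locale real_closed_ring = f_ring +
  fixes Fr :: "'a \<Rightarrow> 'a \<Rightarrow> 'a"
    and rho :: "nat \<Rightarrow> nat \<Rightarrow> 'a list \<Rightarrow> 'a"
  assumes Fr_closed: "\<lbrakk> a \<in> carrier A; b \<in> carrier A \<rbrakk> \<Longrightarrow> Fr a b \<in> carrier A"
    and rho_closed:
      "\<lbrakk> 1 \<le> j; j \<le> d; length as = d; set as \<subseteq> carrier A \<rbrakk> \<Longrightarrow> rho d j as \<in> carrier A"
    and Fr_mult:
      "\<lbrakk> a \<in> carrier A; b \<in> carrier A \<rbrakk> \<Longrightarrow>
         Fr a b \<otimes> abs_val b = (abs_val a \<curlywedge> abs_val b) [^] (2::nat)"
    and Fr_nonneg: "\<lbrakk> a \<in> carrier A; b \<in> carrier A \<rbrakk> \<Longrightarrow> \<zero> \<preceq> Fr a b"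
    and Fr_le: "\<lbrakk> a \<in> carrier A; b \<in> carrier A \<rbrakk> \<Longrightarrow> Fr a b \<preceq> abs_val a \<curlywedge> abs_val b"
    and rho_linear: "a \<in> carrier A \<Longrightarrow> virtual_root A rho 1 1 [\<one>, \<ominus> a] = a"
    and rho_bounds: "virtual_root_bounds rho"
    and rho_quadratic:
      "\<lbrakk> a \<in> carrier A; b \<in> carrier A \<rbrakk> \<Longrightarrow> rho 2 2 [a \<oplus> b, \<ominus> (a \<otimes> b)] = a \<curlyvee> b"


section \<open>Fields of fractions and integrally closed domains\<close>

definition frac_pairs :: "('a, 'm) ring_scheme \<Rightarrow> ('a \<times> 'a) set"
  where "frac_pairs R = carrier R \<times> (carrier R - {\<zero>\<^bsub>R\<^esub>})"

definition frac_rel :: "('a, 'm) ring_scheme \<Rightarrow> (('a \<times> 'a) \<times> ('a \<times> 'a)) set"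
  where "frac_rel R = {(p, q). p \<in> frac_pairs R \<and> q \<in> frac_pairs R \<and>
    fst p \<otimes>\<^bsub>R\<^esub> snd q = fst q \<otimes>\<^bsub>R\<^esub> snd p}"

definition fraction :: "('a, 'm) ring_scheme \<Rightarrow> 'a \<Rightarrow> 'a \<Rightarrow> ('a \<times> 'a) set"
  where "fraction R a b = frac_rel R `` {(a, b)}"

definition fraction_field :: "('a, 'm) ring_scheme \<Rightarrow> ('a \<times> 'a) set ring"
  where "fraction_field R =
    \<lparr> carrier = frac_pairs R // frac_rel R,
      mult = (\<lambda>S T. \<Union>(a, b)\<in>S. \<Union>(c, d)\<in>T. fraction R (a \<otimes>\<^bsub>R\<^esub> c) (b \<otimes>\<^bsub>R\<^esub> d)),
      one = fraction R \<one>\<^bsub>R\<^esub> \<one>\<^bsub>R\<^esub>,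
      zero = fraction R \<zero>\<^bsub>R\<^esub> \<one>\<^bsub>R\<^esub>,
      add = (\<lambda>S T. \<Union>(a, b)\<in>S. \<Union>(c, d)\<in>T.
               fraction R (a \<otimes>\<^bsub>R\<^esub> d \<oplus>\<^bsub>R\<^esub> c \<otimes>\<^bsub>R\<^esub> b) (b \<otimes>\<^bsub>R\<^esub> d)) \<rparr>"

definition frac_embed :: "('a, 'm) ring_scheme \<Rightarrow> 'a \<Rightarrow> ('a \<times> 'a) set"
  where "frac_embed R a = fraction R a \<one>\<^bsub>R\<^esub>"

definition integrally_closed :: "('a, 'm) ring_scheme \<Rightarrow> bool"
  where "integrally_closed R \<longleftrightarrow> domain R \<and>
    (\<forall>x \<in> carrier (fraction_field R). \<forall>cs. set cs \<subseteq> carrier R \<longrightarrow>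
       ring.eval (fraction_field R) (map (frac_embed R) (\<one>\<^bsub>R\<^esub> # cs)) x =
         \<zero>\<^bsub>fraction_field R\<^esub> \<longrightarrow>
       x \<in> frac_embed R ` carrier R)"


section \<open>Real closed fields\<close>

definition ordered_field_by :: "('a, 'm) ring_scheme \<Rightarrow> ('a \<times> 'a) set \<Rightarrow> bool"
  where "ordered_field_by K r \<longleftrightarrow> field K \<and> linear_order_on (carrier K) r \<and>
    (\<forall>x \<in> carrier K. \<forall>y \<in> carrier K. \<forall>z \<in> carrier K.
       (x, y) \<in> r \<longrightarrow> (x \<oplus>\<^bsub>K\<^esub> z, y \<oplus>\<^bsub>K\<^esub> z) \<in> r) \<and>
    (\<forall>x \<in> carrier K. \<forall>y \<in> carrier K.
       (\<zero>\<^bsub>K\<^esub>, x) \<in> r \<longrightarrow> (\<zero>\<^bsub>K\<^esub>, y) \<in> r \<longrightarrow> (\<zero>\<^bsub>K\<^esub>, x \<otimes>\<^bsub>K\<^esub> y) \<in> r)"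

definition real_closed_field :: "('a, 'm) ring_scheme \<Rightarrow> bool"
  where "real_closed_field K \<longleftrightarrow>
    (\<exists>r. ordered_field_by K r \<and>
       (\<forall>x \<in> carrier K. (\<zero>\<^bsub>K\<^esub>, x) \<in> r \<longrightarrow> (\<exists>y \<in> carrier K. y [^]\<^bsub>K\<^esub> (2::nat) = x)) \<and>
       (\<forall>p. polynomial\<^bsub>K\<^esub> (carrier K) p \<longrightarrow> odd (degree p) \<longrightarrow>
          (\<exists>x \<in> carrier K. ring.eval K p x = \<zero>\<^bsub>K\<^esub>)))"


section \<open>Real closed rings in the sense of Schwartz\<close>

definition reduced_ring :: "('a, 'm) ring_scheme \<Rightarrow> bool"
  where "reduced_ring R \<longleftrightarrow> cring R \<and>
    (\<forall>x \<in> carrier R. \<forall>n::nat. x [^]\<^bsub>R\<^esub> n = \<zero>\<^bsub>R\<^esub> \<longrightarrow> x = \<zero>\<^bsub>R\<^esub>)"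

definition f_ring_order :: "('a, 'm) ring_scheme \<Rightarrow> ('a \<times> 'a) set \<Rightarrow> bool"
  where "f_ring_order R r \<longleftrightarrow> partial_order_on (carrier R) r \<and>
    (\<exists>join. f_ring R join \<and>
       (\<forall>x \<in> carrier R. \<forall>y \<in> carrier R. (x, y) \<in> r \<longleftrightarrow> f_ring.le join x y))"

definition schwartz_real_closed :: "('a, 'm) ring_scheme \<Rightarrow> bool"
  where "schwartz_real_closed R \<longleftrightarrow> reduced_ring R \<and>
    (\<exists>r. f_ring_order R r \<and>
       {x [^]\<^bsub>R\<^esub> (2::nat) | x. x \<in> carrier R} = {x \<in> carrier R. (\<zero>\<^bsub>R\<^esub>, x) \<in> r} \<and>
       (\<forall>a \<in> carrier R. \<forall>b \<in> carrier R. (\<zero>\<^bsub>R\<^esub>, a) \<in> r \<longrightarrow> (a, b) \<in> r \<longrightarrow>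
          (\<exists>z \<in> carrier R. z \<otimes>\<^bsub>R\<^esub> b = a [^]\<^bsub>R\<^esub> (2::nat)))) \<and>
    (\<forall>P. primeideal P R \<longrightarrow>
       integrally_closed (R Quot P) \<and> real_closed_field (fraction_field (R Quot P)))"

end

theory Submission
  imports Defs "HOL-Algebra.Algebraic_Closure_Type"
begin

text \<open>Over an ordered field whose polynomials of degree at most \<open>n\<close> satisfy the intermediate value
  theorem, the signs of a monic \<open>f\<close> of degree \<open>n + 1\<close> between consecutive virtual roots are forced,
  by induction along \<open>f'\<close>. Hence every root is a virtual root, and conversely virtual roots
  give back the intermediate value theorem in degree \<open>n + 1\<close>.

  If \<open>A\<close> carries virtual roots, then \<open>\<rho>\<^bsub>2,2\<^esub>(0,a)\<close> is a square root of \<open>a \<ge> 0\<close>. The residue field at a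
  prime is thus ordered by its squares, and it is the fraction field of a subring with virtual roots;
  so it is real closed, and the subring is integrally closed because a root of a monic polynomial is one
  of its virtual roots.

  Conversely, the residue fields of a Schwartz real closed ring have unique virtual roots (the
  intermediate value theorem comes from square roots and odd degree by Laplace's argument). These are
  integral over \<open>A/P\<close>, so they lie in it. The conditions on a virtual root \<open>x\<close> can be written as one equation
  \<open>F x = \<zero>\<close> by adding up the negative parts of the elements required to be nonnegative; it has a unique
  solution modulo every prime. The solutions modulo single primes are glued to an element of \<open>A\<close> with
  the help of the divisibility condition (2).\<close>

section \<open>Polynomials over ordered fields\<close>

text \<open>An ordered field has no completeness, so the passage from degree \<open>n\<close> to
  \<open>n + 1\<close> has to be algebraic: where \<open>p\<close> takes a value twice, linear
  factors are divided out, and the quotient has a degree in which the intermediate value theorem is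
  already known. So the sign of the derivative controls monotonicity without circularity.

  Condition (2) makes every prime ideal convex. This orders \<open>A/P\<close> and turns order
  conditions modulo \<open>P\<close> into membership in \<open>P\<close>. Integral closedness
  suffices to bring virtual roots down to \<open>A/P\<close>, because a virtual root of
  \<open>f\<close> is a root of \<open>f\<close> or a virtual root of \<open>f'\<close>.

  The obstacle to gluing is that an element vanishing on a closed set is only nilpotent modulo an
  ideal; a power of it has to be traded for the element itself, and only square roots are available
  for that. Uniqueness of virtual roots serves three times: local solutions become compatible, the
  roots chosen for \<open>f\<close> fit those chosen for \<open>f'\<close>, and
  \<open>a \<curlyvee> b\<close> is recognized as a virtual root.\<close>

definition ivt :: "nat \<Rightarrow> 'a::linordered_field itself \<Rightarrow> bool" where
  "ivt n T \<longleftrightarrow> (\<forall>p::'a poly. \<forall>a b. degree p \<le> n \<longrightarrow> a < b \<longrightarrow> poly p a < 0 \<longrightarrow> 0 < poly p b \<longrightarrow>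
     (\<exists>c. a < c \<and> c < b \<and> poly p c = 0))"

lemma ivtD:
  fixes p :: "'a::linordered_field poly"
  assumes "ivt n TYPE('a)" "degree p \<le> n" "a < b" "poly p a * poly p b < 0"
  shows "\<exists>c. a < c \<and> c < b \<and> poly p c = 0"
proof (cases "poly p a < 0")
  case True
  then have "0 < poly p b" using assms(4) by (simp add: mult_less_0_iff)
  then show ?thesis using assms True unfolding ivt_def by blast
next
  case False
  then have "0 < poly p a" "poly p b < 0" using assms(4) by (auto simp: mult_less_0_iff)
  then have "poly (-p) a < 0" "0 < poly (-p) b" "degree (-p) \<le> n" using assms by auto
  then obtain c where "a < c" "c < b" "poly (-p) c = 0"
    using assms(1,3) unfolding ivt_def by blast
  then show ?thesis by auto
qed

lemma poly_bounded_near: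
  fixes p :: "'a::linordered_field poly"
  shows "\<exists>C\<ge>0. \<forall>y. \<bar>y\<bar> \<le> 1 \<longrightarrow> \<bar>poly p y\<bar> \<le> C"
proof (induction p)
  case (pCons a p)
  then obtain C where C: "C \<ge> 0" "\<And>y. \<bar>y\<bar> \<le> 1 \<Longrightarrow> \<bar>poly p y\<bar> \<le> C" by blast
  have "\<bar>poly (pCons a p) y\<bar> \<le> \<bar>a\<bar> + C" if "\<bar>y\<bar> \<le> 1" for y
  proof -
    have "\<bar>y * poly p y\<bar> \<le> 1 * C" unfolding abs_mult using C that by (intro mult_mono) auto
    then show ?thesis by (simp add: abs_if split: if_splits)
  qed
  then show ?case using C(1) by (intro exI[of _ "\<bar>a\<bar> + C"]) auto
qed auto

text \<open>Continuity costs no completeness: \<open>p(y) - p(a) = (y - a) q(y - a)\<close>, where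
  \<open>q\<close> is the quotient \<open>(p - p(a)) / (X - a)\<close> recentred at \<open>a\<close>
  and bounded on \<open>[-1, 1]\<close>. It serves to pass from open to closed intervals in
  \<open>ivt_strict_mono\<close>.\<close>

lemma poly_continuous:
  fixes p :: "'a::linordered_field poly"
  assumes "0 < e"
  shows "\<exists>d>0. \<forall>y. \<bar>y - a\<bar> \<le> d \<longrightarrow> \<bar>poly p y - poly p a\<bar> < e"
proof -
  define q where "q = pcompose (synthetic_div p a) [:a, 1:]"
  obtain C where C: "C \<ge> 0" "\<And>y. \<bar>y\<bar> \<le> 1 \<Longrightarrow> \<bar>poly q y\<bar> \<le> C" using poly_bounded_near by blast
  \<comment> \<open>The \<open>1\<close> keeps \<open>y - a\<close> in the range where
    \<open>C\<close> is a bound; the \<open>+ 1\<close> keeps the denominator positive when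
    \<open>C = 0\<close>.\<close>
  define d where "d = min 1 (e / (2 * (C + 1)))"
  have "d > 0" using C assms by (auto simp: d_def)
  moreover have "\<bar>poly p y - poly p a\<bar> < e" if y: "\<bar>y - a\<bar> \<le> d" for y
  proof -
    have "poly p y = poly ([:-a, 1:] * synthetic_div p a + [:poly p a:]) y"
      by (simp only: synthetic_div_correct')
    then have eq: "poly p y - poly p a = (y - a) * poly q (y - a)"
      by (simp add: q_def poly_pcompose algebra_simps)
    have "\<bar>(y - a) * poly q (y - a)\<bar> \<le> d * C"
      unfolding abs_mult using C y by (intro mult_mono) (auto simp: d_def)
    also have "\<dots> \<le> e / (2 * (C + 1)) * C" using C by (intro mult_right_mono) (auto simp: d_def)
    also have "\<dots> < e"
    proof -
      have "e * C < e * (2 * (C + 1))" using C assms by (intro mult_strict_left_mono) auto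
      then show ?thesis using C by (simp add: pos_divide_less_eq)
    qed
    finally show ?thesis using eq by simp
  qed
  ultimately show ?thesis by blast
qed

text \<open>If \<open>p'\<close> is positive at both ends, then
  \<open>p - c = (X - x)(X - y) h\<close> with \<open>h\<close> negative at \<open>x\<close> and
  positive at \<open>y\<close>. With two linear factors gone, the known intermediate value theorem
  applies to \<open>h\<close>; its root \<open>w\<close> has \<open>p(w) = c\<close>, and the
  interval from \<open>w\<close> to \<open>y\<close> contains fewer such points.\<close>

lemma ivt_rolle:
  fixes p :: "'a::linordered_field poly"
  assumes ivt: "ivt n TYPE('a)" and deg: "degree p \<le> Suc n"
  assumes "x < y" "poly p x = c" "poly p y = c"
  shows "\<exists>z. x \<le> z \<and> z \<le> y \<and> poly (pderiv p) z \<le> 0"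
  using assms(3-)
proof (induction "card {z. x < z \<and> z < y \<and> poly p z = c}" arbitrary: x rule: less_induct)
  case less
  show ?case
  proof (rule ccontr)
    assume *: "\<not> ?thesis"
    then have pos: "poly (pderiv p) x > 0" "poly (pderiv p) y > 0" using less.prems(1) by (auto simp: not_le dest: spec[of _ x] spec[of _ y])
    have "poly (p - [:c:]) x = 0" using less.prems by simp
    then obtain q where q: "p - [:c:] = [:-x, 1:] * q" unfolding poly_eq_0_iff_dvd dvd_def by blast
    have "poly (p - [:c:]) y = 0" using less.prems by simp
    then have "poly q y = 0" using less.prems(1) unfolding q by simp
    then obtain h where h: "q = [:-y, 1:] * h" unfolding poly_eq_0_iff_dvd dvd_def by blast
    have p: "p = [:-x, 1:] * ([:-y, 1:] * h) + [:c:]" using q h by (simp add: algebra_simps)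
    have "pderiv p \<noteq> 0" using pos by auto
    then have h0: "h \<noteq> 0" using p by (auto simp: pderiv_pCons)
    have pz: "poly p z = (z - x) * ((z - y) * poly h z) + c" for z
      by (subst p) (simp add: algebra_simps)
    have dx: "poly (pderiv p) x = (x - y) * poly h x" "poly (pderiv p) y = (y - x) * poly h y"
      by (subst p; simp add: pderiv_mult pderiv_add pderiv_pCons del: mult_pCons_left mult_pCons_right)+
    have hs: "poly h x < 0" "poly h y > 0"
      using pos less.prems(1) unfolding dx by (auto simp: zero_less_mult_iff)
    have "Suc (Suc (degree h)) = degree (p - [:c:])" unfolding q h
      by (simp add: degree_mult_eq h0 del: mult_pCons_left mult_pCons_right)
    also have "\<dots> \<le> Suc n" using deg by (simp add: degree_diff_le)
    finally have "degree h \<le> n" by simp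
    then obtain w where w: "x < w" "w < y" "poly h w = 0"
      using ivt less.prems(1) hs unfolding ivt_def by blast
    have pw: "poly p w = c" using w pz by simp
    have fin: "finite {z. x < z \<and> z < y \<and> poly p z = c}"
    proof (rule finite_subset)
      have "p - [:c:] \<noteq> 0" unfolding q h using h0 by (simp del: mult_pCons_left mult_pCons_right)
      then show "finite {z. poly (p - [:c:]) z = 0}" by (rule poly_roots_finite)
    qed auto
    have "card {z. w < z \<and> z < y \<and> poly p z = c} < card {z. x < z \<and> z < y \<and> poly p z = c}"
      using w pw by (intro psubset_card_mono fin) auto
    from less.hyps[OF this] w pw less.prems show False using *
      by (meson less_imp_le order_trans)
  qed
qed

text \<open>If \<open>p(x) > p(y)\<close>, then \<open>(p - p(y)) / (X - y)\<close> is negative at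
  \<open>x\<close> and equals \<open>p'(y) > 0\<close> at \<open>y\<close>, so it has a root between
  them, where \<open>p\<close> takes the value \<open>p(y)\<close>. In either case a value is taken
  twice, and \<open>ivt_rolle\<close> contradicts \<open>p' > 0\<close>.\<close>

lemma ivt_strict_mono_open:
  fixes p :: "'a::linordered_field poly"
  assumes ivt: "ivt n TYPE('a)" and deg: "degree p \<le> Suc n"
    and pos: "\<And>z. a < z \<Longrightarrow> z < b \<Longrightarrow> 0 < poly (pderiv p) z"
    and xy: "a < x" "x < y" "y < b"
  shows "poly p x < poly p y"
proof (rule ccontr)
  assume *: "\<not> ?thesis"
  have "\<exists>x1. x \<le> x1 \<and> x1 < y \<and> poly p x1 = poly p y"
  proof (cases "poly p x = poly p y")
    case False
    define q where "q = synthetic_div p y"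
    have q: "p = [:-y, 1:] * q + [:poly p y:]" unfolding q_def by (simp only: synthetic_div_correct')
    have pz: "poly p z = (z - y) * poly q z + poly p y" for z
      by (subst q) (simp add: algebra_simps)
    have "poly (pderiv p) y = poly q y"
      by (subst q) (simp add: pderiv_mult pderiv_add pderiv_pCons del: mult_pCons_left mult_pCons_right)
    then have "poly q y > 0" using pos[of y] xy by simp
    moreover have "poly q x < 0"
    proof -
      have "poly p x > poly p y" using * False by simp
      then have "0 < (x - y) * poly q x" using pz[of x] by linarith
      then show ?thesis using xy by (simp add: zero_less_mult_iff)
    qed
    moreover have "degree q \<le> n" using deg unfolding q_def by (simp add: degree_synthetic_div)
    ultimately obtain w where "x < w" "w < y" "poly q w = 0" using ivt xy unfolding ivt_def by blast
    then show ?thesis using pz[of w] by (intro exI[of _ w]) auto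
  qed (use xy in auto)
  then obtain x1 where x1: "x \<le> x1" "x1 < y" "poly p x1 = poly p y" by blast
  then obtain z where "x1 \<le> z" "z \<le> y" "poly (pderiv p) z \<le> 0"
    using ivt_rolle[OF ivt deg, of x1 y] by auto
  then show False using pos[of z] x1 xy by auto
qed

text \<open>The derivative may vanish at \<open>a\<close> and \<open>b\<close>. Two interior points
  supply the strict inequality, and continuity the weak one at each end.\<close>

lemma ivt_strict_mono:
  fixes p :: "'a::linordered_field poly"
  assumes ivt: "ivt n TYPE('a)" and deg: "degree p \<le> Suc n"
    and pos: "\<And>z. a < z \<Longrightarrow> z < b \<Longrightarrow> 0 < poly (pderiv p) z" and ab: "a < b"
  shows "poly p a < poly p b"
proof -
  note mono = ivt_strict_mono_open[OF ivt deg pos]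
  have left: "poly p a \<le> poly p m" if m: "a < m" "m < b" for m
  proof (rule ccontr)
    assume "\<not> ?thesis"
    then have "0 < poly p a - poly p m" by simp
    then obtain d where d: "d > 0" "\<And>y. \<bar>y - a\<bar> \<le> d \<Longrightarrow> \<bar>poly p y - poly p a\<bar> < poly p a - poly p m"
      using poly_continuous by blast
    \<comment> \<open>Between \<open>a\<close> and \<open>m\<close>, and within \<open>d\<close> of
      \<open>a\<close>: interior monotonicity puts \<open>p(y)\<close> below \<open>p(m)\<close>,
      continuity puts it above.\<close>
    define y where "y = min (a + d) ((a + m) / 2)"
    have y: "a < y" "y < m" "\<bar>y - a\<bar> \<le> d" using d m by (auto simp: y_def min_def field_simps)
    show False using d(2)[OF y(3)] mono[of a b y m] y m by auto
  qed
  have right: "poly p m \<le> poly p b" if m: "a < m" "m < b" for m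
  proof (rule ccontr)
    assume "\<not> ?thesis"
    then have "0 < poly p m - poly p b" by simp
    then obtain d where d: "d > 0" "\<And>y. \<bar>y - b\<bar> \<le> d \<Longrightarrow> \<bar>poly p y - poly p b\<bar> < poly p m - poly p b"
      using poly_continuous by blast
    define y where "y = max (b - d) ((b + m) / 2)"
    have y: "m < y" "y < b" "\<bar>y - b\<bar> \<le> d" using d m by (auto simp: y_def max_def field_simps)
    show False using d(2)[OF y(3)] mono[of a b m y] y m by auto
  qed
  obtain x where x: "a < x" "x < b" using dense ab by blast
  obtain y where y: "x < y" "y < b" using dense x by blast
  show ?thesis using left[of x] mono[of a b x y] right[of y] x y by auto
qed

lemma ivt_strict_mono_sign:
  fixes p :: "'a::linordered_field poly"
  assumes ivt: "ivt n TYPE('a)" and deg: "degree p \<le> Suc n"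
    and pos: "\<And>z. a < z \<Longrightarrow> z < b \<Longrightarrow> 0 < s * poly (pderiv p) z" and ab: "a < b"
  shows "s * poly p a < s * poly p b"
  using ivt_strict_mono[OF ivt, of "smult s p" a b] deg pos ab
  by (auto simp: pderiv_smult intro: order_trans[OF degree_smult_le])

section \<open>Virtual roots over ordered fields\<close>

text \<open>Condition (V2), with the virtual roots of the derivative as a parameter
  \<open>U\<close>; this separates one step of the recursion on the degree from the recursion
  itself.\<close>

definition virtual_root_conds :: "nat \<Rightarrow> 'a::linordered_field poly \<Rightarrow> (nat \<Rightarrow> 'a) \<Rightarrow> nat \<Rightarrow> 'a \<Rightarrow> bool" where
  "virtual_root_conds d f U j x \<longleftrightarrow> (let \<sigma> = (-1)^(d - j) in
     (2 \<le> j \<longrightarrow> U (j - 1) \<le> x \<and> \<sigma> * (x - U (j - 1)) * poly f (U (j - 1)) \<le> 0 \<and>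
        \<sigma> * (x - U (j - 1)) * poly f x \<le> 0) \<and>
     (j \<le> d - 1 \<longrightarrow> x \<le> U j \<and> 0 \<le> \<sigma> * (U j - x) * poly f (U j) \<and> 0 \<le> \<sigma> * (U j - x) * poly f x) \<and>
     (j = d \<longrightarrow> 0 \<le> poly f x) \<and> (j = 1 \<longrightarrow> 0 \<le> (-1)^d * poly f x))"

text \<open>The index \<open>0\<close> and the index \<open>n + 1\<close> stand for \<open>-\<infinity>\<close> and \<open>\<infinity>\<close>. A virtual root need not be
  a root, so nothing is said about the sign at \<open>W j\<close> itself.\<close>
definition sign_pattern :: "nat \<Rightarrow> 'a::linordered_field poly \<Rightarrow> (nat \<Rightarrow> 'a) \<Rightarrow> bool" where
  "sign_pattern n f W \<longleftrightarrow> (\<forall>j\<le>n. \<forall>y. (1 \<le> j \<longrightarrow> W j < y) \<longrightarrow> (j < n \<longrightarrow> y < W (Suc j)) \<longrightarrow>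
     0 < (-1)^(n - j) * poly f y)"

text \<open>The virtual roots \<open>U\<close> of the derivative are bound existentially, since
  neither their existence nor their uniqueness is known yet. The number \<open>n\<close> stands for
  the degree but is not tied to \<open>degree f\<close>.\<close>

primrec virtual_roots :: "nat \<Rightarrow> 'a::linordered_field poly \<Rightarrow> (nat \<Rightarrow> 'a) \<Rightarrow> bool" where
  "virtual_roots 0 f W \<longleftrightarrow> True"
| "virtual_roots (Suc n) f W \<longleftrightarrow> (\<exists>U. virtual_roots n (smult (inverse (of_nat (Suc n))) (pderiv f)) U \<and>
     (\<forall>j\<in>{1..Suc n}. virtual_root_conds (Suc n) f U j (W j)))"

text \<open>A strict inequality \<open>u < x\<close> or \<open>x < v\<close> allows the factor
  \<open>x - u\<close> or \<open>v - x\<close> to be cancelled in (V2). The guarded premises treat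
  the missing neighbour of an outermost root as infinite; there the end conditions of (V2) give the
  same sign.\<close>

lemma virtual_root_condsD:
  fixes f :: "'a::linordered_field poly"
  assumes "virtual_root_conds (Suc n) f U j x" "1 \<le> j" "j \<le> Suc n"
  shows "2 \<le> j \<Longrightarrow> U (j - 1) \<le> x" "j \<le> n \<Longrightarrow> x \<le> U j"
    "\<lbrakk>2 \<le> j \<Longrightarrow> U (j - 1) < x\<rbrakk> \<Longrightarrow> (-1)^(Suc n - j) * poly f x \<le> 0"
    "\<lbrakk>j \<le> n \<Longrightarrow> x < U j\<rbrakk> \<Longrightarrow> 0 \<le> (-1)^(Suc n - j) * poly f x"
proof -
  let ?s = "(-1)^(Suc n - j) :: 'a"
  show "2 \<le> j \<Longrightarrow> U (j - 1) \<le> x" "j \<le> n \<Longrightarrow> x \<le> U j"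
    using assms(1) by (auto simp: virtual_root_conds_def Let_def)
  show "(-1)^(Suc n - j) * poly f x \<le> 0" if *: "2 \<le> j \<Longrightarrow> U (j - 1) < x"
  proof (cases "j = 1")
    case True
    then have "0 \<le> (-1)^(Suc n) * poly f x" using assms(1) by (auto simp: virtual_root_conds_def Let_def)
    then show ?thesis using True by simp
  next
    case False
    then have j: "2 \<le> j" using assms by simp
    then have "?s * (x - U (j - 1)) * poly f x \<le> 0" using assms(1) by (auto simp: virtual_root_conds_def Let_def)
    then have "(x - U (j - 1)) * (?s * poly f x) \<le> 0" by (simp only: mult_ac)
    then show ?thesis using *[OF j] by (simp add: mult_le_0_iff)
  qed
  show "0 \<le> (-1)^(Suc n - j) * poly f x" if *: "j \<le> n \<Longrightarrow> x < U j"
  proof (cases "j = Suc n")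
    case True
    then show ?thesis using assms(1) by (auto simp: virtual_root_conds_def Let_def)
  next
    case False
    then have j: "j \<le> n" using assms by simp
    then have "0 \<le> ?s * (U j - x) * poly f x" using assms(1) by (auto simp: virtual_root_conds_def Let_def)
    then have "0 \<le> (U j - x) * (?s * poly f x)" by (simp only: mult_ac)
    then show ?thesis using *[OF j] by (simp add: zero_le_mult_iff)
  qed
qed

text \<open>After \<open>j - 1\<close> of its \<open>n\<close> virtual roots, \<open>f'\<close> has
  the sign \<open>(-1)^(n - (j - 1))\<close>, which is \<open>(-1)^(Suc n - j)\<close>. So on the
  \<open>j\<close>-th piece \<open>f\<close> is strictly monotone in the direction of the sign
  \<open>\<sigma>\<close> that (V2) attaches to the \<open>j\<close>-th virtual root.\<close>

lemma sign_monotone: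
  fixes f :: "'a::linordered_field poly"
  assumes ivt: "ivt n TYPE('a)" and deg: "degree f \<le> Suc n"
    and sg: "sign_pattern n (smult (inverse (of_nat (Suc n))) (pderiv f)) U"
    and j: "1 \<le> j" "j \<le> Suc n" and ab: "a < b"
    and lo: "2 \<le> j \<Longrightarrow> U (j - 1) \<le> a" and hi: "j \<le> n \<Longrightarrow> b \<le> U j"
  shows "(-1)^(Suc n - j) * poly f a < (-1)^(Suc n - j) * poly f b"
proof (rule ivt_strict_mono_sign[OF ivt deg _ ab])
  fix z assume z: "a < z" "z < b"
  let ?s = "(-1)^(Suc n - j) :: 'a"
  have "n - (j - 1) = Suc n - j" using j by simp
  moreover have "0 < (-1)^(n - (j-1)) * poly (smult (inverse (of_nat (Suc n))) (pderiv f)) z"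
  proof -
    have "1 \<le> j - 1 \<longrightarrow> U (j - 1) < z"
    proof
      assume "1 \<le> j - 1"
      then have "2 \<le> j" by simp
      from lo[OF this] z(1) show "U (j - 1) < z" by simp
    qed
    moreover have "j - 1 < n \<longrightarrow> z < U (Suc (j - 1))" "j - 1 \<le> n"
      using z(2) j hi by (auto intro: less_le_trans)
    ultimately show ?thesis using sg unfolding sign_pattern_def by blast
  qed
  ultimately have "0 < ?s * (inverse (of_nat (Suc n)) * poly (pderiv f) z)" by simp
  also have "\<dots> = inverse (of_nat (Suc n)) * (?s * poly (pderiv f) z)" by (simp only: mult_ac)
  finally show "0 < ?s * poly (pderiv f) z"
    by (simp only: zero_less_mult_iff) (auto simp: add_nonneg_pos add_pos_nonneg less_le_not_le)
qed

text \<open>\<open>U j\<close> separates \<open>W j\<close> from \<open>W (Suc j)\<close>. A point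
  up to \<open>U j\<close> is compared with \<open>W j\<close>, a point from \<open>U j\<close> on
  with \<open>W (Suc j)\<close>, each within one monotone piece: (V2) gives the weak sign at the
  virtual root, monotonicity makes it strict.\<close>

lemma sign_pattern_step:
  fixes f :: "'a::linordered_field poly"
  assumes ivt: "ivt n TYPE('a)" and deg: "degree f \<le> Suc n"
    and sg: "sign_pattern n (smult (inverse (of_nat (Suc n))) (pderiv f)) U"
    and W: "\<And>j. 1 \<le> j \<Longrightarrow> j \<le> Suc n \<Longrightarrow> virtual_root_conds (Suc n) f U j (W j)"
  shows "sign_pattern (Suc n) f W"
  unfolding sign_pattern_def
proof (intro allI impI)
  fix j y assume j: "j \<le> Suc n" and lo: "1 \<le> j \<longrightarrow> W j < y" and hi: "j < Suc n \<longrightarrow> y < W (Suc j)"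
  note mono = sign_monotone[OF ivt deg sg]
  consider "1 \<le> j" "j \<le> n \<Longrightarrow> y \<le> U j" | "j \<le> n" "1 \<le> j \<Longrightarrow> U j \<le> y"
    using j by (cases "j = 0"; cases "j = Suc n") force+
  then show "0 < (-1)^(Suc n - j) * poly f y"
  proof cases
    case 1
    note V = virtual_root_condsD[OF W[OF 1(1) j] 1(1) j]
    have "(-1)^(Suc n - j) * poly f (W j) < (-1)^(Suc n - j) * poly f y"
      using mono[OF 1(1) j, of "W j" y] lo 1 V(1) by auto
    moreover have "0 \<le> (-1)^(Suc n - j) * poly f (W j)" using V(4) lo 1 by force
    ultimately show ?thesis by simp
  next
    case 2
    have j': "1 \<le> Suc j" "Suc j \<le> Suc n" using 2 by auto
    note V = virtual_root_condsD[OF W[OF j'] j']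
    have "(-1)^(Suc n - Suc j) * poly f y < (-1)^(Suc n - Suc j) * poly f (W (Suc j))"
      using mono[OF j', of y "W (Suc j)"] hi 2 V(2) by auto
    moreover have "(-1)^(Suc n - Suc j) * poly f (W (Suc j)) \<le> 0" using V(3) hi 2 by force
    ultimately have "(-1)^(Suc n - Suc j) * poly f y < 0" by simp
    moreover have "Suc n - j = Suc (Suc n - Suc j)" using 2 by simp
    ultimately show ?thesis by simp
  qed
qed

text \<open>A point different from all \<open>W j\<close> lies strictly inside a region of known
  sign, found from the last \<open>W j\<close> below it; the index \<open>0\<close> keeps the set of
  candidates nonempty.\<close>

lemma sign_pattern_root:
  fixes f :: "'a::linordered_field poly"
  assumes "sign_pattern n f W" "poly f y = 0"
  shows "\<exists>j\<in>{1..n}. y = W j"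
proof (rule ccontr)
  assume *: "\<not> ?thesis"
  define J where "J = {j. j \<le> n \<and> (j = 0 \<or> W j < y)}"
  have J: "finite J" "0 \<in> J" unfolding J_def by auto
  define j where "j = Max J"
  have "j \<in> J" using J unfolding j_def by (intro Max_in) auto
  moreover have "y < W (Suc j)" if "j < n"
  proof (rule ccontr)
    assume "\<not> y < W (Suc j)"
    moreover have "y \<noteq> W (Suc j)" using * that by auto
    ultimately have "Suc j \<in> J" using that unfolding J_def by auto
    then have "Suc j \<le> j" unfolding j_def using J by (intro Max_ge) auto
    then show False by simp
  qed
  ultimately have "0 < (-1)^(n - j) * poly f y" using assms(1) unfolding sign_pattern_def J_def by auto
  then show False using assms(2) by simp
qed

text \<open>Cutting at a \<open>U i\<close> inside the interval leaves a sign change on one side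
  with fewer such points, unless \<open>U i\<close> is itself a root. When none is left,
  \<open>f\<close> is monotone on the interval; the virtual root \<open>W j\<close> of that piece
  cannot lie outside it, and inside it the two inequalities of (V2) force
  \<open>f(W j) = 0\<close>.\<close>

lemma sign_change_root:
  fixes f :: "'a::linordered_field poly"
  assumes ivt: "ivt n TYPE('a)" and deg: "degree f \<le> Suc n"
    and sg: "sign_pattern n (smult (inverse (of_nat (Suc n))) (pderiv f)) U"
    and W: "\<And>j. 1 \<le> j \<Longrightarrow> j \<le> Suc n \<Longrightarrow> virtual_root_conds (Suc n) f U j (W j)"
    and "a < b" and "t = 1 \<or> t = -1" "t * poly f a < 0" "0 < t * poly f b"
  shows "\<exists>c. a < c \<and> c < b \<and> poly f c = 0"
  using assms(5,7,8)
proof (induction "card {j\<in>{1..n}. a < U j \<and> U j < b}" arbitrary: a b rule: less_induct)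
  case less
  show ?case
  proof (cases "\<exists>j\<in>{1..n}. a < U j \<and> U j < b")
    case True
    then obtain i where i: "i \<in> {1..n}" "a < U i" "U i < b" by blast
    consider "t * poly f (U i) = 0" | "t * poly f (U i) > 0" | "t * poly f (U i) < 0" by linarith
    then show ?thesis
    proof cases
      case 2
      have "card {j\<in>{1..n}. a < U j \<and> U j < U i} < card {j\<in>{1..n}. a < U j \<and> U j < b}"
        using i by (intro psubset_card_mono) auto
      from less.hyps[OF this i(2) less.prems(2) 2] i show ?thesis by (meson less_trans)
    next
      case 3
      have "card {j\<in>{1..n}. U i < U j \<and> U j < b} < card {j\<in>{1..n}. a < U j \<and> U j < b}"
        using i by (intro psubset_card_mono) auto
      from less.hyps[OF this i(3) 3 less.prems(3)] i show ?thesis by (meson less_trans)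
    qed (use i assms(6) in auto)
  next
    case False
    \<comment> \<open>\<open>k\<close> is the last index with \<open>U k \<le> a\<close>, or
      \<open>0\<close> if there is none, so \<open>j = k + 1\<close> numbers the monotone piece that
      contains the interval.\<close>
    define J where "J = {j. j \<le> n \<and> (j = 0 \<or> U j \<le> a)}"
    have J: "finite J" "0 \<in> J" unfolding J_def by auto
    define k where "k = Max J"
    define j where "j = Suc k"
    have kJ: "k \<in> J" using J unfolding k_def by (intro Max_in) auto
    have j: "1 \<le> j" "j \<le> Suc n" using kJ unfolding J_def j_def by auto
    have lo: "U (j - 1) \<le> a" if "2 \<le> j" using kJ that unfolding J_def j_def by auto
    have hi: "b \<le> U j" if "j \<le> n"
    proof (rule ccontr)
      assume "\<not> ?thesis"
      then have "j \<in> J" using False that j unfolding J_def by force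
      then have "j \<le> k" unfolding k_def using J by (intro Max_ge) auto
      then show False unfolding j_def by simp
    qed
    note mono = sign_monotone[OF ivt deg sg j]
    let ?s = "(-1)^(Suc n - j) :: 'a"
    \<comment> \<open>Since \<open>t f\<close> rises from \<open>a\<close> to \<open>b\<close> as
      well, the sign of the piece must be \<open>t\<close>.\<close>
    have "?s * poly f a < ?s * poly f b" using mono[of a b] lo hi less.prems by auto
    then have s: "?s = t" using less.prems assms(6) by (cases "even (Suc n - j)") auto
    note V = virtual_root_condsD[OF W[OF j] j, unfolded s, simplified]
    have xa: "a < W j"
    proof (rule ccontr)
      assume "\<not> ?thesis"
      then have *: "W j \<le> a" by simp
      then have "0 \<le> t * poly f (W j)" using V(4) hi less.prems(1) by force
      moreover have "t * poly f (W j) \<le> t * poly f a"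
        using mono[of "W j" a, unfolded s] * V(1) hi less.prems(1) by (cases "W j = a") force+
      ultimately show False using less.prems by simp
    qed
    have xb: "W j < b"
    proof (rule ccontr)
      assume "\<not> ?thesis"
      then have *: "b \<le> W j" by simp
      then have "t * poly f (W j) \<le> 0" using V(3) lo less.prems(1) by force
      moreover have "t * poly f b \<le> t * poly f (W j)"
        using mono[of b "W j", unfolded s] * V(2) lo less.prems(1) by (cases "W j = b") force+
      ultimately show False using less.prems by simp
    qed
    have "t * poly f (W j) = 0" using V(3,4) lo hi xa xb by (intro antisym) force+
    then show ?thesis using xa xb assms(6) by auto
  qed
qed

lemma virtual_roots_sign_pattern:
  fixes f :: "'a::linordered_field poly"
  assumes "ivt n TYPE('a)" "lead_coeff f = 1" "degree f \<le> Suc n" "virtual_roots (degree f) f W"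
  shows "sign_pattern (degree f) f W"
  using assms(2-)
proof (induction "degree f" arbitrary: f W)
  case 0
  then have "f = 1" by (metis degree_0_id one_pCons)
  then show ?case by (auto simp: sign_pattern_def)
next
  case (Suc d)
  define g where "g = smult (inverse (of_nat (Suc d))) (pderiv f)"
  have dg: "degree g = d" using Suc.hyps(2) by (simp add: g_def degree_pderiv del: of_nat_Suc)
  have lg: "lead_coeff g = 1" unfolding dg
    using Suc.hyps(2) Suc.prems(1) by (simp add: g_def coeff_pderiv del: of_nat_Suc)
  obtain U where U: "virtual_roots d g U" "\<And>j. j \<in> {1..Suc d} \<Longrightarrow> virtual_root_conds (Suc d) f U j (W j)"
    using Suc.prems(3) unfolding Suc.hyps(2)[symmetric] g_def by auto
  have "sign_pattern d g U" using Suc.hyps(1)[of g U] dg lg U(1) Suc.prems(2) Suc.hyps(2) by simp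
  moreover have "ivt d TYPE('a)" using assms(1) Suc.prems(2) Suc.hyps(2) unfolding ivt_def by auto
  ultimately show ?case using sign_pattern_step[of d f U W] U(2) Suc.hyps(2) unfolding g_def by auto
qed

text \<open>Every polynomial is, up to a constant and a rescaling of the variable, monic with
  coefficients in \<open>B\<close>, so the intermediate value theorem only needs virtual roots over \<open>B\<close>.\<close>
locale fraction_subring =
  fixes B :: "'a::linordered_field set"
  assumes one_B: "1 \<in> B" and add_B: "a \<in> B \<Longrightarrow> b \<in> B \<Longrightarrow> a + b \<in> B"
    and minus_B: "a \<in> B \<Longrightarrow> - a \<in> B" and mult_B: "a \<in> B \<Longrightarrow> b \<in> B \<Longrightarrow> a * b \<in> B"
    and denominator_B: "\<exists>s\<in>B. s \<noteq> 0 \<and> s * x \<in> B"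
begin

lemma zero_B: "0 \<in> B"
  using add_B[OF one_B minus_B[OF one_B]] by simp

lemma power_B: "a \<in> B \<Longrightarrow> a ^ n \<in> B"
  by (induction n) (auto intro: one_B mult_B)

lemma common_denominator: "\<exists>s\<in>B. s > 0 \<and> (\<forall>i. s * coeff q i \<in> B)"
proof (induction q)
  case 0
  then show ?case using one_B zero_B by (intro bexI[of _ 1]) auto
next
  case (pCons a q)
  then obtain s where s: "s \<in> B" "s > 0" "\<And>i. s * coeff q i \<in> B" by blast
  obtain t where t: "t \<in> B" "t \<noteq> 0" "t * a \<in> B" using denominator_B by blast
  \<comment> \<open>\<open>t\<close> may be negative; its square keeps the common denominator
    positive.\<close>
  have "s * (t * t) * coeff (pCons a q) i \<in> B" for i
  proof (cases i)
    case 0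
    have "(s * t) * (t * a) \<in> B" by (rule mult_B[OF mult_B[OF s(1) t(1)] t(3)])
    then show ?thesis using 0 by (simp add: mult_ac)
  next
    case (Suc k)
    have "(t * t) * (s * coeff q k) \<in> B" by (rule mult_B[OF mult_B[OF t(1) t(1)] s(3)])
    then show ?thesis using Suc by (simp add: mult_ac)
  qed
  moreover have "s * (t * t) > 0" using s t by (metis mult_pos_pos not_square_less_zero linorder_neqE_linordered_idom mult_eq_0_iff)
  moreover have "s * (t * t) \<in> B" using s t by (intro mult_B)
  ultimately show ?case by blast
qed

text \<open>With \<open>q\<close> the monic multiple of \<open>p\<close>, the polynomial
  \<open>f(X) = s^n q(X / s)\<close> has the coefficients \<open>s^(n - i) q_i\<close>: the leading
  one stays \<open>1\<close>, every other one contains a factor \<open>s\<close> that clears its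
  denominator. As \<open>s > 0\<close>, the order of sample points and roots is preserved.\<close>

lemma rescale_to_monic:
  fixes p :: "'a poly"
  assumes "degree p = n" "n > 0"
  shows "\<exists>f c s. lead_coeff f = 1 \<and> degree f = n \<and> (\<forall>i. coeff f i \<in> B) \<and> c \<noteq> 0 \<and> s > 0 \<and>
    (\<forall>x. poly f (s * x) = c * poly p x)"
proof -
  have p0: "lead_coeff p \<noteq> 0" "p \<noteq> 0" using assms by auto
  define q where "q = smult (inverse (lead_coeff p)) p"
  obtain s where s: "s \<in> B" "s > 0" "\<And>i. s * coeff q i \<in> B" using common_denominator by blast
  define f where "f = smult (s ^ n) (pcompose q [:0, inverse s:])"
  have cf: "coeff f i = s ^ n * (inverse s ^ i * coeff q i)" for i
    unfolding f_def by (simp add: coeff_pcompose_linear)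
  have dq: "degree q = n" "coeff q n = 1" using assms p0 by (auto simp: q_def)
  have df: "degree f = n" using s dq by (simp add: f_def degree_pcompose)
  have "lead_coeff f = 1" using s dq by (simp add: df cf power_inverse)
  moreover have "coeff f i \<in> B" for i
  proof -
    consider "i = n" | "i < n" | "i > n" by linarith
    then show ?thesis
    proof cases
      case 2
      then have "s ^ n = s ^ (n - i - 1) * s * s ^ i" by (metis (no_types, lifting) Suc_diff_Suc diff_Suc_1 diff_add_inverse2 diff_le_self le_add_diff_inverse2 less_imp_le_nat power_Suc2 power_add diff_Suc_eq_diff_pred)
      then have "coeff f i = s ^ (n - i - 1) * (s * coeff q i)"
        using s by (simp add: cf power_inverse field_simps)
      then show ?thesis using mult_B[OF power_B[OF s(1)] s(3)] by simp
    qed (use dq s df \<open>lead_coeff f = 1\<close> in \<open>auto simp: cf one_B zero_B power_inverse coeff_eq_0\<close>)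
  qed
  moreover have "poly f (s * x) = (s ^ n * inverse (lead_coeff p)) * poly p x" for x
  proof -
    have *: "s * x * inverse s = x" using s by simp
    have "poly f (s * x) = (s ^ n * inverse (lead_coeff p)) * poly p (s * x * inverse s)"
      by (simp add: f_def q_def poly_pcompose)
    then show ?thesis by (simp only: *)
  qed
  ultimately show ?thesis using df s p0 by (intro exI[of _ f] exI[of _ "s ^ n * inverse (lead_coeff p)"] exI[of _ s]) auto
qed

context
  assumes vr: "\<And>f. lead_coeff f = 1 \<Longrightarrow> (\<And>i. coeff f i \<in> B) \<Longrightarrow>
    \<exists>W. (\<forall>j\<in>{1..degree f}. W j \<in> B) \<and> virtual_roots (degree f) f W"
begin

text \<open>With \<open>ivt n\<close> the derivative of a monic \<open>f\<close> of degree
  \<open>n + 1\<close> has the expected sign pattern, and then the virtual roots of \<open>f\<close>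
  supply a root at every sign change, which is \<open>ivt (Suc n)\<close>.\<close>

lemma ivt_all: "ivt n TYPE('a)"
proof (induction n)
  case 0
  have False if "degree p \<le> 0" "poly p a < 0" "0 < poly p b" for p :: "'a poly" and a b
    using that by (auto elim!: degree_eq_zeroE)
  then show ?case unfolding ivt_def by blast
next
  case (Suc n)
  have monic: "\<exists>c. a < c \<and> c < b \<and> poly f c = 0"
    if f: "lead_coeff f = 1" "\<And>i. coeff f i \<in> B" "degree f = Suc n" and ab: "a < b" "poly f a * poly f b < 0" for f a b
  proof -
    define g where "g = smult (inverse (of_nat (Suc n))) (pderiv f)"
    have dg: "degree g = n" using f(3) by (simp add: g_def degree_pderiv del: of_nat_Suc)
    have lg: "lead_coeff g = 1" unfolding dg using f by (simp add: g_def coeff_pderiv del: of_nat_Suc)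
    obtain W where "virtual_roots (Suc n) f W" using vr[OF f(1,2)] f(3) by auto
    then obtain U where U: "virtual_roots n g U"
       "\<And>j. j \<in> {1..Suc n} \<Longrightarrow> virtual_root_conds (Suc n) f U j (W j)" unfolding g_def by auto
    have sg: "sign_pattern n g U" using virtual_roots_sign_pattern[OF Suc.IH lg, of U] U(1) dg by simp
    note root = sign_change_root[OF Suc.IH _ sg[unfolded g_def] U(2) ab(1)]
    show ?thesis
    proof (cases "poly f a < 0")
      case True
      then show ?thesis using root[of 1] ab(2) f(3) by (auto simp: mult_less_0_iff)
    next
      case False
      then show ?thesis using root[of "-1"] ab(2) f(3) by (auto simp: mult_less_0_iff)
    qed
  qed
  have "\<exists>c. a < c \<and> c < b \<and> poly p c = 0"
    if p: "degree p \<le> Suc n" "a < b" "poly p a < 0" "0 < poly p b" for p :: "'a poly" and a b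
  proof (cases "degree p = Suc n")
    case True
    then obtain f c s where f: "lead_coeff f = 1" "degree f = Suc n" "\<And>i. coeff f i \<in> B" "c \<noteq> 0" "s > 0"
      "\<And>x. poly f (s * x) = c * poly p x"
      using rescale_to_monic[of p "Suc n"] by auto
    \<comment> \<open>The constant \<open>c\<close> may be negative, so only the product of the two
      values has a known sign.\<close>
    have "poly f (s * a) * poly f (s * b) = (c * c) * (poly p a * poly p b)" by (simp add: f(6))
    also have "\<dots> < 0" using p f(4) by (intro mult_pos_neg mult_neg_pos) (auto simp: zero_less_mult_iff linorder_neq_iff)
    finally obtain z where "s * a < z" "z < s * b" "poly f z = 0"
      using monic[OF f(1,3,2), of "s * a" "s * b"] p(2) f(5) by auto
    then show ?thesis using f(4,5) f(6)[of "z / s"] by (intro exI[of _ "z / s"]) (auto simp: field_simps)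
  next
    case False
    then show ?thesis using p Suc.IH unfolding ivt_def by auto
  qed
  then show ?case unfolding ivt_def by blast
qed

lemma integral_in_B:
  assumes "lead_coeff f = 1" "\<And>i. coeff f i \<in> B" "poly f y = 0"
  shows "y \<in> B"
proof -
  obtain W where "\<forall>j\<in>{1..degree f}. W j \<in> B" "virtual_roots (degree f) f W" using vr assms by blast
  then show ?thesis
    using sign_pattern_root[OF virtual_roots_sign_pattern[OF ivt_all assms(1), of "degree f" W] assms(3)] by auto
qed

text \<open>The end conditions of (V2) provide the two sample points, in place of an estimate for
  large arguments: \<open>f \<ge> 0\<close> at the last virtual root and, the degree being odd,
  \<open>f \<le> 0\<close> at the first.\<close>

lemma odd_degree_root:
  fixes p :: "'a poly"
  assumes "odd (degree p)"
  shows "\<exists>y. poly p y = 0"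
proof -
  obtain f c s where f: "lead_coeff f = 1" "degree f = degree p" "\<And>i. coeff f i \<in> B" "c \<noteq> 0" "s > 0"
    "\<And>x. poly f (s * x) = c * poly p x"
    using rescale_to_monic[of p "degree p"] odd_pos[OF assms] by blast
  obtain W where W: "virtual_roots (degree f) f W" using vr f by blast
  obtain n where n: "degree f = Suc n" using odd_pos[OF assms] f(2) by (metis gr0_implies_Suc)
  have "\<exists>U. virtual_root_conds (Suc n) f U (Suc n) (W (Suc n)) \<and> virtual_root_conds (Suc n) f U 1 (W 1)"
  proof -
    obtain U where "\<forall>j\<in>{1..Suc n}. virtual_root_conds (Suc n) f U j (W j)" using W unfolding n by auto
    then show ?thesis by (intro exI[of _ U]) (auto dest: bspec[of _ _ "Suc n"] bspec[of _ _ 1])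
  qed
  then have "0 \<le> poly f (W (Suc n))" "poly f (W 1) \<le> 0"
    using assms n f(2) by (auto simp: virtual_root_conds_def Let_def)
  moreover have "\<exists>y. poly f y = 0" if "poly f (W 1) < 0" "0 < poly f (W (Suc n))"
  proof (cases "W 1" "W (Suc n)" rule: linorder_cases)
    case less
    then show ?thesis using ivtD[OF ivt_all order_refl, of _ _ f] that by (meson mult_neg_pos)
  next
    case greater
    then show ?thesis using ivtD[OF ivt_all order_refl, of _ _ f] that by (meson mult_pos_neg)
  qed (use that in auto)
  ultimately obtain y where "poly f y = 0" by force
  then show ?thesis using f(4,5) f(6)[of "y / s"] by (intro exI[of _ "y / s"]) auto
qed

end
end

section \<open>Existence and uniqueness of virtual roots over an ordered field\<close>

lemma virtual_roots_sorted:
  assumes "virtual_roots n f W" "1 \<le> i" "i < n"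
  shows "W i \<le> W (Suc i)"
proof -
  obtain m where n: "n = Suc m" using assms by (cases n) auto
  obtain U where U: "\<And>j. j \<in> {1..n} \<Longrightarrow> virtual_root_conds n f U j (W j)"
    using assms(1) unfolding n virtual_roots.simps by blast
  have "W i \<le> U i" "U i \<le> W (Suc i)"
    using U[of i] U[of "Suc i"] assms unfolding virtual_root_conds_def Let_def by auto
  then show ?thesis by simp
qed

text \<open>Two solutions \<open>x < y\<close> lie on one piece, where \<open>\<sigma> f\<close>
  strictly increases; but \<open>x < v\<close> forces \<open>\<sigma> f(x) \<ge> 0\<close>, and
  \<open>u < y\<close> forces \<open>\<sigma> f(y) \<le> 0\<close>.\<close>

lemma virtual_root_unique:
  fixes f :: "'a::linordered_field poly"
  assumes ivt: "ivt n TYPE('a)" and deg: "degree f \<le> Suc n"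
    and sg: "sign_pattern n (smult (inverse (of_nat (Suc n))) (pderiv f)) U"
    and j: "1 \<le> j" "j \<le> Suc n"
    and xy: "virtual_root_conds (Suc n) f U j x" "virtual_root_conds (Suc n) f U j y"
  shows "x = y"
proof -
  have False if x: "virtual_root_conds (Suc n) f U j x" and y: "virtual_root_conds (Suc n) f U j y" and "x < y" for x y
  proof -
    note V = virtual_root_condsD[OF x j] and W = virtual_root_condsD[OF y j]
    have "(-1)^(Suc n - j) * poly f x < (-1)^(Suc n - j) * poly f y"
      using sign_monotone[OF ivt deg sg j that(3)] V(1) W(2) by auto
    moreover have "0 \<le> (-1)^(Suc n - j) * poly f x" using V(4) W(2) that(3) by force
    moreover have "(-1)^(Suc n - j) * poly f y \<le> 0" using V(1) W(3) that(3) by force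
    ultimately show False by simp
  qed
  then show ?thesis using xy by (meson linorder_neqE_linordered_idom)
qed

lemma poly_ge_lead_coeff:
  fixes p :: "'a::linordered_field poly"
  assumes "lead_coeff p > 0"
  shows "\<exists>N. \<forall>x\<ge>N. lead_coeff p \<le> poly p x"
  using assms
proof (induction p)
  case (pCons a p)
  show ?case
  proof (cases "p = 0")
    case False
    then obtain N where N: "\<And>x. x \<ge> N \<Longrightarrow> lead_coeff p \<le> poly p x" and l: "lead_coeff p > 0"
      using pCons by auto
    define M where "M = max N (1 + \<bar>a\<bar> / lead_coeff p)"
    have "lead_coeff p \<le> poly (pCons a p) x" if x: "x \<ge> M" for x
    proof -
      have 1: "1 + \<bar>a\<bar> / lead_coeff p \<le> x" "N \<le> x" using x by (auto simp: M_def)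
      have "lead_coeff p + \<bar>a\<bar> = (1 + \<bar>a\<bar> / lead_coeff p) * lead_coeff p" using False by (simp add: distrib_right)
      also have "\<dots> \<le> x * poly p x"
      proof (rule mult_mono)
        show "0 \<le> x" using 1(1) l by (smt (verit, ccfv_SIG) abs_ge_zero add_increasing2 divide_nonneg_pos order_trans zero_le_one)
      qed (use 1 l N[OF 1(2)] in auto)
      finally show ?thesis using False by (simp add: abs_if split: if_splits)
    qed
    then show ?thesis using False by auto
  next
    case True
    then show ?thesis by (intro exI[of _ 0]) auto
  qed
qed auto

text \<open>On the \<open>j\<close>-th piece \<open>\<sigma> f\<close> increases from
  \<open>u\<close> to \<open>v\<close>: take \<open>u\<close> if the value there is already
  nonnegative, \<open>v\<close> if the value there is still nonpositive, and otherwise a root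
  between them. The conclusion records which kind of element was found, since this is what later
  shows it to be integral.\<close>

lemma virtual_root_exists:
  fixes f :: "'a::linordered_field poly"
  assumes ivt: "\<And>n. ivt n TYPE('a)" and f: "degree f = Suc n" "lead_coeff f = 1"
    and sg: "sign_pattern n (smult (inverse (of_nat (Suc n))) (pderiv f)) U"
    and sorted: "\<And>i. 1 \<le> i \<Longrightarrow> i < n \<Longrightarrow> U i \<le> U (Suc i)"
    and j: "1 \<le> j" "j \<le> Suc n"
  shows "\<exists>x. virtual_root_conds (Suc n) f U j x \<and> (x \<in> U ` {1..n} \<or> poly f x = 0)"
proof -
  define s :: 'a where "s = (-1)^(Suc n - j)"
  have ss: "s = 1 \<or> s = -1" unfolding s_def by (cases "even (Suc n - j)") auto
  have uv: "U (j - 1) \<le> U j" if "2 \<le> j" "j \<le> n" using sorted[of "j - 1"] that by auto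
  have fuv: "s * poly f (U (j - 1)) \<le> s * poly f (U j)" if "2 \<le> j" "j \<le> n"
  proof (cases "U (j - 1) = U j")
    case False
    then show ?thesis using sign_monotone[OF ivt _ sg j, of "U (j-1)" "U j"] uv that f unfolding s_def by auto
  qed auto
  have conds: "virtual_root_conds (Suc n) f U j x" if
    "2 \<le> j \<Longrightarrow> U (j - 1) \<le> x \<and> (x - U (j - 1)) * (s * poly f (U (j - 1))) \<le> 0 \<and> (x - U (j - 1)) * (s * poly f x) \<le> 0"
    "j \<le> n \<Longrightarrow> x \<le> U j \<and> 0 \<le> (U j - x) * (s * poly f (U j)) \<and> 0 \<le> (U j - x) * (s * poly f x)"
    "j = Suc n \<Longrightarrow> 0 \<le> s * poly f x" "j = 1 \<Longrightarrow> s * poly f x \<le> 0" for x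
    using that unfolding virtual_root_conds_def s_def Let_def by (auto simp: mult_ac)
  consider "2 \<le> j" "0 \<le> s * poly f (U (j - 1))" | "j \<le> n" "s * poly f (U j) \<le> 0"
    | "2 \<le> j \<Longrightarrow> s * poly f (U (j - 1)) < 0" "j \<le> n \<Longrightarrow> 0 < s * poly f (U j)" by force
  then show ?thesis
  proof cases
    case 1
    have "virtual_root_conds (Suc n) f U j (U (j - 1))"
      using 1 uv fuv by (intro conds) (auto intro!: mult_nonneg_nonneg intro: order_trans)
    moreover have "U (j - 1) \<in> U ` {1..n}" using 1 j by (intro imageI) auto
    ultimately show ?thesis by blast
  next
    case 2
    have "virtual_root_conds (Suc n) f U j (U j)"
    proof (intro conds)
      assume j2: "2 \<le> j"
      have "(U j - U (j - 1)) * (s * poly f (U (j - 1))) \<le> 0"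
        using uv[OF j2 2(1)] order_trans[OF fuv[OF j2 2(1)] 2(2)] by (auto intro: mult_nonneg_nonpos)
      moreover have "(U j - U (j - 1)) * (s * poly f (U j)) \<le> 0"
        using uv[OF j2 2(1)] 2(2) by (auto intro: mult_nonneg_nonpos)
      ultimately show "U (j - 1) \<le> U j \<and> (U j - U (j - 1)) * (s * poly f (U (j - 1))) \<le> 0 \<and>
          (U j - U (j - 1)) * (s * poly f (U j)) \<le> 0" using uv[OF j2 2(1)] by blast
    qed (use 2 in auto)
    moreover have "U j \<in> U ` {1..n}" using 2 j by (intro imageI) auto
    ultimately show ?thesis by blast
  next
    case 3
    obtain a where a: "2 \<le> j \<Longrightarrow> a = U (j - 1)" "j = 1 \<Longrightarrow> j \<le> n \<Longrightarrow> a < U j" "s * poly f a < 0"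
    proof (cases "2 \<le> j")
      case False
      then have j1: "j = 1" using j by simp
      \<comment> \<open>For \<open>j = 1\<close> there is no left end. Reflecting the variable and
        multiplying by \<open>- s\<close> gives a monic polynomial again, so a large argument of
        \<open>h\<close> yields a point \<open>a\<close> with \<open>s f(a) < 0\<close>.\<close>
      define h where "h = smult (- s) (pcompose f [:0, -1:])"
      have dh: "degree h = Suc n" using ss f by (auto simp: h_def degree_pcompose)
      have "coeff h (Suc n) = - s * (-1)^(Suc n)" unfolding h_def coeff_smult coeff_pcompose_linear
        using f by simp
      also have "\<dots> = 1" using j1 unfolding s_def by (simp flip: power_add)
      finally have "lead_coeff h = 1" using dh by simp
      then obtain N where N: "\<And>x. x \<ge> N \<Longrightarrow> 1 \<le> poly h x" using poly_ge_lead_coeff[of h] by auto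
      have "1 \<le> poly h (max N (- U j + 1))" by (rule N) simp
      then have "s * poly f (- max N (- U j + 1)) \<le> -1" by (simp add: h_def poly_pcompose)
      then show ?thesis using that[of "- max N (- U j + 1)"] False by (auto simp: max_def split: if_splits)
    qed (use 3 in auto)
    obtain b where b: "a < b" "j \<le> n \<Longrightarrow> b = U j" "0 < s * poly f b"
    proof (cases "j \<le> n")
      case True
      have "a < U j"
      proof (cases "2 \<le> j")
        case True': True
        have "a \<noteq> U j" using a 3 True by auto
        then show ?thesis using uv True a(1) True' by force
      qed (use a j True in auto)
      then show ?thesis using that 3 True by auto
    next
      case False
      then have "s = 1" using j unfolding s_def by simp
      obtain N where N: "\<And>x. x \<ge> N \<Longrightarrow> 1 \<le> poly f x" using poly_ge_lead_coeff[of f] f by auto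
      then have "0 < poly f (max N (a + 1))" by (meson less_le_trans max.cobounded1 zero_less_one)
      then show ?thesis using that[of "max N (a + 1)"] False \<open>s = 1\<close> by (auto simp: max_def split: if_splits)
    qed
    have "poly f a * poly f b < 0" using a(3) b(3) ss by (auto simp: mult_less_0_iff)
    then obtain x where x: "a < x" "x < b" "poly f x = 0" using ivtD[OF ivt order_refl b(1)] by blast
    have "virtual_root_conds (Suc n) f U j x"
      using x a(1) b(2) 3 by (intro conds) (auto intro: mult_nonneg_nonpos)
    then show ?thesis using x by blast
  qed
qed

section \<open>Newton's identities\<close>

definition power_sum :: "'b::comm_ring_1 list \<Rightarrow> nat \<Rightarrow> 'b" where
  "power_sum xs k = (\<Sum>x\<leftarrow>xs. x ^ k)"

text \<open>The reversed polynomial with roots \<open>xs\<close>, as a power series; its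
  coefficients are, up to sign, the elementary symmetric functions of \<open>xs\<close>.\<close>

definition reverse_fps :: "'b::field list \<Rightarrow> 'b fps" where
  "reverse_fps xs = (\<Prod>x\<leftarrow>xs. 1 - fps_const x * fps_X)"

text \<open>A logarithmic derivative: each factor \<open>1 - x X\<close> contributes
  \<open>- x / (1 - x X)\<close>, and \<open>x / (1 - x X)\<close> expands to the geometric series
  \<open>G\<close>.\<close>

lemma fps_deriv_reverse_fps:
  fixes xs :: "'b::field list"
  shows
  "fps_deriv (reverse_fps xs) = - reverse_fps xs * Abs_fps (\<lambda>n. power_sum xs (Suc n))"
proof (induction xs)
  case (Cons x xs)
  define S where "S = Abs_fps (\<lambda>n. power_sum xs (Suc n))"
  define G where "G = Abs_fps (\<lambda>n. x ^ Suc n)"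
  have G: "(1 - fps_const x * fps_X) * G = fps_const x"
  proof (rule fps_ext)
    fix n
    have "(1 - fps_const x * fps_X) * G = G - fps_const x * (fps_X * G)" by (simp add: algebra_simps)
    then show "((1 - fps_const x * fps_X) * G) $ n = fps_const x $ n"
      by (cases n) (auto simp: G_def)
  qed
  have "Abs_fps (\<lambda>n. power_sum (x # xs) (Suc n)) = G + S"
    by (rule fps_ext) (simp add: G_def S_def power_sum_def)
  moreover have "fps_deriv (reverse_fps (x # xs)) =
     - fps_const x * reverse_fps xs - (1 - fps_const x * fps_X) * (reverse_fps xs * S)"
  proof -
    have d: "fps_deriv (1 - fps_const x * fps_X) = - fps_const x" by simp
    have "reverse_fps (x # xs) = (1 - fps_const x * fps_X) * reverse_fps xs" by (simp add: reverse_fps_def)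
    then have "fps_deriv (reverse_fps (x # xs)) =
       (1 - fps_const x * fps_X) * fps_deriv (reverse_fps xs) + - fps_const x * reverse_fps xs"
      by (simp only: fps_deriv_mult d)
    then show ?thesis unfolding Cons.IH S_def[symmetric] by (simp only: mult_minus_left mult_minus_right) simp
  qed
  moreover have "- (u * e) * (g + v) = - (u * g) * e - u * (e * v)" for u e g v :: "'b fps"
    by (simp add: algebra_simps)
  from this[of "1 - fps_const x * fps_X" "reverse_fps xs" G S]
  have "- ((1 - fps_const x * fps_X) * reverse_fps xs) * (G + S) =
     - fps_const x * reverse_fps xs - (1 - fps_const x * fps_X) * (reverse_fps xs * S)"
    by (simp only: G)
  ultimately show ?case by (simp add: reverse_fps_def)
qed (simp add: reverse_fps_def power_sum_def fps_eq_iff)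

lemma reverse_fps_0: "reverse_fps xs $ 0 = 1"
  by (induction xs) (auto simp: reverse_fps_def)

lemma newton:
  "of_nat (Suc n) * reverse_fps xs $ Suc n = - (\<Sum>i=0..n. reverse_fps xs $ i * power_sum xs (Suc (n - i)))"
proof -
  have "fps_deriv (reverse_fps xs) $ n = (- reverse_fps xs * Abs_fps (\<lambda>n. power_sum xs (Suc n))) $ n"
    by (simp only: fps_deriv_reverse_fps)
  then show ?thesis by (simp add: fps_mult_nth sum_negf)
qed

section \<open>Coefficients and power sums in a subfield\<close>

locale subfield_set =
  fixes R :: "'b::field_char_0 set"
  assumes one_R: "1 \<in> R" and add_R: "a \<in> R \<Longrightarrow> b \<in> R \<Longrightarrow> a + b \<in> R"
    and minus_R: "a \<in> R \<Longrightarrow> - a \<in> R" and mult_R: "a \<in> R \<Longrightarrow> b \<in> R \<Longrightarrow> a * b \<in> R"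
    and inverse_R: "a \<in> R \<Longrightarrow> inverse a \<in> R"
begin

lemma zero_R: "0 \<in> R"
  using add_R[OF one_R minus_R[OF one_R]] by simp

lemma of_nat_R: "of_nat n \<in> R"
  by (induction n) (auto intro: zero_R one_R add_R)

lemma sum_R: "(\<And>i. i \<in> I \<Longrightarrow> f i \<in> R) \<Longrightarrow> sum f I \<in> R"
  by (induction I rule: infinite_finite_induct) (auto intro: zero_R add_R)

lemma diff_R: "a \<in> R \<Longrightarrow> b \<in> R \<Longrightarrow> a - b \<in> R"
  using add_R[OF _ minus_R, of a b] by simp

lemma power_sum_R_if:
  assumes "\<And>n. reverse_fps xs $ n \<in> R"
  shows "power_sum xs k \<in> R"
proof (induction k rule: less_induct)
  case (less k)
  show ?case
  proof (cases k)
    case 0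
    have "power_sum xs 0 = of_nat (length xs)"
      unfolding power_sum_def by (induction xs) auto
    then show ?thesis using 0 of_nat_R by simp
  next
    case (Suc n)
    \<comment> \<open>The term \<open>i = 0\<close> has coefficient \<open>1\<close>, so it isolates
      the new power sum.\<close>
    have "of_nat (Suc n) * reverse_fps xs $ Suc n =
      - (power_sum xs (Suc n) + (\<Sum>i=1..n. reverse_fps xs $ i * power_sum xs (Suc (n - i))))"
      unfolding newton by (subst sum.atLeast_Suc_atMost) (auto simp: reverse_fps_0)
    moreover have "P = - N - S" if "N = - (P + S)" for N P S :: 'b using that by simp
    ultimately have "power_sum xs (Suc n) = - (of_nat (Suc n) * reverse_fps xs $ Suc n) -
       (\<Sum>i=1..n. reverse_fps xs $ i * power_sum xs (Suc (n - i)))" by blast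
    also have "\<dots> \<in> R"
      using less assms Suc by (intro diff_R minus_R mult_R of_nat_R sum_R) auto
    finally show ?thesis using Suc by simp
  qed
qed

text \<open>Newton's identity is solved for the new coefficient by dividing by \<open>Suc n\<close>;
  this is where characteristic \<open>0\<close> enters.\<close>

lemma reverse_fps_R_if:
  assumes "\<And>k. power_sum xs k \<in> R"
  shows "reverse_fps xs $ n \<in> R"
proof (induction n rule: less_induct)
  case (less n)
  show ?case
  proof (cases n)
    case 0
    then show ?thesis using reverse_fps_0[of xs] one_R by simp
  next
    case (Suc m)
    have "reverse_fps xs $ Suc m = inverse (of_nat (Suc m)) * (of_nat (Suc m) * reverse_fps xs $ Suc m)"
      by (simp del: of_nat_Suc)
    also have "\<dots> \<in> R" unfolding newton
      using less assms Suc by (intro mult_R inverse_R of_nat_R minus_R sum_R) auto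
    finally show ?thesis using Suc by simp
  qed
qed

lemma coeff_reverse_fps:
  fixes xs :: "'b list"
  defines "p \<equiv> (\<Prod>x\<leftarrow>xs. [:-x, 1:])"
  shows "reverse_fps xs $ n = coeff (reflect_poly p) n" "degree p = length xs" "lead_coeff p = 1"
proof -
  have "fps_of_poly (reflect_poly p) = reverse_fps xs"
    unfolding p_def reverse_fps_def
  proof (induction xs)
    case (Cons x xs)
    have "reflect_poly [:-x, 1:] = [:1, -x:]" by (simp add: reflect_poly_def)
    moreover have "fps_of_poly [:1, -x:] = 1 - fps_const x * fps_X" by (simp add: fps_of_poly_pCons)
    ultimately have "fps_of_poly (reflect_poly ([:-x, 1:] * q)) = (1 - fps_const x * fps_X) * fps_of_poly (reflect_poly q)" for q
      by (simp only: reflect_poly_mult fps_of_poly_mult)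
    then show ?case using Cons.IH by (simp only: list.map prod_list.Cons)
  qed simp
  then show "reverse_fps xs $ n = coeff (reflect_poly p) n" by (metis fps_of_poly_nth)
  have "degree p = length xs \<and> lead_coeff p = 1"
    unfolding p_def
  proof (induction xs)
    case (Cons x xs)
    let ?q = "\<Prod>x\<leftarrow>xs. [:-x, 1:]"
    have "?q \<noteq> 0" using Cons by auto
    then have "degree ([:-x, 1:] * ?q) = Suc (length xs)" using Cons
      by (simp add: degree_mult_eq del: mult_pCons_left)
    moreover have "lead_coeff ([:-x, 1:] * ?q) = 1" unfolding lead_coeff_mult conjunct2[OF Cons] by simp
    ultimately show ?case by simp
  qed auto
  then show "degree p = length xs" "lead_coeff p = 1" by blast+
qed

text \<open>This takes the place of the fundamental theorem on symmetric polynomials: for a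
  polynomial given by its roots, rationality of the coefficients can be checked on power sums, which
  are easy to compute for the roots used below.\<close>

lemma coeff_R_iff_power_sum_R:
  "(\<forall>i. coeff (\<Prod>x\<leftarrow>xs. [:-x, 1:]) i \<in> R) \<longleftrightarrow> (\<forall>k. power_sum xs k \<in> R)"
proof -
  let ?p = "\<Prod>x\<leftarrow>xs. [:-x, 1:]"
  have "(\<forall>i. coeff ?p i \<in> R) \<longleftrightarrow> (\<forall>n. reverse_fps xs $ n \<in> R)"
  proof safe
    fix n assume "\<forall>i. coeff ?p i \<in> R"
    then show "reverse_fps xs $ n \<in> R" by (simp add: coeff_reverse_fps coeff_reflect_poly zero_R)
  next
    fix i assume *: "\<forall>n. reverse_fps xs $ n \<in> R"
    show "coeff ?p i \<in> R"
    proof (cases "i \<le> degree ?p")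
      case True
      then have "coeff ?p i = reverse_fps xs $ (degree ?p - i)"
        unfolding coeff_reverse_fps(1) by (simp add: coeff_reflect_poly)
      then show ?thesis using * by simp
    qed (simp add: coeff_eq_0 zero_R)
  qed
  then show ?thesis using power_sum_R_if reverse_fps_R_if by blast
qed

end

section \<open>The intermediate value theorem for real closed fields\<close>

text \<open>One value for each unordered pair of positions, so \<open>n\<close> entries give
  \<open>n(n - 1)/2\<close> values even if entries repeat; this count drives the induction in
  \<open>C_root\<close>.\<close>

fun pair_values :: "('b \<Rightarrow> 'b \<Rightarrow> 'c) \<Rightarrow> 'b list \<Rightarrow> 'c list" where
  "pair_values h [] = []"
| "pair_values h (x # xs) = map (h x) xs @ pair_values h xs"

lemma length_pair_values: "2 * length (pair_values h xs) = length xs * (length xs - 1)"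
proof (induction xs)
  case (Cons x xs)
  then show ?case by (cases xs) (auto simp: algebra_simps)
qed auto

lemma set_pair_values: "z \<in> set (pair_values h xs) \<Longrightarrow> \<exists>x\<in>set xs. \<exists>y\<in>set xs. z = h x y"
  by (induction xs) auto

lemma sum_pair_values:
  fixes F :: "'b \<Rightarrow> 'b \<Rightarrow> 'c::comm_ring_1"
  assumes "\<And>x y. F x y = F y x"
  shows "2 * sum_list (pair_values F xs) + (\<Sum>x\<leftarrow>xs. F x x) = (\<Sum>x\<leftarrow>xs. \<Sum>y\<leftarrow>xs. F x y)"
proof (induction xs)
  case (Cons x xs)
  have "(\<Sum>z\<leftarrow>xs. F z x) = (\<Sum>y\<leftarrow>xs. F x y)" using assms by (auto intro!: arg_cong[of _ _ sum_list])
  then show ?case using Cons by (simp add: sum_list_addf algebra_simps)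
qed auto

text \<open>Laplace's auxiliary roots: \<open>x + y\<close> and \<open>x y\<close> are recovered from two values of \<open>t\<close>.\<close>
definition laplace :: "nat \<Rightarrow> 'b::comm_ring_1 \<Rightarrow> 'b \<Rightarrow> 'b" where
  "laplace t x y = x + y + of_nat t * (x * y)"

text \<open>Expanding one factor at a time turns the sum over all ordered pairs into products of
  power sums; the exponents \<open>a\<close> and \<open>b\<close> are arbitrary so that the
  induction closes. Removing the diagonal and halving leaves the sum over unordered pairs.\<close>

lemma (in subfield_set) power_sum_laplace:
  assumes "\<And>k. power_sum xs k \<in> R"
  shows "power_sum (pair_values (laplace t) xs) k \<in> R"
proof -
  have 1: "(\<Sum>x\<leftarrow>xs. \<Sum>y\<leftarrow>xs. x^a * y^b * laplace t x y ^ k) \<in> R" for a b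
  proof (induction k arbitrary: a b)
    case 0
    have "(\<Sum>x\<leftarrow>xs. \<Sum>y\<leftarrow>xs. x^a * y^b * laplace t x y ^ 0) = power_sum xs a * power_sum xs b"
      unfolding power_sum_def by (simp add: sum_list_const_mult sum_list_mult_const)
    then show ?case using assms mult_R by simp
  next
    case (Suc k)
    have "(\<Sum>x\<leftarrow>xs. \<Sum>y\<leftarrow>xs. x^a * y^b * laplace t x y ^ Suc k) =
      (\<Sum>x\<leftarrow>xs. \<Sum>y\<leftarrow>xs. x^Suc a * y^b * laplace t x y ^ k) +
      (\<Sum>x\<leftarrow>xs. \<Sum>y\<leftarrow>xs. x^a * y^Suc b * laplace t x y ^ k) +
      of_nat t * (\<Sum>x\<leftarrow>xs. \<Sum>y\<leftarrow>xs. x^Suc a * y^Suc b * laplace t x y ^ k)"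
      unfolding sum_list_const_mult[symmetric] sum_list_addf[symmetric]
      by (intro arg_cong[of _ _ sum_list] map_cong refl) (simp add: laplace_def algebra_simps)
    then show ?case by (simp only:) (intro add_R mult_R of_nat_R Suc)
  qed
  have 2: "(\<Sum>x\<leftarrow>xs. x^a * laplace t x x ^ k) \<in> R" for a
  proof (induction k arbitrary: a)
    case 0
    then show ?case using assms unfolding power_sum_def by simp
  next
    case (Suc k)
    have "(\<Sum>x\<leftarrow>xs. x^a * laplace t x x ^ Suc k) =
      of_nat 2 * (\<Sum>x\<leftarrow>xs. x^Suc a * laplace t x x ^ k) + of_nat t * (\<Sum>x\<leftarrow>xs. x^Suc (Suc a) * laplace t x x ^ k)"
      unfolding sum_list_const_mult[symmetric] sum_list_addf[symmetric]
      by (intro arg_cong[of _ _ sum_list] map_cong refl) (simp add: laplace_def algebra_simps)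
    then show ?case by (simp only:) (intro add_R mult_R of_nat_R Suc)
  qed
  have eq: "power_sum (pair_values (laplace t) xs) k = sum_list (pair_values (\<lambda>x y. laplace t x y ^ k) xs)"
    unfolding power_sum_def
  proof (induction xs)
    case (Cons x xs)
    then show ?case by (simp add: o_def)
  qed auto
  have "2 * power_sum (pair_values (laplace t) xs) k + (\<Sum>x\<leftarrow>xs. laplace t x x ^ k) =
     (\<Sum>x\<leftarrow>xs. \<Sum>y\<leftarrow>xs. laplace t x y ^ k)"
    unfolding eq by (rule sum_pair_values) (simp add: laplace_def algebra_simps)
  then have "power_sum (pair_values (laplace t) xs) k =
     inverse (of_nat 2) * ((\<Sum>x\<leftarrow>xs. \<Sum>y\<leftarrow>xs. laplace t x y ^ k) - (\<Sum>x\<leftarrow>xs. laplace t x x ^ k))"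
    by (simp add: field_simps)
  also have "\<dots> \<in> R" using 1[of 0 0] 2[of 0] by (intro mult_R inverse_R of_nat_R diff_R) auto
  finally show ?thesis .
qed

lemma poly_map_poly_to_ac: "poly (map_poly to_ac p) (to_ac x) = to_ac (poly p x)"
  by (induction p) (auto simp: map_poly_pCons)

section \<open>Adjoining a square root of \<open>-1\<close> to an ordered field with square roots
  and roots in odd degree\<close>

locale odd_roots =
  fixes T :: "'a::linordered_field itself"
  assumes ex_sqrt: "\<And>x::'a. 0 \<le> x \<Longrightarrow> \<exists>y. y * y = x"
    and odd_root: "\<And>p::'a poly. odd (degree p) \<Longrightarrow> \<exists>x. poly p x = 0"
begin

definition imag :: "'a alg_closure" where "imag = (SOME i. i * i = - 1)"

lemma imag: "imag * imag = - 1"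
proof -
  have "degree [:1, 0, 1 :: 'a alg_closure:] > 0" by simp
  then obtain z where "poly [:1, 0, 1 :: 'a alg_closure:] z = 0" using alg_closed_imp_poly_has_root by blast
  then have "z * z = - 1" by (simp add: add_eq_0_iff)
  then show ?thesis unfolding imag_def by (rule someI)
qed

definition cplx :: "'a \<Rightarrow> 'a \<Rightarrow> 'a alg_closure" where "cplx a b = to_ac a + to_ac b * imag"

lemma cplx_simps:
  "cplx a b + cplx c d = cplx (a + c) (b + d)" "- cplx a b = cplx (-a) (-b)"
  "cplx a b * cplx c d = cplx (a * c - b * d) (a * d + b * c)" "to_ac a = cplx a 0"
proof -
  have "cplx a b * cplx c d = to_ac (a * c) + to_ac (b * d) * (imag * imag) + to_ac (a * d + b * c) * imag"
    by (simp add: cplx_def algebra_simps)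
  then show "cplx a b * cplx c d = cplx (a * c - b * d) (a * d + b * c)" by (simp add: imag cplx_def)
qed (auto simp: cplx_def algebra_simps)

lemma cplx_eq_0: "cplx a b = 0 \<longleftrightarrow> a = 0 \<and> b = 0"
proof
  assume "cplx a b = 0"
  then have "cplx a b * cplx a (- b) = 0" by simp
  then have "to_ac (a * a + b * b) = 0" by (simp add: cplx_simps mult.commute)
  then show "a = 0 \<and> b = 0" unfolding to_ac_eq_0_iff by (simp add: sum_squares_eq_zero_iff)
qed (simp add: cplx_def)

definition C where "C = {z. \<exists>a b. z = cplx a b}"

lemma C_closed: "z \<in> C \<Longrightarrow> w \<in> C \<Longrightarrow> z + w \<in> C" "z \<in> C \<Longrightarrow> - z \<in> C" "z \<in> C \<Longrightarrow> w \<in> C \<Longrightarrow> z * w \<in> C"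
  "to_ac x \<in> C"
  unfolding C_def using cplx_simps by blast+

text \<open>The half-angle formula: with \<open>m\<close> the modulus of \<open>a + b i\<close>, the
  root is \<open>x + i y\<close> or \<open>x - i y\<close>, where \<open>x^2 = (m + a)/2\<close> and
  \<open>y^2 = (m - a)/2\<close>, according to whether \<open>2 x y\<close> is \<open>b\<close> or
  \<open>- b\<close>.\<close>

lemma C_sqrt:
  assumes "z \<in> C"
  shows "\<exists>w\<in>C. w * w = z"
proof -
  obtain a b where z: "z = cplx a b" using assms unfolding C_def by blast
  obtain m' where "m' * m' = a * a + b * b" using ex_sqrt[of "a * a + b * b"] by auto
  then have m: "\<bar>m'\<bar> * \<bar>m'\<bar> = a * a + b * b" by simp
  \<comment> \<open>The nonnegative root is needed: only then are \<open>m + a\<close> and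
    \<open>m - a\<close> nonnegative.\<close>
  define m where "m = \<bar>m'\<bar>"
  have mm: "m * m = a * a + b * b" "m \<ge> 0" using m unfolding m_def by auto
  have "a * a \<le> m * m" using mm by simp
  then have "\<bar>a\<bar> \<le> \<bar>m\<bar>" using abs_le_square_iff[of a m] by (simp add: power2_eq_square)
  then have "0 \<le> (m + a) / 2" "0 \<le> (m - a) / 2" using mm(2) by auto
  then obtain x y where x: "x * x = (m + a) / 2" and y: "y * y = (m - a) / 2" using ex_sqrt by metis
  have "(2 * x * y) * (2 * x * y) = 4 * ((x * x) * (y * y))" by (simp add: algebra_simps)
  also have "\<dots> = m * m - a * a" unfolding x y by (simp add: field_simps)
  also have "\<dots> = b * b" using mm by simp
  finally have "2 * x * y = b \<or> 2 * x * y = - b" by (rule square_eq_iff[THEN iffD1])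
  then have "cplx x y * cplx x y = z \<or> cplx x (- y) * cplx x (- y) = z"

  proof -
    have 1: "x * x - y * y = a" unfolding x y by (simp add: field_simps)
    have "cplx x y * cplx x y = cplx a (2 * x * y)" "cplx x (- y) * cplx x (- y) = cplx a (- (2 * x * y))"
      unfolding cplx_simps 1[symmetric] by (simp_all add: algebra_simps)
    then show ?thesis using \<open>2 * x * y = b \<or> 2 * x * y = - b\<close> unfolding z by (metis minus_minus)
  qed
  then show ?thesis unfolding C_def by blast
qed

text \<open>Induction on the exponent of \<open>2\<close> in the degree. For fixed \<open>t\<close>,
  the values \<open>x + y + t x y\<close> over pairs of roots are the roots of a polynomial of
  degree \<open>n(n - 1)/2\<close>, which contains one factor \<open>2\<close> less than
  \<open>n\<close>; so one of them lies in \<open>C\<close>.\<close>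

lemma C_root:
  fixes p :: "'a poly"
  assumes "lead_coeff p = 1" "degree p = 2 ^ k * m" "odd m"
  shows "\<exists>z\<in>C. poly (map_poly to_ac p) z = 0"
  using assms
proof (induction k arbitrary: p m)
  case 0
  then obtain x where "poly p x = 0" using odd_root by auto
  then have "poly (map_poly to_ac p) (to_ac x) = 0"
    by (simp add: poly_map_poly_to_ac)
  then show ?case using C_closed by blast
next
  case (Suc k)
  define n where "n = degree p"
  have n: "n = 2 * (2 ^ k * m)" using Suc.prems n_def by simp
  define P where "P = map_poly to_ac p"
  have P: "lead_coeff P = 1" "degree P = n"
    using Suc.prems(1) by (auto simp: P_def n_def coeff_map_poly degree_map_poly)
  then have "P \<noteq> 0" by auto
  then obtain M where M: "size M = n" "P = (\<Prod>x\<in>#M. [:- x, 1:])"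
    using alg_closed_imp_factorization[of P] P by auto
  obtain xs where xs: "mset xs = M" using ex_mset by blast
  have Pxs: "P = (\<Prod>x\<leftarrow>xs. [:-x, 1:])" "length xs = n" using M xs by (auto simp flip: prod_mset_prod_list)
  interpret R: subfield_set "range (to_ac :: 'a \<Rightarrow> 'a alg_closure)"
  proof
    fix a b :: "'a alg_closure" assume "a \<in> range to_ac" "b \<in> range to_ac"
    then obtain x y where "a = to_ac x" "b = to_ac y" by auto
    then show "a + b \<in> range to_ac" "a * b \<in> range to_ac" "- a \<in> range to_ac" "inverse a \<in> range to_ac"
      by (metis rangeI to_ac_add to_ac_mult to_ac_minus to_ac_inverse)+
  qed (metis rangeI to_ac_1)
  have "\<forall>i. coeff P i \<in> range to_ac" by (simp add: P_def coeff_map_poly)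
  then have ps: "power_sum xs j \<in> range to_ac" for j using R.coeff_R_iff_power_sum_R[of xs] unfolding Pxs by blast
  have ex: "\<exists>x\<in>set xs. \<exists>y\<in>set xs. laplace t x y \<in> C" for t
  proof -
    define ys where "ys = pair_values (laplace t) xs"
    define Q where "Q = (\<Prod>x\<leftarrow>ys. [:-x, 1:])"
    \<comment> \<open>\<open>of_ac\<close> inverts \<open>to_ac\<close> on its range, and the
      coefficients of \<open>Q\<close> are shown next to lie there.\<close>
    define q where "q = map_poly of_ac Q"
    have "\<forall>i. coeff Q i \<in> range to_ac"
      using R.coeff_R_iff_power_sum_R[of ys] R.power_sum_laplace[OF ps] unfolding Q_def ys_def by blast
    then have Q: "Q = map_poly to_ac q"
      by (intro poly_eqI) (simp add: q_def coeff_map_poly to_ac_of_ac)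
    have lQ: "degree Q = length ys" "lead_coeff Q = 1" using R.coeff_reverse_fps[of ys] unfolding Q_def by auto
    have dq: "degree q = length ys" using lQ Q by (simp add: degree_map_poly)
    have lq: "lead_coeff q = 1" using lQ dq by (simp add: q_def coeff_map_poly of_ac_eqI)
    have "2 * length ys = n * (n - 1)" unfolding ys_def length_pair_values Pxs ..
    then have "length ys = 2 ^ k * (m * (n - 1))" unfolding n by simp
    moreover have "odd (m * (n - 1))" using Suc.prems n by (auto elim: oddE)
    ultimately obtain z where z: "z \<in> C" "poly Q z = 0" using Suc.IH[of q "m * (n - 1)"] lq dq Q by auto
    then have "z \<in> set ys" unfolding Q_def by (induction ys) auto
    then show ?thesis using set_pair_values z(1) unfolding ys_def by metis
  qed
  then obtain f g where fg: "\<And>t. f t \<in> set xs" "\<And>t. g t \<in> set xs" "\<And>t. laplace t (f t) (g t) \<in> C" by metis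
  \<comment> \<open>Infinitely many \<open>t\<close> but finitely many pairs of roots: some pair
    serves two values of \<open>t\<close>, and the two linear equations are solved for
    \<open>x + y\<close> and \<open>x y\<close>.\<close>
  have "\<not> inj (\<lambda>t. (f t, g t))"
  proof
    assume "inj (\<lambda>t. (f t, g t))"
    moreover have "range (\<lambda>t. (f t, g t)) \<subseteq> set xs \<times> set xs" using fg by auto
    ultimately have "finite (UNIV :: nat set)" by (meson finite_SigmaI finite_imageD finite_subset List.finite_set)
    then show False by simp
  qed
  then obtain t u where tu: "t \<noteq> u" "f t = f u" "g t = g u" unfolding inj_def by auto
  define x y where "x = f t" and "y = g t"
  have xy: "x + y + of_nat t * (x * y) \<in> C" "x + y + of_nat u * (x * y) \<in> C" "x \<in> set xs"
    using fg tu unfolding x_def y_def laplace_def by metis+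
  have "(of_nat t - of_nat u) * (x * y) \<in> C"
    using C_closed(1)[OF xy(1) C_closed(2)[OF xy(2)]] by (simp add: algebra_simps)
  then have "to_ac (inverse (of_nat t - of_nat u)) * ((of_nat t - of_nat u) * (x * y)) \<in> C"
    by (rule C_closed(3)[OF C_closed(4)])
  moreover have "to_ac (inverse (of_nat t - of_nat u)) * ((of_nat t - of_nat u) * (x * y)) = x * y"
    using tu by (simp only: to_ac_inverse to_ac_diff to_ac_of_nat mult.assoc[symmetric]) simp
  ultimately have pr: "x * y \<in> C" by (simp only:)
  have "to_ac (of_nat t) * (x * y) \<in> C" by (intro C_closed pr)
  then have "of_nat t * (x * y) \<in> C" by simp
  then have su: "x + y \<in> C" using C_closed(1)[OF xy(1) C_closed(2)] by (metis add_diff_cancel_right' diff_conv_add_uminus)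
  \<comment> \<open>\<open>(x + y)^2 - 4 x y = (x - y)^2\<close>, so a square root in
    \<open>C\<close> yields \<open>x - y\<close> and with it \<open>x\<close>.\<close>
  have "to_ac (- 4) * (x * y) \<in> C" by (intro C_closed pr)
  then have "(x + y) * (x + y) + to_ac (- 4) * (x * y) \<in> C" by (rule C_closed(1)[OF C_closed(3)[OF su su]])
  then obtain w where w: "w \<in> C" "w * w = (x + y) * (x + y) + to_ac (- 4) * (x * y)" using C_sqrt by blast
  have "w * w = (x - y) * (x - y)" unfolding w(2) by (simp add: algebra_simps)
  then have "x - y = w \<or> x - y = - w" by (auto simp: square_eq_iff)
  then have xyC: "x - y \<in> C" using w C_closed by auto
  have "to_ac (inverse 2) * ((x + y) + (x - y)) \<in> C" by (intro C_closed su xyC)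
  then have "x \<in> C" by simp
  moreover have "poly P x = 0" unfolding Pxs using xy(3) by (induction xs) auto
  ultimately show ?case unfolding P_def by blast
qed

text \<open>A root in \<open>C\<close> gives a factor \<open>X - \<alpha>\<close> or
  \<open>(X - \<alpha>)^2 + \<beta>^2\<close>. A factor with the same sign at \<open>a\<close> and
  \<open>b\<close> is divided out and leaves a sign change in lower degree; the only other
  possibility is a linear factor with \<open>\<alpha>\<close> between \<open>a\<close> and
  \<open>b\<close>.\<close>

lemma intermediate_value:
  fixes p :: "'a poly"
  assumes "a < b" "poly p a * poly p b < 0"
  shows "\<exists>c. a < c \<and> c < b \<and> poly p c = 0"
  using assms
proof (induction "degree p" arbitrary: p rule: less_induct)
  case less
  have p0: "p \<noteq> 0" using less.prems by auto
  have dp: "degree p > 0"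
  proof (rule ccontr)
    assume "\<not> ?thesis"
    then obtain c where "p = [:c:]" by (auto elim: degree_eq_zeroE)
    then show False using less.prems by (simp add: mult_less_0_iff)
  qed
  obtain m k where mk: "degree p = 2 ^ k * m" "odd m"
    using dp multiplicity_decompose'[of "degree p" 2] by (metis gr_implies_not0 odd_one not_is_unit_0 prime_elem_def two_is_prime_nat)
  define p' where "p' = smult (inverse (lead_coeff p)) p"
  have "lead_coeff p' = 1" using p0 by (simp add: p'_def)
  moreover have "degree p' = degree p" using p0 by (simp add: p'_def)
  ultimately obtain z where z: "z \<in> C" "poly (map_poly to_ac p') z = 0"
    using C_root mk by metis
  have "map_poly to_ac p' = smult (to_ac (inverse (lead_coeff p))) (map_poly to_ac p)"
    by (intro poly_eqI) (simp add: coeff_map_poly p'_def)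
  then have pz: "poly (map_poly to_ac p) z = 0" using z(2) p0 by simp
  obtain \<alpha> \<beta> where ab: "z = cplx \<alpha> \<beta>" using z unfolding C_def by blast
  have reduce: ?case if p: "p = D * q" and D: "degree D > 0" "poly D a * poly D b > 0" for D q
  proof -
    have "degree q < degree p" using p p0 D by (auto simp: degree_mult_eq)
    moreover have "(poly D a * poly D b) * (poly q a * poly q b) < 0" using less.prems(2) p by (simp add: mult_ac)
    then have "poly q a * poly q b < 0" using D(2) by (metis mult_less_0_iff less_asym)
    ultimately show ?thesis using less.hyps[of q] less.prems(1) p by auto
  qed
  show ?case
  proof (cases "\<beta> = 0")
    case True
    then have "to_ac (poly p \<alpha>) = 0" using pz ab by (simp add: cplx_def poly_map_poly_to_ac)
    then have root: "poly p \<alpha> = 0" by simp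
    then obtain q where q: "p = [:-\<alpha>, 1:] * q" unfolding poly_eq_0_iff_dvd dvd_def by blast
    have "\<alpha> \<noteq> a" "\<alpha> \<noteq> b" using root less.prems by auto
    then consider "a < \<alpha>" "\<alpha> < b" | "(a - \<alpha>) * (b - \<alpha>) > 0"
      using less.prems(1) by (fastforce simp: zero_less_mult_iff)
    then show ?thesis
    proof cases
      case 2
      then show ?thesis using reduce[OF q] by simp
    qed (use root in blast)
  next
    case False
    define D where "D = [:\<alpha> * \<alpha> + \<beta> * \<beta>, - 2 * \<alpha>, 1:]"
    have Dpos: "poly D x > 0" for x
    proof -
      have "poly D x = (x - \<alpha>) * (x - \<alpha>) + \<beta> * \<beta>" by (simp add: D_def algebra_simps)
      moreover have "\<beta> * \<beta> > 0" using False by (metis mult_pos_pos mult_neg_neg linorder_neqE_linordered_idom)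
      ultimately show ?thesis by (simp add: add_nonneg_pos)
    qed
    have "poly (map_poly to_ac D) z = to_ac (\<alpha> * \<alpha> + \<beta> * \<beta>) + z * (to_ac (- 2 * \<alpha>) + z)"
      by (simp add: D_def map_poly_pCons)
    also have "\<dots> = 0" unfolding ab cplx_simps cplx_eq_0 by (auto simp: algebra_simps)
    finally have Dz: "poly (map_poly to_ac D) z = 0" .
    have hadd: "map_poly to_ac (q + r) = map_poly to_ac q + map_poly to_ac r" for q r :: "'a poly"
      by (intro poly_eqI) (simp add: coeff_map_poly)
    have hmul: "map_poly to_ac (q * r) = map_poly to_ac q * map_poly to_ac r" for q r :: "'a poly"
      by (intro poly_eqI) (simp add: coeff_map_poly coeff_mult to_ac_sum)
    \<comment> \<open>The remainder is at most linear, has coefficients in the ordered field and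
      vanishes at \<open>z\<close>, whose imaginary part is not zero; so it is
      \<open>0\<close>.\<close>
    define r where "r = p mod D"
    have "p = p div D * D + r" by (simp add: r_def)
    then have "poly (map_poly to_ac p) z = poly (map_poly to_ac (p div D)) z * poly (map_poly to_ac D) z + poly (map_poly to_ac r) z"
      by (metis hadd hmul poly_add poly_mult)
    then have rz: "poly (map_poly to_ac r) z = 0" using pz Dz by simp
    have "D \<noteq> 0" "degree D = 2" by (auto simp: D_def)
    then have "degree r < 2" using degree_mod_less[of D p] unfolding r_def by auto
    then have "r = [:coeff r 0, coeff r 1:]"
      by (intro poly_eqI) (auto simp: coeff_pCons coeff_eq_0 split: nat.split)
    then obtain r0 r1 where r: "r = [:r0, r1:]" by blast
    have "cplx (r0 + r1 * \<alpha>) (r1 * \<beta>) = 0"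
      using rz unfolding r ab by (simp add: map_poly_pCons cplx_def algebra_simps split: if_splits)
    then have "r1 = 0" "r0 = 0" using False unfolding cplx_eq_0 by auto
    then have "p = D * (p div D)" using \<open>p = p div D * D + r\<close> r by (simp add: mult.commute)
    then show ?thesis using reduce[of D "p div D"] Dpos \<open>degree D = 2\<close> by simp
  qed
qed

end

section \<open>Virtual roots in a ring with a relation\<close>

text \<open>The relation \<open>Le\<close> is a parameter because the same conditions are read in
  \<open>A\<close> with its lattice order, in residue fields with the order given by squares, and in
  ordered field types with \<open>\<le>\<close>.\<close>

definition vr_conds :: "('r, 'm) ring_scheme \<Rightarrow> ('r \<Rightarrow> 'r \<Rightarrow> bool) \<Rightarrow> nat \<Rightarrow> 'r list \<Rightarrow> (nat \<Rightarrow> 'r) \<Rightarrow> nat \<Rightarrow> 'r \<Rightarrow> bool" where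
  "vr_conds R Le d f U j x \<longleftrightarrow>
    (let \<sigma> = (\<ominus>\<^bsub>R\<^esub> \<one>\<^bsub>R\<^esub>) [^]\<^bsub>R\<^esub> (d - j); u = U (j - 1); v = U j
     in (2 \<le> j \<longrightarrow> Le u x \<and>
           Le (\<sigma> \<otimes>\<^bsub>R\<^esub> (x \<ominus>\<^bsub>R\<^esub> u) \<otimes>\<^bsub>R\<^esub> ring.eval R f u) \<zero>\<^bsub>R\<^esub> \<and>
           Le (\<sigma> \<otimes>\<^bsub>R\<^esub> (x \<ominus>\<^bsub>R\<^esub> u) \<otimes>\<^bsub>R\<^esub> ring.eval R f x) \<zero>\<^bsub>R\<^esub>) \<and>
        (j \<le> d - 1 \<longrightarrow> Le x v \<and>
           Le \<zero>\<^bsub>R\<^esub> (\<sigma> \<otimes>\<^bsub>R\<^esub> (v \<ominus>\<^bsub>R\<^esub> x) \<otimes>\<^bsub>R\<^esub> ring.eval R f v) \<and>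
           Le \<zero>\<^bsub>R\<^esub> (\<sigma> \<otimes>\<^bsub>R\<^esub> (v \<ominus>\<^bsub>R\<^esub> x) \<otimes>\<^bsub>R\<^esub> ring.eval R f x)) \<and>
        (j = d \<longrightarrow> Le \<zero>\<^bsub>R\<^esub> (ring.eval R f x)) \<and>
        (j = 1 \<longrightarrow> Le \<zero>\<^bsub>R\<^esub> ((\<ominus>\<^bsub>R\<^esub> \<one>\<^bsub>R\<^esub>) [^]\<^bsub>R\<^esub> d \<otimes>\<^bsub>R\<^esub> ring.eval R f x)))"

text \<open>Starting at degree \<open>0\<close> costs nothing: for \<open>d = j = 1\<close> the conditions say that \<open>f\<close>
  vanishes at \<open>x\<close>.\<close>
primrec vroots :: "('r, 'm) ring_scheme \<Rightarrow> ('r \<Rightarrow> 'r \<Rightarrow> bool) \<Rightarrow> nat \<Rightarrow> 'r list \<Rightarrow> (nat \<Rightarrow> 'r) \<Rightarrow> bool" where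
  "vroots R Le 0 f W \<longleftrightarrow> True"
| "vroots R Le (Suc n) f W \<longleftrightarrow> (\<exists>U. (\<forall>j\<in>{1..n}. U j \<in> carrier R) \<and> vroots R Le n (monic_deriv R f) U \<and>
     (\<forall>j\<in>{1..Suc n}. vr_conds R Le (Suc n) f U j (W j)))"

lemma vr_conds_cong:
  assumes "\<And>j. j \<in> {1..d - 1} \<Longrightarrow> U j = U_closed j" "1 \<le> j" "j \<le> d"
  shows "vr_conds R Le d f U j x \<longleftrightarrow> vr_conds R Le d f U_closed j x"
proof -
  have "U (j - 1) = U_closed (j - 1)" if "2 \<le> j" using that assms(2,3) by (intro assms(1)) auto
  moreover have "j \<le> d - 1 \<Longrightarrow> U j = U_closed j" using assms by auto
  ultimately  show ?thesis unfolding vr_conds_def Let_def by auto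
qed

lemma length_poly_deriv: "length (poly_deriv R f) = length f - 1"
  by (induction R f rule: poly_deriv.induct) auto

lemma length_monic_deriv: "length (monic_deriv R f) = length f - 1"
  by (simp add: monic_deriv_def length_poly_deriv)

lemma poly_deriv_nth:
  "i < length f - 1 \<Longrightarrow> poly_deriv R f ! i = [(length f - 1 - i)] \<cdot>\<^bsub>R\<^esub> (f ! i)"
proof (induction R f arbitrary: i rule: poly_deriv.induct)
  case (3 R c c' cs)
  then show ?case by (cases i) auto
qed auto

lemma (in ring) poly_deriv_closed: "set f \<subseteq> carrier R \<Longrightarrow> set (poly_deriv R f) \<subseteq> carrier R"
proof (induction f)
  case (Cons a f)
  then show ?case by (cases f) auto
qed auto

definition of_nat_in :: "('r, 'm) ring_scheme \<Rightarrow> nat \<Rightarrow> 'r" where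
  "of_nat_in R k = [k] \<cdot>\<^bsub>R\<^esub> \<one>\<^bsub>R\<^esub>"

text \<open>Being a Q-algebra, stated through units: this covers the zero ring and passes along
  homomorphisms.\<close>

definition rational_ring :: "('r, 'm) ring_scheme \<Rightarrow> bool" where
  "rational_ring R \<longleftrightarrow> (\<forall>k>0. of_nat_in R k \<in> Units R)"

lemma (in cring) monic_deriv_closed:
  assumes "rational_ring R" "set f \<subseteq> carrier R"
  shows "set (monic_deriv R f) \<subseteq> carrier R"
proof (cases "length f - 1 = 0")
  case True
  then have "monic_deriv R f = []" using length_monic_deriv[of R f] by (metis length_0_conv)
  then show ?thesis by simp
next
  case False
  then have "of_nat_in R (length f - 1) \<in> Units R" using assms unfolding rational_ring_def by auto
  then have "inv (of_nat_in R (length f - 1)) \<in> carrier R" by simp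
  then show ?thesis using poly_deriv_closed[OF assms(2)] unfolding monic_deriv_def of_nat_in_def by auto
qed

lemma (in cring) monic_poly_deriv:
  assumes "rational_ring R" "monic_poly R (Suc n) f"
  shows "monic_poly R n (monic_deriv R f)"
proof -
  obtain cs where f: "f = \<one> # cs" "length cs = Suc n" "set cs \<subseteq> carrier R"
    using assms unfolding monic_poly_def by blast
  have sf: "set f \<subseteq> carrier R" using f by auto
  have u: "of_nat_in R (Suc n) \<in> Units R" using assms unfolding rational_ring_def by auto
  obtain c cs' where cs: "cs = c # cs'" using f by (cases cs) auto
  have "monic_deriv R f = (inv (of_nat_in R (Suc n)) \<otimes> of_nat_in R (Suc n)) #
     map (\<lambda>c. inv (of_nat_in R (Suc n)) \<otimes> c) (poly_deriv R cs)"
    using f unfolding monic_deriv_def of_nat_in_def cs by simp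
  also have "\<dots> = \<one> # map (\<lambda>c. inv (of_nat_in R (Suc n)) \<otimes> c) (poly_deriv R cs)" using u by simp
  finally have eq: "monic_deriv R f = \<one> # map (\<lambda>c. inv (of_nat_in R (Suc n)) \<otimes> c) (poly_deriv R cs)" .
  have "set (monic_deriv R f) \<subseteq> carrier R" by (rule monic_deriv_closed[OF assms(1) sf])
  then show ?thesis unfolding monic_poly_def using eq length_monic_deriv[of R f] f by auto
qed

context ring_hom_cring
begin

lemma eval_map:
  "set f \<subseteq> carrier R \<Longrightarrow> x \<in> carrier R \<Longrightarrow> ring.eval S (map h f) (h x) = h (ring.eval R f x)"
proof (induction f)
  case (Cons a f)
  then show ?case
    by (simp add: R.eval_in_carrier ring.eval.simps[OF R.ring_axioms] ring.eval.simps[OF S.ring_axioms])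
qed (simp add: ring.eval.simps[OF R.ring_axioms] ring.eval.simps[OF S.ring_axioms])

lemma hom_add_pow: "a \<in> carrier R \<Longrightarrow> h ([(k::nat)] \<cdot>\<^bsub>R\<^esub> a) = [k] \<cdot>\<^bsub>S\<^esub> h a"
proof (induction k)
  case 0
  then show ?case by (simp add: add_pow_def)
next
  case (Suc k)
  have "[Suc k] \<cdot>\<^bsub>R\<^esub> a = [k] \<cdot>\<^bsub>R\<^esub> a \<oplus>\<^bsub>R\<^esub> a" "[Suc k] \<cdot>\<^bsub>S\<^esub> h a = [k] \<cdot>\<^bsub>S\<^esub> h a \<oplus>\<^bsub>S\<^esub> h a"
    using Suc.prems by simp_all
  then show ?case using Suc by simp
qed

lemma hom_of_nat_in: "h (of_nat_in R k) = of_nat_in S k"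
  unfolding of_nat_in_def by (simp add: hom_add_pow)

lemma hom_Units: "u \<in> Units R \<Longrightarrow> h u \<in> Units S \<and> h (inv\<^bsub>R\<^esub> u) = inv\<^bsub>S\<^esub> (h u)"
proof -
  assume u: "u \<in> Units R"
  have "h u \<otimes>\<^bsub>S\<^esub> h (inv\<^bsub>R\<^esub> u) = \<one>\<^bsub>S\<^esub>" using u by (metis R.Units_closed R.Units_inv_closed R.Units_r_inv hom_mult hom_one)
  then show ?thesis using u by (metis R.Units_closed R.Units_inv_closed S.comm_inv_char S.m_comm S.Units_one_closed hom_closed S.unit_factor)
qed

lemma rational_ring_hom: "rational_ring R \<Longrightarrow> rational_ring S"
  unfolding rational_ring_def using hom_Units hom_of_nat_in by metis

lemma monic_deriv_map:
  assumes "rational_ring R" "set f \<subseteq> carrier R"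
  shows "monic_deriv S (map h f) = map h (monic_deriv R f)"
proof (cases "length f - 1 = 0")
  case True
  then show ?thesis using length_monic_deriv[of R f] length_monic_deriv[of S "map h f"] by (metis length_0_conv length_map list.simps(8))
next
  case False
  have d: "poly_deriv S (map h f) = map h (poly_deriv R f)"
    using assms(2)
  proof (induction f)
    case (Cons c f)
    then show ?case by (cases f) (auto simp: hom_add_pow)
  qed simp
  have "of_nat_in R (length f - 1) \<in> Units R" using assms False unfolding rational_ring_def by auto
  note u = this hom_Units[OF this]
  show ?thesis
    using R.poly_deriv_closed[OF assms(2)] u unfolding monic_deriv_def d
    by (auto simp: hom_of_nat_in simp flip: of_nat_in_def)
qed

lemma monic_poly_map: "monic_poly R d f \<Longrightarrow> monic_poly S d (map h f)"
  unfolding monic_poly_def by (force intro: hom_closed)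

text \<open>Every condition of (V2) is an inequality between ring expressions, so a homomorphism
  that preserves the relation in one direction transports all of them.\<close>

lemma vr_conds_map:
  assumes Le: "\<And>x y. x \<in> carrier R \<Longrightarrow> y \<in> carrier R \<Longrightarrow> Le x y \<Longrightarrow> Le' (h x) (h y)"
    and f: "set f \<subseteq> carrier R" and x: "x \<in> carrier R" and U: "\<And>j. j \<in> {1..d - 1} \<Longrightarrow> U j \<in> carrier R"
    and j: "1 \<le> j" "j \<le> d" and V: "vr_conds R Le d f U j x"
  shows "vr_conds S Le' d (map h f) (h \<circ> U) j (h x)"
proof -
  have ev: "ring.eval R f y \<in> carrier R" if "y \<in> carrier R" for y by (rule R.eval_in_carrier[OF f that])
  have pw: "h ((\<ominus>\<^bsub>R\<^esub> \<one>\<^bsub>R\<^esub>) [^]\<^bsub>R\<^esub> (k::nat)) = (\<ominus>\<^bsub>S\<^esub> \<one>\<^bsub>S\<^esub>) [^]\<^bsub>S\<^esub> k" for k by simp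
  have u: "U (j - 1) \<in> carrier R" if "2 \<le> j" using that j by (intro U) auto
  have v: "U j \<in> carrier R" if "j \<le> d - 1" using U that j by auto
  have le0: "Le' (h a) \<zero>\<^bsub>S\<^esub>" if "a \<in> carrier R" "Le a \<zero>\<^bsub>R\<^esub>" for a using Le[OF that(1) _ that(2)] by simp
  have le1: "Le' \<zero>\<^bsub>S\<^esub> (h a)" if "a \<in> carrier R" "Le \<zero>\<^bsub>R\<^esub> a" for a using Le[OF _ that(1) that(2)] by simp
  note simps = eval_map[OF f] R.minus_eq S.minus_eq
  show ?thesis unfolding vr_conds_def Let_def
  proof (intro conjI impI)
    assume j2: "2 \<le> j"
    note u = u[OF j2]
    show "Le' ((h \<circ> U) (j - 1)) (h x)" using V j2 Le[OF u x] unfolding vr_conds_def Let_def by simp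
    show "Le' ((\<ominus>\<^bsub>S\<^esub> \<one>\<^bsub>S\<^esub>) [^]\<^bsub>S\<^esub> (d - j) \<otimes>\<^bsub>S\<^esub> (h x \<ominus>\<^bsub>S\<^esub> (h \<circ> U) (j - 1)) \<otimes>\<^bsub>S\<^esub> S.eval (map h f) ((h \<circ> U) (j - 1))) \<zero>\<^bsub>S\<^esub>"
      using le0[of "(\<ominus>\<^bsub>R\<^esub> \<one>\<^bsub>R\<^esub>) [^]\<^bsub>R\<^esub> (d - j) \<otimes>\<^bsub>R\<^esub> (x \<ominus>\<^bsub>R\<^esub> U (j - 1)) \<otimes>\<^bsub>R\<^esub> R.eval f (U (j - 1))"] V j2 u x ev[OF u]
      unfolding vr_conds_def Let_def by (simp add: simps)
    show "Le' ((\<ominus>\<^bsub>S\<^esub> \<one>\<^bsub>S\<^esub>) [^]\<^bsub>S\<^esub> (d - j) \<otimes>\<^bsub>S\<^esub> (h x \<ominus>\<^bsub>S\<^esub> (h \<circ> U) (j - 1)) \<otimes>\<^bsub>S\<^esub> S.eval (map h f) (h x)) \<zero>\<^bsub>S\<^esub>"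
      using le0[of "(\<ominus>\<^bsub>R\<^esub> \<one>\<^bsub>R\<^esub>) [^]\<^bsub>R\<^esub> (d - j) \<otimes>\<^bsub>R\<^esub> (x \<ominus>\<^bsub>R\<^esub> U (j - 1)) \<otimes>\<^bsub>R\<^esub> R.eval f x"] V j2 u x ev[OF x]
      unfolding vr_conds_def Let_def by (simp add: simps)
  next
    assume jd: "j \<le> d - 1"
    note v = v[OF jd]
    show "Le' (h x) ((h \<circ> U) j)" using V jd Le[OF x v] unfolding vr_conds_def Let_def by simp
    show "Le' \<zero>\<^bsub>S\<^esub> ((\<ominus>\<^bsub>S\<^esub> \<one>\<^bsub>S\<^esub>) [^]\<^bsub>S\<^esub> (d - j) \<otimes>\<^bsub>S\<^esub> ((h \<circ> U) j \<ominus>\<^bsub>S\<^esub> h x) \<otimes>\<^bsub>S\<^esub> S.eval (map h f) ((h \<circ> U) j))"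
      using le1[of "(\<ominus>\<^bsub>R\<^esub> \<one>\<^bsub>R\<^esub>) [^]\<^bsub>R\<^esub> (d - j) \<otimes>\<^bsub>R\<^esub> (U j \<ominus>\<^bsub>R\<^esub> x) \<otimes>\<^bsub>R\<^esub> R.eval f (U j)"] V jd v x ev[OF v]
      unfolding vr_conds_def Let_def by (simp add: simps)
    show "Le' \<zero>\<^bsub>S\<^esub> ((\<ominus>\<^bsub>S\<^esub> \<one>\<^bsub>S\<^esub>) [^]\<^bsub>S\<^esub> (d - j) \<otimes>\<^bsub>S\<^esub> ((h \<circ> U) j \<ominus>\<^bsub>S\<^esub> h x) \<otimes>\<^bsub>S\<^esub> S.eval (map h f) (h x))"
      using le1[of "(\<ominus>\<^bsub>R\<^esub> \<one>\<^bsub>R\<^esub>) [^]\<^bsub>R\<^esub> (d - j) \<otimes>\<^bsub>R\<^esub> (U j \<ominus>\<^bsub>R\<^esub> x) \<otimes>\<^bsub>R\<^esub> R.eval f x"] V jd v x ev[OF x]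
      unfolding vr_conds_def Let_def by (simp add: simps)
  next
    assume "j = d"
    then show "Le' \<zero>\<^bsub>S\<^esub> (S.eval (map h f) (h x))"
      using le1[OF ev[OF x]] V eval_map[OF f x] unfolding vr_conds_def Let_def by simp
  next
    assume "j = 1"
    then show "Le' \<zero>\<^bsub>S\<^esub> ((\<ominus>\<^bsub>S\<^esub> \<one>\<^bsub>S\<^esub>) [^]\<^bsub>S\<^esub> d \<otimes>\<^bsub>S\<^esub> S.eval (map h f) (h x))"
      using le1[of "(\<ominus>\<^bsub>R\<^esub> \<one>\<^bsub>R\<^esub>) [^]\<^bsub>R\<^esub> d \<otimes>\<^bsub>R\<^esub> R.eval f x"] V ev[OF x] eval_map[OF f x] unfolding vr_conds_def Let_def by simp
  qed
qed

lemma vroots_map: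
  assumes Le: "\<And>x y. x \<in> carrier R \<Longrightarrow> y \<in> carrier R \<Longrightarrow> Le x y \<Longrightarrow> Le' (h x) (h y)"
    and rat: "rational_ring R"
    and "set f \<subseteq> carrier R" "\<And>j. j \<in> {1..n} \<Longrightarrow> W j \<in> carrier R" "vroots R Le n f W"
  shows "vroots S Le' n (map h f) (h \<circ> W)"
  using assms(3-)
proof (induction n arbitrary: f W)
  case (Suc n)
  obtain U where U: "\<And>j. j \<in> {1..n} \<Longrightarrow> U j \<in> carrier R" "vroots R Le n (monic_deriv R f) U"
    "\<And>j. j\<in>{1..Suc n} \<Longrightarrow> vr_conds R Le (Suc n) f U j (W j)" using Suc.prems(3) unfolding vroots.simps by blast
  have "vroots S Le' n (monic_deriv S (map h f)) (h \<circ> U)"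
    unfolding monic_deriv_map[OF rat Suc.prems(1)] using R.monic_deriv_closed[OF rat Suc.prems(1)] U
    by (intro Suc.IH) auto
  moreover have "vr_conds S Le' (Suc n) (map h f) (h \<circ> U) j ((h \<circ> W) j)" if "j \<in> {1..Suc n}" for j
    unfolding o_apply using that U
    by (intro vr_conds_map[where Le = Le and U = U and d = "Suc n", unfolded o_def] assms(1) Suc.prems(1,2)) (auto simp: o_def)
  ultimately show ?case using U(1) unfolding vroots.simps by (intro exI[of _ "h \<circ> U"]) auto
qed simp

end

section \<open>Euclidean ordered fields\<close>

text \<open>The order is recovered from the ring structure, so no order has to be carried through
  quotients, fields of fractions and isomorphic copies.\<close>

definition sq_le :: "('r, 'm) ring_scheme \<Rightarrow> 'r \<Rightarrow> 'r \<Rightarrow> bool" where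
  "sq_le K x y \<longleftrightarrow> (\<exists>z\<in>carrier K. y \<ominus>\<^bsub>K\<^esub> x = z \<otimes>\<^bsub>K\<^esub> z)"

text \<open>Just what makes the squares the nonnegative cone of a linear order: one of
  \<open>x\<close> and \<open>- x\<close> is a square, squares are closed under sums, and a sum of
  two squares vanishes only trivially.\<close>

definition euclidean_field :: "('r, 'm) ring_scheme \<Rightarrow> bool" where
  "euclidean_field K \<longleftrightarrow> field K \<and>
     (\<forall>x\<in>carrier K. \<exists>z\<in>carrier K. x = z \<otimes>\<^bsub>K\<^esub> z \<or> \<ominus>\<^bsub>K\<^esub> x = z \<otimes>\<^bsub>K\<^esub> z) \<and>
     (\<forall>x\<in>carrier K. \<forall>y\<in>carrier K. \<exists>z\<in>carrier K. x \<otimes>\<^bsub>K\<^esub> x \<oplus>\<^bsub>K\<^esub> y \<otimes>\<^bsub>K\<^esub> y = z \<otimes>\<^bsub>K\<^esub> z) \<and>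
     (\<forall>x\<in>carrier K. \<forall>y\<in>carrier K. x \<otimes>\<^bsub>K\<^esub> x \<oplus>\<^bsub>K\<^esub> y \<otimes>\<^bsub>K\<^esub> y = \<zero>\<^bsub>K\<^esub> \<longrightarrow> x = \<zero>\<^bsub>K\<^esub>)"

definition odd_polys_have_roots :: "('r, 'm) ring_scheme \<Rightarrow> bool" where
  "odd_polys_have_roots K \<longleftrightarrow> (\<forall>p. polynomial\<^bsub>K\<^esub> (carrier K) p \<longrightarrow> odd (Polynomials.degree p) \<longrightarrow>
     (\<exists>x \<in> carrier K. ring.eval K p x = \<zero>\<^bsub>K\<^esub>))"

definition virtual_root_subring :: "('r, 'm) ring_scheme \<Rightarrow> 'r set \<Rightarrow> bool" where
  "virtual_root_subring K B \<longleftrightarrow> B \<subseteq> carrier K \<and> \<one>\<^bsub>K\<^esub> \<in> B \<and>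
     (\<forall>a\<in>B. \<forall>b\<in>B. a \<oplus>\<^bsub>K\<^esub> b \<in> B \<and> a \<otimes>\<^bsub>K\<^esub> b \<in> B \<and> \<ominus>\<^bsub>K\<^esub> a \<in> B) \<and>
     (\<forall>x\<in>carrier K. \<exists>s\<in>B. s \<noteq> \<zero>\<^bsub>K\<^esub> \<and> s \<otimes>\<^bsub>K\<^esub> x \<in> B) \<and>
     (\<forall>n f. monic_poly K n f \<longrightarrow> set f \<subseteq> B \<longrightarrow>
        (\<exists>W. (\<forall>j\<in>{1..n}. W j \<in> B) \<and> vroots K (sq_le K) n f W))"

text \<open>The quantifier over \<open>B\<close> is inside, so that this is a property of
  \<open>K\<close> alone; the passage through \<open>'k model\<close> handles properties of that
  kind.\<close>

definition virtual_roots_detect_roots :: "('r, 'm) ring_scheme \<Rightarrow> bool" where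
  "virtual_roots_detect_roots K \<longleftrightarrow> (\<forall>B. virtual_root_subring K B \<longrightarrow> odd_polys_have_roots K \<and>
     (\<forall>n f x. monic_poly K n f \<longrightarrow> set f \<subseteq> B \<longrightarrow> x \<in> carrier K \<longrightarrow> ring.eval K f x = \<zero>\<^bsub>K\<^esub> \<longrightarrow> x \<in> B))"

definition virtual_roots_exist_uniquely :: "('r, 'm) ring_scheme \<Rightarrow> bool" where
  "virtual_roots_exist_uniquely K \<longleftrightarrow> (odd_polys_have_roots K \<longrightarrow>
     (\<forall>n f U j. monic_poly K (Suc n) f \<longrightarrow> (\<forall>j\<in>{1..n}. U j \<in> carrier K) \<longrightarrow>
        vroots K (sq_le K) n (monic_deriv K f) U \<longrightarrow> j \<in> {1..Suc n} \<longrightarrow>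
        (\<exists>x\<in>carrier K. vr_conds K (sq_le K) (Suc n) f U j x \<and> (x \<in> U ` {1..n} \<or> ring.eval K f x = \<zero>\<^bsub>K\<^esub>)) \<and>
        (\<forall>x\<in>carrier K. \<forall>y\<in>carrier K. vr_conds K (sq_le K) (Suc n) f U j x \<longrightarrow>
           vr_conds K (sq_le K) (Suc n) f U j y \<longrightarrow> x = y)))"

section \<open>Polynomials as lists and as functions\<close>

abbreviation type_ring :: "'t::linordered_field ring" where
  "type_ring \<equiv> ring_of_type_algebra"

lemma field_type_ring: "field (type_ring :: 't::linordered_field ring)"
  by (rule field_from_type_algebra)

interpretation TR: cring "type_ring :: 't::linordered_field ring"
  by (rule cring_from_type_algebra)

lemma type_ring_simps [simp]:
  "carrier (type_ring :: 't::linordered_field ring) = UNIV"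
  "x \<otimes>\<^bsub>type_ring\<^esub> y = x * (y :: 't)" "x \<oplus>\<^bsub>type_ring\<^esub> y = x + (y :: 't)"
  "\<one>\<^bsub>type_ring\<^esub> = (1 :: 't)" "\<zero>\<^bsub>type_ring\<^esub> = (0 :: 't)"
  by (simp_all add: ring_of_type_algebra_def)

lemma type_ring_uminus [simp]: "\<ominus>\<^bsub>type_ring\<^esub> x = - (x :: 't::linordered_field)"
  by (rule TR.minus_equality) auto

lemma type_ring_minus [simp]: "x \<ominus>\<^bsub>type_ring\<^esub> y = x - (y :: 't::linordered_field)"
  by (simp add: TR.minus_eq)

lemma type_ring_pow [simp]: "x [^]\<^bsub>type_ring\<^esub> (n::nat) = (x :: 't::linordered_field) ^ n"
  by (induction n) (auto simp: mult.commute)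

lemma type_ring_add_pow [simp]: "[(k::nat)] \<cdot>\<^bsub>type_ring\<^esub> x = of_nat k * (x :: 't::linordered_field)"
proof (induction k)
  case 0
  then show ?case by (simp add: add_pow_def)
next
  case (Suc k)
  have "[Suc k] \<cdot>\<^bsub>type_ring\<^esub> x = [k] \<cdot>\<^bsub>type_ring\<^esub> x \<oplus>\<^bsub>type_ring\<^esub> x" by (rule TR.add.nat_pow_Suc)
  then show ?case using Suc by (simp add: algebra_simps)
qed

lemma type_ring_inv [simp]: "x \<noteq> 0 \<Longrightarrow> inv\<^bsub>type_ring\<^esub> x = inverse (x :: 't::linordered_field)"
  by (rule TR.comm_inv_char) auto

lemma rational_type_ring: "rational_ring (type_ring :: 't::linordered_field ring)"
  unfolding rational_ring_def of_nat_in_def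
  by (simp add: field.field_Units[OF field_type_ring])

lemma poly_Poly_snoc:
  fixes x :: "'t::comm_ring_1"
  shows "poly (Poly (xs @ [a])) x = poly (Poly xs) x + a * x ^ length xs"
  by (induction xs) (auto simp: algebra_simps)

lemma eval_type_ring: "ring.eval type_ring f x = poly (Poly (rev f)) (x :: 't::linordered_field)"
  by (induction f) (simp_all add: ring.eval.simps[OF TR.ring_axioms] poly_Poly_snoc)

lemma Poly_monic_deriv:
  fixes f :: "'t::linordered_field list"
  assumes "length f = Suc (Suc n)"
  shows "Poly (rev (monic_deriv type_ring f)) = smult (inverse (of_nat (Suc n))) (pderiv (Poly (rev f)))"
proof (rule poly_eqI)
  fix i
  have l: "length (poly_deriv type_ring f) = Suc n" using length_poly_deriv[of type_ring f] assms by simp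
  show "coeff (Poly (rev (monic_deriv type_ring f))) i = coeff (smult (inverse (of_nat (Suc n))) (pderiv (Poly (rev f)))) i"
  proof (cases "i < Suc n")
    case True
    \<comment> \<open>Lists begin with the leading coefficient: position \<open>n - i\<close> holds
      the coefficient of \<open>X^(i + 1)\<close> in \<open>f\<close> and that of \<open>X^i\<close>
      in the derivative.\<close>
    then have "poly_deriv type_ring f ! (n - i) = of_nat (Suc i) * f ! (n - i)"
      using poly_deriv_nth[of "n - i" f "type_ring :: 't ring"] assms by (simp add: Suc_diff_le del: of_nat_Suc)
    then show ?thesis using True assms l
      by (simp add: nth_default_def monic_deriv_def rev_nth coeff_pderiv del: of_nat_Suc)
  next
    case False
    then show ?thesis using assms l
      by (simp add: nth_default_def monic_deriv_def coeff_pderiv del: of_nat_Suc)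
  qed
qed

lemma Poly_monic:
  assumes "monic_poly type_ring n (f :: 't::linordered_field list)"
  shows "length f = Suc n" "degree (Poly (rev f)) = n" "lead_coeff (Poly (rev f)) = 1" "f = rev (coeffs (Poly (rev f)))"
proof -
  obtain cs where f: "f = 1 # cs" "length cs = n" using assms unfolding monic_poly_def by auto
  have c: "coeffs (Poly (rev f)) = rev f" using f by (simp add: no_trailing_unfold)
  show "length f = Suc n" using f by simp
  have "Poly (rev f) \<noteq> 0"
  proof
    assume "Poly (rev f) = 0"
    then show False using c f by simp
  qed
  then have d: "degree (Poly (rev f)) = length (rev f) - 1" using c degree_eq_length_coeffs by metis
  then show "degree (Poly (rev f)) = n" using f by simp
  then show "lead_coeff (Poly (rev f)) = 1" using f by (simp add: nth_default_def nth_append)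
  show "f = rev (coeffs (Poly (rev f)))" using c by simp
qed

lemma vr_conds_type_ring:
  "vr_conds type_ring (\<le>) d f U j x \<longleftrightarrow> virtual_root_conds d (Poly (rev f)) U j (x :: 't::linordered_field)"
  unfolding vr_conds_def virtual_root_conds_def by (simp add: eval_type_ring Let_def)

lemma vroots_type_ring:
  assumes "length f = Suc n"
  shows "vroots type_ring (\<le>) n f W \<longleftrightarrow> virtual_roots n (Poly (rev f)) (W :: nat \<Rightarrow> 't::linordered_field)"
  using assms
proof (induction n arbitrary: f W)
  case (Suc n)
  have "length (monic_deriv type_ring f) = Suc n" using Suc.prems length_monic_deriv[of type_ring f] by simp
  then show ?case using Suc.IH[of "monic_deriv type_ring f"] Poly_monic_deriv[OF Suc.prems]
    by (simp add: vr_conds_type_ring del: of_nat_Suc)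
qed simp

section \<open>From ordered field types to euclidean fields\<close>

text \<open>An isomorphism from an ordered field type that also matches the orders. Through it and
  its inverse \<open>k\<close>, theorems about the type become theorems about the carrier.\<close>

locale field_model =
  fixes K :: "'k ring" and h :: "'t::linordered_field \<Rightarrow> 'k"
  assumes euclidean: "euclidean_field K" and hom: "h \<in> ring_hom type_ring K"
    and bij: "bij_betw h UNIV (carrier K)" and le_iff: "\<And>x y. x \<le> y \<longleftrightarrow> sq_le K (h x) (h y)"
begin

definition k :: "'k \<Rightarrow> 't" where "k = inv_into UNIV h"

lemma kh [simp]: "k (h x) = x"
  unfolding k_def using bij by (simp add: bij_betw_def)

lemma hk [simp]: "y \<in> carrier K \<Longrightarrow> h (k y) = y"
  unfolding k_def using bij by (auto simp: bij_betw_def f_inv_into_f)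

lemma field_K: "field K" using euclidean unfolding euclidean_field_def by blast

sublocale K: field K by (rule field_K)

lemma H: "ring_hom_cring type_ring K h"
  by (intro ring_hom_cring.intro ring_hom_cring_axioms.intro cring_from_type_algebra K.is_cring hom)

sublocale H: ring_hom_cring type_ring K h by (rule H)

lemma h_simps: "h x \<in> carrier K" "h (x + y) = h x \<oplus>\<^bsub>K\<^esub> h y" "h (x * y) = h x \<otimes>\<^bsub>K\<^esub> h y"
  "h 0 = \<zero>\<^bsub>K\<^esub>" "h 1 = \<one>\<^bsub>K\<^esub>" "h (- x) = \<ominus>\<^bsub>K\<^esub> h x" "h (x - y) = h x \<ominus>\<^bsub>K\<^esub> h y"
  using H.hom_closed[of x] H.hom_add[of x y] H.hom_mult[of x y] H.hom_zero H.hom_one H.hom_a_inv[of x]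
    H.hom_add[of x "-y"] H.hom_a_inv[of y] by (simp_all add: K.minus_eq)

lemma k_hom: "k \<in> ring_hom K type_ring"
proof (rule ring_hom_memI)
  fix x y assume xy: "x \<in> carrier K" "y \<in> carrier K"
  have "k (h (k x) \<otimes>\<^bsub>K\<^esub> h (k y)) = k x * k y" "k (h (k x) \<oplus>\<^bsub>K\<^esub> h (k y)) = k x + k y"
    by (simp_all only: h_simps(2,3)[symmetric] kh)
  then show "k (x \<otimes>\<^bsub>K\<^esub> y) = k x \<otimes>\<^bsub>type_ring\<^esub> k y" "k (x \<oplus>\<^bsub>K\<^esub> y) = k x \<oplus>\<^bsub>type_ring\<^esub> k y"
    using xy by simp_all
next
  show "k \<one>\<^bsub>K\<^esub> = \<one>\<^bsub>type_ring\<^esub>" using kh[of 1] by (simp only: h_simps type_ring_simps)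
qed simp

sublocale G: ring_hom_cring K type_ring k
  by (intro ring_hom_cring.intro ring_hom_cring_axioms.intro cring_from_type_algebra K.is_cring k_hom)

lemma rational_K: "rational_ring K" by (rule H.rational_ring_hom[OF rational_type_ring])

lemma map_hk: "set f \<subseteq> carrier K \<Longrightarrow> map h (map k f) = f"
  by (induction f) auto

lemma map_kh: "map k (map h f) = f"
  by (simp add: o_def)

lemma eval_K: "set f \<subseteq> carrier K \<Longrightarrow> x \<in> carrier K \<Longrightarrow> ring.eval K f x = h (poly (Poly (rev (map k f))) (k x))"
  using H.eval_map[of "map k f" "k x"] map_hk[of f] by (simp add: eval_type_ring)

lemma le_k: "x \<in> carrier K \<Longrightarrow> y \<in> carrier K \<Longrightarrow> sq_le K x y \<Longrightarrow> k x \<le> k y"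
  using le_iff[of "k x" "k y"] by simp

lemma degree_Poly_rev: "xs \<noteq> [] \<Longrightarrow> hd xs \<noteq> 0 \<Longrightarrow> degree (Poly (rev xs)) = length xs - 1"
proof -
  assume xs: "xs \<noteq> []" "hd xs \<noteq> 0"
  then obtain a as where [simp]: "xs = a # as" "a \<noteq> 0" by (cases xs) auto
  have "coeffs (Poly (rev xs)) = rev xs" by (simp add: no_trailing_unfold)
  moreover from this have "Poly (rev xs) \<noteq> 0" by (metis coeffs_0_eq_Nil rev_is_Nil_conv xs(1))
  ultimately show ?thesis using degree_eq_length_coeffs[of "Poly (rev xs)"] by simp
qed

lemma odd_polys_if_odd_root:
  assumes "\<And>p :: 't poly. odd (degree p) \<Longrightarrow> \<exists>x. poly p x = 0"
  shows "odd_polys_have_roots K"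
  unfolding odd_polys_have_roots_def
proof (intro allI impI)
  fix p assume p: "polynomial\<^bsub>K\<^esub> (carrier K) p" and odd: "odd (Polynomials.degree p)"
  have p0: "p \<noteq> []" using odd by auto
  have pc: "set p \<subseteq> carrier K" "hd p \<noteq> \<zero>\<^bsub>K\<^esub>" using p p0 unfolding polynomial_def by auto
  have "hd p \<in> carrier K" using pc p0 by (cases p) auto
  then have "k (hd p) \<noteq> 0" using pc(2) hk h_simps(4) by metis
  then have "hd (map k p) \<noteq> 0" using p0 by (simp add: hd_map)
  then have "degree (Poly (rev (map k p))) = length p - 1" using degree_Poly_rev[of "map k p"] p0 by simp
  then obtain x where "poly (Poly (rev (map k p))) x = 0" using assms odd by metis
  then have "ring.eval K p (h x) = \<zero>\<^bsub>K\<^esub>" using eval_K[OF pc(1), of "h x"] by (simp add: h_simps)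
  then show "\<exists>x\<in>carrier K. ring.eval K p x = \<zero>\<^bsub>K\<^esub>" using h_simps by blast
qed

lemma odd_root_if_odd_polys:
  assumes "odd_polys_have_roots K" "odd (degree (p :: 't poly))"
  shows "\<exists>x. poly p x = 0"
proof -
  define F where "F = map h (rev (coeffs p))"
  have p0: "p \<noteq> 0" using assms by auto
  have Fc: "set F \<subseteq> carrier K" unfolding F_def using h_simps by auto
  have kF: "map k F = rev (coeffs p)" unfolding F_def map_kh ..
  have "hd F = h (lead_coeff p)" using p0 by (simp add: F_def hd_map hd_rev last_coeffs_eq_coeff_degree)
  also have "\<dots> \<noteq> \<zero>\<^bsub>K\<^esub>" using p0 kh[of "lead_coeff p"] kh[of 0] by (metis h_simps(4) leading_coeff_0_iff)
  finally have "polynomial\<^bsub>K\<^esub> (carrier K) F" using Fc unfolding polynomial_def by blast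
  moreover have "length F - 1 = degree p" using p0 by (simp add: F_def length_coeffs)
  ultimately obtain x where x: "x \<in> carrier K" "ring.eval K F x = \<zero>\<^bsub>K\<^esub>"
    using assms unfolding odd_polys_have_roots_def by metis
  then have "h (poly p (k x)) = h 0" using eval_K[OF Fc x(1)] kF by (simp add: h_simps)
  then have "poly p (k x) = 0" by (metis kh)
  then show ?thesis by blast
qed

text \<open>The preimage \<open>B'\<close> of \<open>B\<close> satisfies
  \<open>fraction_subring\<close>: a monic polynomial over \<open>B'\<close> is moved to
  \<open>K\<close>, where its virtual roots are given, and these are moved back.\<close>

lemma virtual_roots_detect_roots: "virtual_roots_detect_roots K"
  unfolding virtual_roots_detect_roots_def
proof (intro allI impI)
  fix B assume "virtual_root_subring K B"
  then have B: "B \<subseteq> carrier K" "\<one>\<^bsub>K\<^esub> \<in> B"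
    "\<And>a b. a \<in> B \<Longrightarrow> b \<in> B \<Longrightarrow> a \<oplus>\<^bsub>K\<^esub> b \<in> B \<and> a \<otimes>\<^bsub>K\<^esub> b \<in> B \<and> \<ominus>\<^bsub>K\<^esub> a \<in> B"
    "\<And>x. x \<in> carrier K \<Longrightarrow> \<exists>s\<in>B. s \<noteq> \<zero>\<^bsub>K\<^esub> \<and> s \<otimes>\<^bsub>K\<^esub> x \<in> B"
    and W: "\<And>n f. monic_poly K n f \<Longrightarrow> set f \<subseteq> B \<Longrightarrow> \<exists>W. (\<forall>j\<in>{1..n}. W j \<in> B) \<and> vroots K (sq_le K) n f W"
    unfolding virtual_root_subring_def by blast+
  define B' where "B' = {x. h x \<in> B}"
  interpret fraction_subring B'
  proof
    fix x :: 't
    obtain s where s: "s \<in> B" "s \<noteq> \<zero>\<^bsub>K\<^esub>" "s \<otimes>\<^bsub>K\<^esub> h x \<in> B" using B(4)[OF h_simps(1)] by blast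
    then have "s \<in> carrier K" using B(1) by blast
    then have "k s \<in> B'" "k s * x \<in> B'" "k s \<noteq> 0" using s by (auto simp: B'_def h_simps) (metis hk h_simps(4))
    then show "\<exists>s\<in>B'. s \<noteq> 0 \<and> s * x \<in> B'" by blast
  qed (use B(2,3) in \<open>auto simp: B'_def h_simps\<close>)
  have vr: "\<exists>W. (\<forall>j\<in>{1..degree f}. W j \<in> B') \<and> virtual_roots (degree f) f W"
    if f: "lead_coeff f = 1" "\<And>i. coeff f i \<in> B'" for f
  proof -
    define F where "F = rev (coeffs f)"
    have f0: "f \<noteq> 0" using f(1) by auto
    have FP: "Poly (rev F) = f" by (simp add: F_def)
    have "coeffs f \<noteq> []" using f0 by simp
    then have lF: "length F = Suc (degree f)" using f0 by (simp add: F_def length_coeffs)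
    moreover have "hd F = 1" using f f0 by (simp add: F_def hd_rev last_coeffs_eq_coeff_degree)
    ultimately have "F = 1 # tl F" "length (tl F) = degree f" by (cases F, auto)+
    then have mF: "monic_poly type_ring (degree f) F" unfolding monic_poly_def by force
    have "set F \<subseteq> B'" using f(2) zero_B by (auto simp: F_def coeffs_def split: if_splits)
    then have sF: "set (map h F) \<subseteq> B" by (auto simp: B'_def)
    obtain W where W: "\<And>j. j\<in>{1..degree f} \<Longrightarrow> W j \<in> B" "vroots K (sq_le K) (degree f) (map h F) W"
      using W[OF H.monic_poly_map[OF mF] sF] by blast
    have "vroots type_ring (\<le>) (degree f) (map k (map h F)) (k \<circ> W)"
      using W(2) sF B(1) W(1) by (intro G.vroots_map[where Le = "sq_le K"] le_k rational_K) auto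
    then have "virtual_roots (degree f) f (k \<circ> W)" unfolding map_kh vroots_type_ring[OF lF] FP .
    moreover have "(k \<circ> W) j \<in> B'" if "j \<in> {1..degree f}" for j
    proof -
      have "W j \<in> B" "W j \<in> carrier K" using W(1)[OF that] B(1) by auto
      then show ?thesis by (simp add: B'_def)
    qed
    ultimately show ?thesis by blast
  qed
  have "x \<in> B" if f: "monic_poly K n f" "set f \<subseteq> B" and x: "x \<in> carrier K" "ring.eval K f x = \<zero>\<^bsub>K\<^esub>" for n f x
  proof -
    define p where "p = Poly (rev (map k f))"
    have fc: "set f \<subseteq> carrier K" using f B(1) by blast
    have lp: "lead_coeff p = 1" unfolding p_def using Poly_monic(3)[OF G.monic_poly_map[OF f(1)]] .
    have "h (poly p (k x)) = h 0" using eval_K[OF fc x(1)] x(2) by (simp add: p_def h_simps)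
    then have "poly p (k x) = 0" by (metis kh)
    moreover have "coeff p i \<in> B'" for i
    proof (cases "i < length f")
      case True
      then have "f ! (length f - Suc i) \<in> B" "f ! (length f - Suc i) \<in> carrier K" using f(2) fc by auto
      then show ?thesis using True by (simp add: p_def nth_default_def rev_nth B'_def)
    next
      case False
      then show ?thesis using zero_B by (simp add: p_def nth_default_def)
    qed
    ultimately have "k x \<in> B'" using integral_in_B[OF vr lp] by blast
    then show ?thesis using x by (simp add: B'_def)
  qed
  moreover have "odd_polys_have_roots K" using odd_polys_if_odd_root odd_degree_root[OF vr] by blast
  ultimately show "odd_polys_have_roots K \<and> (\<forall>n f x. monic_poly K n f \<longrightarrow> set f \<subseteq> B \<longrightarrow> x \<in> carrier K \<longrightarrow> ring.eval K f x = \<zero>\<^bsub>K\<^esub> \<longrightarrow> x \<in> B)"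
    by blast
qed

text \<open>Nonnegative elements have square roots by the very definition of \<open>sq_le\<close>;
  together with roots in odd degree this makes the type an instance of \<open>odd_roots\<close>,
  which gives \<open>ivt\<close> in every degree.\<close>

lemma virtual_roots_exist_uniquely: "virtual_roots_exist_uniquely K"
  unfolding virtual_roots_exist_uniquely_def
proof (intro allI impI)
  fix n f U j
  assume odd: "odd_polys_have_roots K" and f: "monic_poly K (Suc n) f" and U: "\<forall>j\<in>{1..n}. U j \<in> carrier K"
    and vr: "vroots K (sq_le K) n (monic_deriv K f) U" and j: "j \<in> {1..Suc n}"
  interpret odd_roots "TYPE('t)"
  proof
    fix x :: 't assume "0 \<le> x"
    then have "sq_le K \<zero>\<^bsub>K\<^esub> (h x)" using le_iff[of 0 x] by (simp add: h_simps)
    then obtain z where z: "z \<in> carrier K" "h x \<ominus>\<^bsub>K\<^esub> \<zero>\<^bsub>K\<^esub> = z \<otimes>\<^bsub>K\<^esub> z" unfolding sq_le_def by blast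
    then have "h x = h (k z * k z)" using h_simps(1)[of x] by (simp add: h_simps K.minus_eq)
    then have "x = k z * k z" by (metis kh)
    then show "\<exists>y. y * y = x" by blast
  qed (rule odd_root_if_odd_polys[OF odd])
  have ivt: "ivt m TYPE('t)" for m
    unfolding ivt_def using intermediate_value by (meson mult_neg_pos)
  define p where "p = Poly (rev (map k f))"
  define g where "g = smult (inverse (of_nat (Suc n))) (pderiv p)"
  have fc: "set f \<subseteq> carrier K" using f unfolding monic_poly_def by auto
  note mp = Poly_monic[OF G.monic_poly_map[OF f], folded p_def]
  have lk: "length (map k f) = Suc (Suc n)" using mp(1) by simp
  have lm: "length (map k (monic_deriv K f)) = Suc n" using lk length_monic_deriv[of K f] by simp
  have "vroots type_ring (\<le>) n (map k (monic_deriv K f)) (k \<circ> U)"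
    using vr U by (intro G.vroots_map[where Le = "sq_le K"] le_k rational_K K.monic_deriv_closed[OF rational_K fc]) auto
  then have vg: "virtual_roots n g (k \<circ> U)"
    unfolding vroots_type_ring[OF lm] unfolding G.monic_deriv_map[OF rational_K fc, symmetric] Poly_monic_deriv[OF lk] g_def p_def .
  have dg: "degree g = n" using mp(2) by (simp add: g_def degree_pderiv del: of_nat_Suc)
  have lg: "lead_coeff g = 1" unfolding dg using mp by (simp add: g_def coeff_pderiv del: of_nat_Suc)
  have sg: "sign_pattern n g (k \<circ> U)"
    using virtual_roots_sign_pattern[OF ivt[of n] lg, of "k \<circ> U"] vg dg by simp
  have j': "1 \<le> j" "j \<le> Suc n" using j by auto
  have "\<exists>x. virtual_root_conds (Suc n) p (k \<circ> U) j x \<and> (x \<in> (k \<circ> U) ` {1..n} \<or> poly p x = 0)"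
    using virtual_root_exists[OF ivt mp(2,3) sg[unfolded g_def] _ j'] virtual_roots_sorted[OF vg] by blast
  then obtain x where x: "virtual_root_conds (Suc n) p (k \<circ> U) j x" "x \<in> (k \<circ> U) ` {1..n} \<or> poly p x = 0" by blast
  have "vr_conds type_ring (\<le>) (Suc n) (map k f) (k \<circ> U) j x" unfolding vr_conds_type_ring using x(1) unfolding p_def .
  then have "vr_conds K (sq_le K) (Suc n) (map h (map k f)) (h \<circ> (k \<circ> U)) j (h x)"
    using j' by (intro H.vr_conds_map[where Le = "(\<le>)"]) (auto simp: le_iff)
  then have "vr_conds K (sq_le K) (Suc n) f (h \<circ> (k \<circ> U)) j (h x)" unfolding map_hk[OF fc] .
  moreover have "vr_conds K (sq_le K) (Suc n) f (h \<circ> (k \<circ> U)) j (h x) = vr_conds K (sq_le K) (Suc n) f U j (h x)"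
    using U j' by (intro vr_conds_cong) auto
  ultimately have 1: "vr_conds K (sq_le K) (Suc n) f U j (h x)" by blast
  have 2: "h x \<in> U ` {1..n} \<or> ring.eval K f (h x) = \<zero>\<^bsub>K\<^esub>"
    using x(2)
  proof
    assume "x \<in> (k \<circ> U) ` {1..n}"
    then obtain i where "i \<in> {1..n}" "x = k (U i)" by auto
    then show ?thesis using U by auto
  next
    assume "poly p x = 0"
    then show ?thesis using eval_K[OF fc h_simps(1), of x] by (simp add: p_def h_simps)
  qed
  have 3: "y = z" if yz: "y \<in> carrier K" "z \<in> carrier K" "vr_conds K (sq_le K) (Suc n) f U j y"
     "vr_conds K (sq_le K) (Suc n) f U j z" for y z
  proof -
    have *: "virtual_root_conds (Suc n) p (k \<circ> U) j (k y)" if "y \<in> carrier K" "vr_conds K (sq_le K) (Suc n) f U j y" for y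
      unfolding p_def vr_conds_type_ring[symmetric] using that U j' fc
      by (intro G.vr_conds_map[where Le = "sq_le K"] le_k) auto
    have "k y = k z"
      using virtual_root_unique[OF ivt _ sg[unfolded g_def] j' *[OF yz(1,3)] *[OF yz(2,4)]] mp(2) by simp
    then show ?thesis using yz by (metis hk)
  qed
  show "(\<exists>x\<in>carrier K. vr_conds K (sq_le K) (Suc n) f U j x \<and> (x \<in> U ` {1..n} \<or> ring.eval K f x = \<zero>\<^bsub>K\<^esub>)) \<and>
        (\<forall>x\<in>carrier K. \<forall>y\<in>carrier K. vr_conds K (sq_le K) (Suc n) f U j x \<longrightarrow>
           vr_conds K (sq_le K) (Suc n) f U j y \<longrightarrow> x = y)"
    using 1 2 3 h_simps(1) by blast
qed

end

section \<open>The order of a euclidean field\<close>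

lemma euclidean_fieldI:
  assumes "field K"
    and "\<And>x. x \<in> carrier K \<Longrightarrow> \<exists>z\<in>carrier K. x = z \<otimes>\<^bsub>K\<^esub> z \<or> \<ominus>\<^bsub>K\<^esub> x = z \<otimes>\<^bsub>K\<^esub> z"
    and "\<And>x y. x \<in> carrier K \<Longrightarrow> y \<in> carrier K \<Longrightarrow> \<exists>z\<in>carrier K. x \<otimes>\<^bsub>K\<^esub> x \<oplus>\<^bsub>K\<^esub> y \<otimes>\<^bsub>K\<^esub> y = z \<otimes>\<^bsub>K\<^esub> z"
    and "\<And>x y. x \<in> carrier K \<Longrightarrow> y \<in> carrier K \<Longrightarrow> x \<otimes>\<^bsub>K\<^esub> x \<oplus>\<^bsub>K\<^esub> y \<otimes>\<^bsub>K\<^esub> y = \<zero>\<^bsub>K\<^esub> \<Longrightarrow> x = \<zero>\<^bsub>K\<^esub>"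
  shows "euclidean_field K"
  using assms unfolding euclidean_field_def by blast

lemma euclidean_field_iso:
  assumes "euclidean_field K" "h \<in> ring_iso K M" "field M"
  shows "euclidean_field M"
proof -
  have K: "field K" using assms(1) unfolding euclidean_field_def by blast
  interpret K: field K by (rule K)
  interpret M: field M by (rule assms(3))
  interpret H: ring_hom_cring K M h
    using assms(2) by (intro ring_hom_cring.intro ring_hom_cring_axioms.intro K.is_cring M.is_cring) (auto simp: ring_iso_def)
  have img: "\<exists>x\<in>carrier K. y = h x" if "y \<in> carrier M" for y
    using that assms(2) unfolding ring_iso_def bij_betw_def by auto
  have inj: "inj_on h (carrier K)" using assms(2) unfolding ring_iso_def bij_betw_def by auto
  show ?thesis
  proof (rule euclidean_fieldI[OF assms(3)])
    fix y assume "y \<in> carrier M"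
    then obtain x where x: "x \<in> carrier K" "y = h x" using img by blast
    then obtain z where "z \<in> carrier K" "x = z \<otimes>\<^bsub>K\<^esub> z \<or> \<ominus>\<^bsub>K\<^esub> x = z \<otimes>\<^bsub>K\<^esub> z"
      using assms(1) unfolding euclidean_field_def by blast
    then show "\<exists>z\<in>carrier M. y = z \<otimes>\<^bsub>M\<^esub> z \<or> \<ominus>\<^bsub>M\<^esub> y = z \<otimes>\<^bsub>M\<^esub> z"
      using x by (metis H.hom_closed H.hom_mult H.hom_a_inv)
  next
    fix y y' assume "y \<in> carrier M" "y' \<in> carrier M"
    then obtain x x' where x: "x \<in> carrier K" "y = h x" "x' \<in> carrier K" "y' = h x'" using img by metis
    have eq: "y \<otimes>\<^bsub>M\<^esub> y \<oplus>\<^bsub>M\<^esub> y' \<otimes>\<^bsub>M\<^esub> y' = h (x \<otimes>\<^bsub>K\<^esub> x \<oplus>\<^bsub>K\<^esub> x' \<otimes>\<^bsub>K\<^esub> x')" using x by simp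
    obtain z where "z \<in> carrier K" "x \<otimes>\<^bsub>K\<^esub> x \<oplus>\<^bsub>K\<^esub> x' \<otimes>\<^bsub>K\<^esub> x' = z \<otimes>\<^bsub>K\<^esub> z"
      using assms(1) x unfolding euclidean_field_def by blast
    then show "\<exists>z\<in>carrier M. y \<otimes>\<^bsub>M\<^esub> y \<oplus>\<^bsub>M\<^esub> y' \<otimes>\<^bsub>M\<^esub> y' = z \<otimes>\<^bsub>M\<^esub> z"
      unfolding eq by (metis H.hom_closed H.hom_mult)
    assume "y \<otimes>\<^bsub>M\<^esub> y \<oplus>\<^bsub>M\<^esub> y' \<otimes>\<^bsub>M\<^esub> y' = \<zero>\<^bsub>M\<^esub>"
    then have "h (x \<otimes>\<^bsub>K\<^esub> x \<oplus>\<^bsub>K\<^esub> x' \<otimes>\<^bsub>K\<^esub> x') = h \<zero>\<^bsub>K\<^esub>" unfolding eq by simp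
    then have "x \<otimes>\<^bsub>K\<^esub> x \<oplus>\<^bsub>K\<^esub> x' \<otimes>\<^bsub>K\<^esub> x' = \<zero>\<^bsub>K\<^esub>" by (rule inj_onD[OF inj]) (use x in simp_all)
    then have "x = \<zero>\<^bsub>K\<^esub>" using assms(1) x unfolding euclidean_field_def by blast
    then show "y = \<zero>\<^bsub>M\<^esub>" using x by simp
  qed
qed

lemma euclidean_field_real: "euclidean_field (type_ring :: real ring)"
proof (rule euclidean_fieldI[OF field_type_ring])
  fix x :: real
  have "x = sqrt x * sqrt x \<or> - x = sqrt (- x) * sqrt (- x)" by (cases "0 \<le> x") auto
  then show "\<exists>z\<in>carrier (type_ring :: real ring). x = z \<otimes>\<^bsub>type_ring\<^esub> z \<or> \<ominus>\<^bsub>type_ring\<^esub> x = z \<otimes>\<^bsub>type_ring\<^esub> z"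
    unfolding type_ring_simps type_ring_uminus by blast
next
  fix x y :: real
  have "x * x + y * y = sqrt (x * x + y * y) * sqrt (x * x + y * y)" by simp
  then show "\<exists>z\<in>carrier type_ring. x \<otimes>\<^bsub>type_ring\<^esub> x \<oplus>\<^bsub>type_ring\<^esub> y \<otimes>\<^bsub>type_ring\<^esub> y = z \<otimes>\<^bsub>type_ring\<^esub> z"
    unfolding type_ring_simps by blast
  assume "x \<otimes>\<^bsub>type_ring\<^esub> x \<oplus>\<^bsub>type_ring\<^esub> y \<otimes>\<^bsub>type_ring\<^esub> y = \<zero>\<^bsub>type_ring\<^esub>"
  then show "x = \<zero>\<^bsub>type_ring\<^esub>" by (simp add: sum_squares_eq_zero_iff)
qed

locale euclidean =
  fixes K :: "('k, 'm) ring_scheme" (structure)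
  assumes euclidean: "euclidean_field K"
begin

lemma field_K: "field K" using euclidean unfolding euclidean_field_def by blast

sublocale cring K using field_K by (simp add: field_def domain_def)

lemma zero_not_one: "\<zero> \<noteq> \<one>"
proof -
  interpret field K by (rule field_K)
  show ?thesis by simp
qed

lemma inverse: "x \<in> carrier K \<Longrightarrow> x \<noteq> \<zero> \<Longrightarrow> inv x \<in> carrier K \<and> inv x \<otimes> x = \<one>"
proof -
  assume x: "x \<in> carrier K" "x \<noteq> \<zero>"
  interpret field K by (rule field_K)
  show ?thesis using x field_Units by simp
qed

lemma mult_eq_0: "x \<in> carrier K \<Longrightarrow> y \<in> carrier K \<Longrightarrow> x \<otimes> y = \<zero> \<Longrightarrow> x = \<zero> \<or> y = \<zero>"
proof -
  assume xy: "x \<in> carrier K" "y \<in> carrier K" "x \<otimes> y = \<zero>"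
  interpret field K by (rule field_K)
  show ?thesis using xy integral by simp
qed

lemma square_cases: "x \<in> carrier K \<Longrightarrow> (\<exists>z\<in>carrier K. x = z \<otimes> z) \<or> (\<exists>z\<in>carrier K. \<ominus> x = z \<otimes> z)"
  and square_add: "x \<in> carrier K \<Longrightarrow> y \<in> carrier K \<Longrightarrow> \<exists>z\<in>carrier K. x \<otimes> x \<oplus> y \<otimes> y = z \<otimes> z"
  and square_sum_0: "x \<in> carrier K \<Longrightarrow> y \<in> carrier K \<Longrightarrow> x \<otimes> x \<oplus> y \<otimes> y = \<zero> \<Longrightarrow> x = \<zero>"
  using euclidean unfolding euclidean_field_def by blast+

lemma sq_le_refl: "x \<in> carrier K \<Longrightarrow> sq_le K x x"
  unfolding sq_le_def by (intro bexI[of _ \<zero>]) (auto simp: minus_eq r_neg)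

lemma sq_le_antisym:
  assumes "x \<in> carrier K" "y \<in> carrier K" "sq_le K x y" "sq_le K y x"
  shows "x = y"
proof -
  obtain z w where z: "z \<in> carrier K" "y \<ominus> x = z \<otimes> z" and w: "w \<in> carrier K" "x \<ominus> y = w \<otimes> w"
    using assms unfolding sq_le_def by blast
  have "z \<otimes> z \<oplus> w \<otimes> w = \<zero>" unfolding z(2)[symmetric] w(2)[symmetric] using assms by algebra
  then have "z = \<zero>" using square_sum_0 z w by blast
  then have "y \<ominus> x = \<zero>" using z by simp
  then show ?thesis using assms by (metis r_right_minus_eq)
qed

lemma sq_le_trans:
  assumes "x \<in> carrier K" "y \<in> carrier K" "u \<in> carrier K" "sq_le K x y" "sq_le K y u"
  shows "sq_le K x u"
proof -
  obtain z w where z: "z \<in> carrier K" "y \<ominus> x = z \<otimes> z" and w: "w \<in> carrier K" "u \<ominus> y = w \<otimes> w"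
    using assms unfolding sq_le_def by blast
  obtain v where v: "v \<in> carrier K" "z \<otimes> z \<oplus> w \<otimes> w = v \<otimes> v" using square_add z w by blast
  have "u \<ominus> x = z \<otimes> z \<oplus> w \<otimes> w" unfolding z(2)[symmetric] w(2)[symmetric] using assms by algebra
  then show ?thesis unfolding sq_le_def using v by auto
qed

lemma sq_le_linear:
  assumes "x \<in> carrier K" "y \<in> carrier K"
  shows "sq_le K x y \<or> sq_le K y x"
proof -
  have "\<ominus> (y \<ominus> x) = x \<ominus> y" using assms by algebra
  then show ?thesis using square_cases[of "y \<ominus> x"] assms unfolding sq_le_def by auto
qed

lemma sq_le_add:
  assumes "x \<in> carrier K" "y \<in> carrier K" "u \<in> carrier K" "sq_le K x y"
  shows "sq_le K (u \<oplus> x) (u \<oplus> y)"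
proof -
  have "(u \<oplus> y) \<ominus> (u \<oplus> x) = y \<ominus> x" using assms by algebra
  then show ?thesis using assms unfolding sq_le_def by simp
qed

lemma sq_le_mult:
  assumes "x \<in> carrier K" "y \<in> carrier K" "u \<in> carrier K" "sq_le K x y" "sq_le K \<zero> u"
  shows "sq_le K (u \<otimes> x) (u \<otimes> y)"
proof -
  obtain z w where z: "z \<in> carrier K" "y \<ominus> x = z \<otimes> z" and w: "w \<in> carrier K" "u \<ominus> \<zero> = w \<otimes> w"
    using assms unfolding sq_le_def by blast
  have "u = w \<otimes> w" using w assms by algebra
  then have "(u \<otimes> y) \<ominus> (u \<otimes> x) = (w \<otimes> w) \<otimes> (y \<ominus> x)" using assms w by algebra
  also have "\<dots> = (w \<otimes> z) \<otimes> (w \<otimes> z)" unfolding z using z w by algebra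
  finally show ?thesis using z w unfolding sq_le_def by auto
qed

lemma add_diff: "x \<in> carrier K \<Longrightarrow> y \<in> carrier K \<Longrightarrow> x \<oplus> y \<ominus> x = y"
  by algebra

end

section \<open>A type of counterexamples\<close>

text \<open>A carrier \<open>K\<close> is not a type, but a property of all euclidean fields \<open>K :: 'k ring\<close> may be
  proved in a type class: the type \<open>'k model\<close> is a copy of some counterexample to the property,
  if there is one, and of the reals otherwise. It is an ordered field in either case, and theorems
  about ordered field types then rule out the counterexample.\<close>

definition counterexample :: "'k ring \<Rightarrow> bool" where
  "counterexample K \<longleftrightarrow> euclidean_field K \<and> \<not> (virtual_roots_detect_roots K \<and> virtual_roots_exist_uniquely K)"

text \<open>The sum type has room for a copy of either field, so the underlying type does not depend
  on whether a counterexample exists.\<close>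

definition model_ring :: "('k + real) ring" where
  "model_ring = (if \<exists>K::'k ring. counterexample K then image_ring Inl (SOME K::'k ring. counterexample K)
     else image_ring Inr type_ring)"

lemma euclidean_image_ring:
  assumes "euclidean_field K" "inj_on h (carrier K)"
  shows "euclidean_field (image_ring h K)"
proof -
  have "field K" using assms unfolding euclidean_field_def by blast
  then show ?thesis
    using euclidean_field_iso[OF assms(1) inj_imp_image_ring_iso[OF assms(2)]] field.inj_imp_image_ring_is_field assms(2)
    by blast
qed

lemma euclidean_model_ring: "euclidean_field (model_ring :: ('k + real) ring)"
proof (cases "\<exists>K::'k ring. counterexample K")
  case True
  then have "counterexample (SOME K::'k ring. counterexample K)" by (rule someI_ex)
  then show ?thesis using True unfolding model_ring_def counterexample_def
    by (auto intro!: euclidean_image_ring)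
next
  case False
  then show ?thesis unfolding model_ring_def by (auto intro!: euclidean_image_ring euclidean_field_real)
qed

typedef 'k model = "carrier (model_ring :: ('k + real) ring)"
proof -
  interpret euclidean "model_ring :: ('k + real) ring" by standard (rule euclidean_model_ring)
  show ?thesis using zero_closed by blast
qed

interpretation MR: euclidean "model_ring :: ('k + real) ring"
  by standard (rule euclidean_model_ring)

lemma Rep_model_closed [simp]: "Rep_model x \<in> carrier model_ring"
  by (rule Rep_model)

instantiation model :: (type) linordered_field
begin

definition "0 = Abs_model (\<zero>\<^bsub>model_ring\<^esub>)"
definition "1 = Abs_model (\<one>\<^bsub>model_ring\<^esub>)"
definition "x + y = Abs_model (Rep_model x \<oplus>\<^bsub>model_ring\<^esub> Rep_model y)"
definition "x * y = Abs_model (Rep_model x \<otimes>\<^bsub>model_ring\<^esub> Rep_model y)"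
definition "- x = Abs_model (\<ominus>\<^bsub>model_ring\<^esub> Rep_model x)"
definition "x - y = Abs_model (Rep_model x \<ominus>\<^bsub>model_ring\<^esub> Rep_model y)"
definition inverse_model :: "'a model \<Rightarrow> 'a model" where
  "inverse_model x = (if x = 0 then 0 else Abs_model (inv\<^bsub>model_ring\<^esub> (Rep_model x)))"
definition divide_model :: "'a model \<Rightarrow> 'a model \<Rightarrow> 'a model" where
  "divide_model x y = x * inverse y"
definition "x \<le> y \<longleftrightarrow> sq_le model_ring (Rep_model x) (Rep_model y)"
definition less_model :: "'a model \<Rightarrow> 'a model \<Rightarrow> bool" where "less_model x y \<longleftrightarrow> x \<le> y \<and> \<not> y \<le> x"
definition abs_model :: "'a model \<Rightarrow> 'a model" where "abs_model x = (if x < 0 then - x else x)"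
definition sgn_model :: "'a model \<Rightarrow> 'a model" where "sgn_model x = (if x = 0 then 0 else if 0 < x then 1 else - 1)"

lemma Rep_model_simps:
  "Rep_model 0 = \<zero>\<^bsub>model_ring\<^esub>" "Rep_model 1 = \<one>\<^bsub>model_ring\<^esub>"
  "Rep_model (x + y) = Rep_model x \<oplus>\<^bsub>model_ring\<^esub> Rep_model y"
  "Rep_model (x * y) = Rep_model x \<otimes>\<^bsub>model_ring\<^esub> Rep_model y"
  "Rep_model (- x) = \<ominus>\<^bsub>model_ring\<^esub> Rep_model x"
  "Rep_model (x - y) = Rep_model x \<ominus>\<^bsub>model_ring\<^esub> Rep_model y"
  by (simp_all add: zero_model_def one_model_def plus_model_def times_model_def uminus_model_def minus_model_def
      Abs_model_inverse)

instance
proof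
  note eqI = Rep_model_inject[THEN iffD1]
  fix a b c :: "'a model"
  show "a + b + c = a + (b + c)" "a + b = b + a" "0 + a = a" "- a + a = 0" "a - b = a + - b"
    "a * b * c = a * (b * c)" "a * b = b * a" "1 * a = a" "(a + b) * c = a * c + b * c"
    by (rule eqI, simp add: Rep_model_simps MR.a_ac MR.m_ac MR.l_neg MR.r_neg MR.minus_eq MR.l_distr MR.r_distr)+
  show "(0::'a model) \<noteq> 1" using MR.zero_not_one by (metis Rep_model_simps(1,2))
  show "inverse (0::'a model) = 0" by (simp add: inverse_model_def)
  show "inverse a * a = 1" if "a \<noteq> 0"
  proof -
    have "Rep_model a \<noteq> \<zero>\<^bsub>model_ring\<^esub>" using that by (metis Rep_model_inject Rep_model_simps(1))
    from MR.inverse[OF Rep_model_closed this] show ?thesis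
      using that by (intro eqI) (simp add: Rep_model_simps inverse_model_def Abs_model_inverse)
  qed
  show "a div b = a * inverse b" by (simp add: divide_model_def)
  show "(a < b) = (a \<le> b \<and> \<not> b \<le> a)" by (simp add: less_model_def)
  show "a \<le> a" "a \<le> b \<or> b \<le> a" unfolding less_eq_model_def
    by (rule MR.sq_le_refl[OF Rep_model_closed], rule MR.sq_le_linear[OF Rep_model_closed Rep_model_closed])
  show "a \<le> c" if "a \<le> b" "b \<le> c"
    using that unfolding less_eq_model_def by (rule MR.sq_le_trans[OF Rep_model_closed Rep_model_closed Rep_model_closed])
  show anti: "a = b" if "a \<le> b" "b \<le> a" for a b :: "'a model"
    using that unfolding less_eq_model_def by (rule eqI[OF MR.sq_le_antisym[OF Rep_model_closed Rep_model_closed]])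
  show "c + a \<le> c + b" if "a \<le> b"
    using that unfolding less_eq_model_def Rep_model_simps by (rule MR.sq_le_add[OF Rep_model_closed Rep_model_closed Rep_model_closed])
  show "c * a < c * b" if "a < b" "0 < c"
  proof -
    have "c * a \<le> c * b" using that unfolding less_model_def less_eq_model_def Rep_model_simps by (intro MR.sq_le_mult[OF Rep_model_closed Rep_model_closed Rep_model_closed]) auto
    moreover have "c * a \<noteq> c * b"
    proof
      assume "c * a = c * b"
      then have "Rep_model c \<otimes>\<^bsub>model_ring\<^esub> Rep_model a = Rep_model c \<otimes>\<^bsub>model_ring\<^esub> Rep_model b" by (metis Rep_model_simps(4))
      then have "Rep_model c \<otimes>\<^bsub>model_ring\<^esub> (Rep_model a \<ominus>\<^bsub>model_ring\<^esub> Rep_model b) = \<zero>\<^bsub>model_ring\<^esub>"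
        by (simp add: MR.minus_eq MR.r_distr MR.r_minus MR.r_neg)
      then have "Rep_model c = Rep_model 0 \<or> Rep_model a \<ominus>\<^bsub>model_ring\<^esub> Rep_model b = \<zero>\<^bsub>model_ring\<^esub>"
        using MR.mult_eq_0[OF Rep_model_closed MR.minus_closed[OF Rep_model_closed Rep_model_closed]]
        unfolding Rep_model_simps by blast
      then have "c = 0 \<or> a = b" by (metis MR.r_right_minus_eq Rep_model_closed Rep_model_inject)
      then show False using that unfolding less_model_def by auto
    qed
    ultimately show ?thesis using anti unfolding less_model_def by blast
  qed
  have mult0: "a * 0 = 0" for a :: "'a model"
    by (rule eqI) (simp add: Rep_model_simps)
  then show "a * 0 = 0" .
  show "0 * a = 0" by (rule eqI) (simp add: Rep_model_simps)
  show "a + b - a = b"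
    by (rule eqI) (simp add: Rep_model_simps MR.add_diff)
  show "a - b - c = a - (b + c)"
    by (rule eqI) (simp add: Rep_model_simps MR.minus_eq MR.a_ac MR.minus_add)
  show "\<bar>a\<bar> = (if a < 0 then - a else a)" by (simp add: abs_model_def)
  show "sgn a = (if a = 0 then 0 else if 0 < a then 1 else - 1)" by (simp add: sgn_model_def)
qed

end

theorem virtual_roots_of_euclidean_field:
  fixes K :: "'k ring"
  assumes "euclidean_field K"
  shows "virtual_roots_detect_roots K" "virtual_roots_exist_uniquely K"
proof -
  have "\<not> counterexample K"
  proof
    assume "counterexample K"
    then have ex: "\<exists>K::'k ring. counterexample K" by blast
    \<comment> \<open>The type copies the counterexample picked by \<open>SOME\<close>, which may
      differ from \<open>K\<close>; the contradiction is reached for that one.\<close>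
    define L where "L = (SOME K::'k ring. counterexample K)"
    have cL: "counterexample L" using someI_ex[OF ex] unfolding L_def .
    then have eL: "euclidean_field L" unfolding counterexample_def by blast
    interpret L: euclidean L by standard (rule eL)
    have mr: "model_ring = image_ring Inl L" using ex unfolding model_ring_def L_def by simp
    define h where "h x = (inv_into (carrier L) Inl (Rep_model x :: 'k + real))" for x :: "'k model"
    have iso: "Inl \<in> ring_iso L (model_ring :: ('k + real) ring)" unfolding mr by (rule inj_imp_image_ring_iso) simp
    have car: "carrier (model_ring :: ('k + real) ring) = Inl ` carrier L" unfolding mr image_ring_carrier ..
    have hI: "h x \<in> carrier L" "Inl (h x) = Rep_model x" for x
    proof -
      have "Rep_model x \<in> Inl ` carrier L" using Rep_model_closed[of x] unfolding car .
      then show "h x \<in> carrier L" "Inl (h x) = Rep_model x" unfolding h_def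
        by (rule inv_into_into, rule f_inv_into_f)
    qed
    have hI': "h x = y" if "Inl y = Rep_model x" for x y using hI(2)[of x] that by (metis sum.inject(1))
    note ih = ring_iso_memE[OF iso]
    have field_model: "field_model L h"
    proof
      show "euclidean_field L" by (rule eL)
      show "h \<in> ring_hom type_ring L"
        by (rule ring_hom_memI) (auto intro!: hI' hI(1) simp: ih hI Rep_model_simps)
      show "bij_betw h UNIV (carrier L)"
        unfolding bij_betw_def
      proof
        show "inj h" by (rule injI) (metis hI(2) Rep_model_inject)
        show "range h = carrier L"
        proof
          show "carrier L \<subseteq> range h"
          proof
            fix y assume "y \<in> carrier L"
            then have "Rep_model (Abs_model (Inl y)) = Inl y" using car by (intro Abs_model_inverse) auto
            then have "h (Abs_model (Inl y)) = y" by (intro hI') simp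
            then show "y \<in> range h" by (metis rangeI)
          qed
        qed (use hI in auto)
      qed
      fix x y :: "'k model"
      have minus: "Inl (h y \<ominus>\<^bsub>L\<^esub> h x) = Rep_model (y - x)"
      proof -
        have "Inl (h y \<ominus>\<^bsub>L\<^esub> h x) \<oplus>\<^bsub>model_ring\<^esub> Rep_model x = Rep_model y"
          using hI by (simp add: ih(3)[symmetric] hI(2)[symmetric]) (simp add: L.minus_eq L.a_assoc L.l_neg)
        moreover have "Inl (h y \<ominus>\<^bsub>L\<^esub> h x) \<in> carrier model_ring" using ih hI by simp
        ultimately show ?thesis unfolding Rep_model_simps
          by (metis MR.minus_eq MR.a_assoc MR.r_neg MR.r_zero Rep_model_closed MR.a_inv_closed)
      qed
      show "x \<le> y \<longleftrightarrow> sq_le L (h x) (h y)"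
      proof
        assume "x \<le> y"
        then obtain z where z: "z \<in> carrier model_ring" "Rep_model (y - x) = z \<otimes>\<^bsub>model_ring\<^esub> z"
          unfolding less_eq_model_def sq_le_def Rep_model_simps by blast
        then obtain w where w: "w \<in> carrier L" "z = Inl w" using car by auto
        have "Inl (h y \<ominus>\<^bsub>L\<^esub> h x) = (Inl (w \<otimes>\<^bsub>L\<^esub> w) :: 'k + real)" using minus z w ih by simp
        then show "sq_le L (h x) (h y)" unfolding sq_le_def using w by auto
      next
        assume "sq_le L (h x) (h y)"
        then obtain w where w: "w \<in> carrier L" "h y \<ominus>\<^bsub>L\<^esub> h x = w \<otimes>\<^bsub>L\<^esub> w" unfolding sq_le_def by blast
        then have "Rep_model (y - x) = Inl w \<otimes>\<^bsub>model_ring\<^esub> Inl w" using minus ih by simp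
        moreover have "Inl w \<in> carrier model_ring" using w ih by simp
        ultimately show "x \<le> y" unfolding less_eq_model_def sq_le_def Rep_model_simps by blast
      qed
    qed
    show False using cL field_model.virtual_roots_detect_roots[OF field_model]
        field_model.virtual_roots_exist_uniquely[OF field_model] unfolding counterexample_def by blast
  qed
  then show "virtual_roots_detect_roots K" "virtual_roots_exist_uniquely K"
    using assms unfolding counterexample_def by auto
qed

section \<open>The field of fractions\<close>

context domain
begin

lemma frac_pairs_iff: "(a, b) \<in> frac_pairs R \<longleftrightarrow> a \<in> carrier R \<and> b \<in> carrier R \<and> b \<noteq> \<zero>"
  unfolding frac_pairs_def by auto

lemma equiv_frac_rel: "equiv (frac_pairs R) (frac_rel R)"
proof (rule equivI)
  show "frac_rel R \<subseteq> frac_pairs R \<times> frac_pairs R" unfolding frac_rel_def by auto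
  show "refl_on (frac_pairs R) (frac_rel R)" unfolding frac_rel_def refl_on_def by auto
  show "sym (frac_rel R)" unfolding frac_rel_def sym_def by auto
  show "trans (frac_rel R)"
  proof (rule transI)
    fix p q r assume "(p, q) \<in> frac_rel R" "(q, r) \<in> frac_rel R"
    moreover obtain a b c d e f where [simp]: "p = (a, b)" "q = (c, d)" "r = (e, f)" by (metis prod.exhaust)
    ultimately have *: "a \<in> carrier R" "b \<in> carrier R" "b \<noteq> \<zero>" "c \<in> carrier R" "d \<in> carrier R" "d \<noteq> \<zero>"
      "e \<in> carrier R" "f \<in> carrier R" "f \<noteq> \<zero>" "a \<otimes> d = c \<otimes> b" "c \<otimes> f = e \<otimes> d"
      unfolding frac_rel_def by (auto simp: frac_pairs_iff)
    have "d \<otimes> (a \<otimes> f) = (a \<otimes> d) \<otimes> f" using *(1-9) by (simp add: m_ac)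
    also have "\<dots> = (c \<otimes> f) \<otimes> b" unfolding *(10) using *(1-9) by (simp add: m_ac)
    also have "\<dots> = d \<otimes> (e \<otimes> b)" unfolding *(11) using *(1-9) by (simp add: m_ac)
    finally have "a \<otimes> f = e \<otimes> b" using * by (simp add: m_lcancel)
    then show "(p, r) \<in> frac_rel R" using * unfolding frac_rel_def by (simp add: frac_pairs_iff)
  qed
qed

definition nz where "nz b \<longleftrightarrow> b \<in> carrier R \<and> b \<noteq> \<zero>"

lemma nz_simps: "nz b \<Longrightarrow> b \<in> carrier R" "nz b \<Longrightarrow> b \<noteq> \<zero>" "nz b \<Longrightarrow> nz c \<Longrightarrow> nz (b \<otimes> c)" "nz \<one>"
  unfolding nz_def by (auto simp: integral_iff)

lemma fraction_eq_iff:
  assumes "a \<in> carrier R" "nz b" "c \<in> carrier R" "nz d"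
  shows "fraction R a b = fraction R c d \<longleftrightarrow> a \<otimes> d = c \<otimes> b"
proof -
  have p: "(a, b) \<in> frac_pairs R" "(c, d) \<in> frac_pairs R" using assms by (auto simp: frac_pairs_iff nz_def)
  have "fraction R a b = fraction R c d \<longleftrightarrow> ((a, b), (c, d)) \<in> frac_rel R"
    unfolding fraction_def using eq_equiv_class_iff[OF equiv_frac_rel p] .
  then show ?thesis using p unfolding frac_rel_def by auto
qed

lemma fraction_member:
  assumes "a \<in> carrier R" "nz b" "p \<in> fraction R a b"
  shows "fst p \<in> carrier R" "nz (snd p)" "fst p \<otimes> b = a \<otimes> snd p"
  using assms unfolding fraction_def frac_rel_def by (auto simp: frac_pairs_def nz_def)

lemma fraction_nonempty: "a \<in> carrier R \<Longrightarrow> nz b \<Longrightarrow> fraction R a b \<noteq> {}"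
  unfolding fraction_def using equiv_class_self[OF equiv_frac_rel, of "(a, b)"] by (auto simp: frac_pairs_iff nz_def)

lemma carrier_fraction_field: "carrier (fraction_field R) = {fraction R a b | a b. a \<in> carrier R \<and> nz b}"
  unfolding fraction_field_def fraction_def quotient_def by (auto simp: frac_pairs_def nz_def)

lemma fractionE:
  assumes "x \<in> carrier (fraction_field R)"
  obtains a b where "a \<in> carrier R" "nz b" "x = fraction R a b"
  using assms unfolding carrier_fraction_field by blast

lemma fraction_closed: "a \<in> carrier R \<Longrightarrow> nz b \<Longrightarrow> fraction R a b \<in> carrier (fraction_field R)"
  unfolding carrier_fraction_field by blast

text \<open>The operations of \<open>fraction_field\<close> are unions over all representatives.
  Each pair of representatives yields the same class, and classes are nonempty, so the union
  collapses.\<close>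

lemma mult_fraction:
  assumes "a \<in> carrier R" "nz b" "c \<in> carrier R" "nz d"
  shows "fraction R a b \<otimes>\<^bsub>fraction_field R\<^esub> fraction R c d = fraction R (a \<otimes> c) (b \<otimes> d)"
proof -
  have "fraction R (fst p \<otimes> fst q) (snd p \<otimes> snd q) = fraction R (a \<otimes> c) (b \<otimes> d)"
    if "p \<in> fraction R a b" "q \<in> fraction R c d" for p q
  proof -
    note p = fraction_member[OF assms(1,2) that(1)] and q = fraction_member[OF assms(3,4) that(2)]
    have "(fst p \<otimes> fst q) \<otimes> (b \<otimes> d) = (fst p \<otimes> b) \<otimes> (fst q \<otimes> d)"
      using p(1,2) q(1,2) assms nz_simps(1) by (simp add: m_ac)
    also have "\<dots> = (a \<otimes> c) \<otimes> (snd p \<otimes> snd q)" unfolding p(3) q(3)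
      using p(1,2) q(1,2) assms nz_simps(1) by (simp add: m_ac)
    finally show ?thesis using p q assms nz_simps by (simp add: fraction_eq_iff)
  qed
  then show ?thesis unfolding fraction_field_def using fraction_nonempty assms
    by (simp add: case_prod_beta)
qed

lemma add_fraction:
  assumes "a \<in> carrier R" "nz b" "c \<in> carrier R" "nz d"
  shows "fraction R a b \<oplus>\<^bsub>fraction_field R\<^esub> fraction R c d = fraction R (a \<otimes> d \<oplus> c \<otimes> b) (b \<otimes> d)"
proof -
  have "fraction R (fst p \<otimes> snd q \<oplus> fst q \<otimes> snd p) (snd p \<otimes> snd q) = fraction R (a \<otimes> d \<oplus> c \<otimes> b) (b \<otimes> d)"
    if "p \<in> fraction R a b" "q \<in> fraction R c d" for p q
  proof -
    note p = fraction_member[OF assms(1,2) that(1)] and q = fraction_member[OF assms(3,4) that(2)]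
    have "(fst p \<otimes> snd q \<oplus> fst q \<otimes> snd p) \<otimes> (b \<otimes> d) = (fst p \<otimes> b) \<otimes> (snd q \<otimes> d) \<oplus> (fst q \<otimes> d) \<otimes> (snd p \<otimes> b)"
      using p(1,2) q(1,2) assms nz_simps(1) by (simp add: m_ac l_distr r_distr)
    also have "\<dots> = (a \<otimes> d \<oplus> c \<otimes> b) \<otimes> (snd p \<otimes> snd q)" unfolding p(3) q(3)
      using p(1,2) q(1,2) assms nz_simps(1) by (simp add: m_ac l_distr r_distr)
    finally show ?thesis using p q assms nz_simps by (simp add: fraction_eq_iff)
  qed
  then show ?thesis unfolding fraction_field_def using fraction_nonempty assms
    by (simp add: case_prod_beta)
qed

lemma one_zero_fraction:
  "\<one>\<^bsub>fraction_field R\<^esub> = fraction R \<one> \<one>" "\<zero>\<^bsub>fraction_field R\<^esub> = fraction R \<zero> \<one>"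
  unfolding fraction_field_def by simp_all

lemma fraction_eqI:
  assumes "a \<in> carrier R" "nz b" "c \<in> carrier R" "nz d" "a \<otimes> d = c \<otimes> b"
  shows "fraction R a b = fraction R c d"
  using assms fraction_eq_iff by simp

lemma field_fraction_field: "field (fraction_field R)"
proof -
  have "abelian_group (fraction_field R)"
  proof (rule abelian_groupI)
    fix x y z assume "x \<in> carrier (fraction_field R)" "y \<in> carrier (fraction_field R)" "z \<in> carrier (fraction_field R)"
    then show "x \<oplus>\<^bsub>fraction_field R\<^esub> y \<oplus>\<^bsub>fraction_field R\<^esub> z = x \<oplus>\<^bsub>fraction_field R\<^esub> (y \<oplus>\<^bsub>fraction_field R\<^esub> z)"
      by (elim fractionE) (auto simp: add_fraction nz_simps m_ac l_distr r_distr a_ac)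
  next
    fix x y assume "x \<in> carrier (fraction_field R)" "y \<in> carrier (fraction_field R)"
    then show "x \<oplus>\<^bsub>fraction_field R\<^esub> y \<in> carrier (fraction_field R)"
      "x \<oplus>\<^bsub>fraction_field R\<^esub> y = y \<oplus>\<^bsub>fraction_field R\<^esub> x"
      by (auto elim!: fractionE simp: add_fraction nz_simps m_ac a_ac intro!: fraction_closed)
  next
    fix x assume "x \<in> carrier (fraction_field R)"
    then obtain a b where x: "a \<in> carrier R" "nz b" "x = fraction R a b" by (rule fractionE)
    then show "\<zero>\<^bsub>fraction_field R\<^esub> \<oplus>\<^bsub>fraction_field R\<^esub> x = x" by (simp add: one_zero_fraction add_fraction nz_simps)
    have "fraction R (\<ominus> a) b \<oplus>\<^bsub>fraction_field R\<^esub> x = \<zero>\<^bsub>fraction_field R\<^esub>"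
      using x by (simp add: one_zero_fraction add_fraction nz_simps l_minus l_neg) (rule fraction_eqI, auto simp: nz_simps)
    then show "\<exists>y\<in>carrier (fraction_field R). y \<oplus>\<^bsub>fraction_field R\<^esub> x = \<zero>\<^bsub>fraction_field R\<^esub>"
      using x by (meson a_inv_closed fraction_closed)
  qed (auto simp: one_zero_fraction nz_simps intro: fraction_closed)
  moreover have "Group.comm_monoid (fraction_field R)"
  proof (rule comm_monoidI)
    fix x y z assume "x \<in> carrier (fraction_field R)" "y \<in> carrier (fraction_field R)" "z \<in> carrier (fraction_field R)"
    then show "x \<otimes>\<^bsub>fraction_field R\<^esub> y \<otimes>\<^bsub>fraction_field R\<^esub> z = x \<otimes>\<^bsub>fraction_field R\<^esub> (y \<otimes>\<^bsub>fraction_field R\<^esub> z)"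
      by (elim fractionE) (auto simp: mult_fraction nz_simps m_ac)
  next
    fix x y assume "x \<in> carrier (fraction_field R)" "y \<in> carrier (fraction_field R)"
    then show "x \<otimes>\<^bsub>fraction_field R\<^esub> y \<in> carrier (fraction_field R)"
      "x \<otimes>\<^bsub>fraction_field R\<^esub> y = y \<otimes>\<^bsub>fraction_field R\<^esub> x"
      by (auto elim!: fractionE simp: mult_fraction nz_simps m_ac intro!: fraction_closed)
  qed (auto elim!: fractionE simp: one_zero_fraction nz_simps mult_fraction intro: fraction_closed)
  moreover have "(x \<oplus>\<^bsub>fraction_field R\<^esub> y) \<otimes>\<^bsub>fraction_field R\<^esub> z =
      x \<otimes>\<^bsub>fraction_field R\<^esub> z \<oplus>\<^bsub>fraction_field R\<^esub> y \<otimes>\<^bsub>fraction_field R\<^esub> z"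
    if "x \<in> carrier (fraction_field R)" "y \<in> carrier (fraction_field R)" "z \<in> carrier (fraction_field R)" for x y z
    using that
  proof (elim fractionE)
    fix a b c d e f assume *: "a \<in> carrier R" "nz b" "x = fraction R a b" "c \<in> carrier R" "nz d" "y = fraction R c d"
      "e \<in> carrier R" "nz f" "z = fraction R e f"
    show ?thesis using * by (simp add: add_fraction mult_fraction nz_simps)
       (rule fraction_eqI, auto simp: nz_simps m_ac l_distr r_distr)
  qed
  ultimately have cring: "cring (fraction_field R)" by (rule cringI)
  show ?thesis
  proof (rule cring.cring_fieldI[OF cring])
    interpret K: cring "fraction_field R" by (rule cring)
    show "Units (fraction_field R) = carrier (fraction_field R) - {\<zero>\<^bsub>fraction_field R\<^esub>}"
    proof (intro equalityI subsetI DiffI)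
      fix x assume x: "x \<in> Units (fraction_field R)"
      then show "x \<in> carrier (fraction_field R)" by (rule K.Units_closed)
      show "x \<notin> {\<zero>\<^bsub>fraction_field R\<^esub>}"
      proof
        assume "x \<in> {\<zero>\<^bsub>fraction_field R\<^esub>}"
        then have "\<one>\<^bsub>fraction_field R\<^esub> = \<zero>\<^bsub>fraction_field R\<^esub>"
          using x by (metis K.Units_r_inv K.Units_inv_closed K.l_null singletonD)
        then show False unfolding one_zero_fraction by (simp add: fraction_eq_iff nz_simps)
      qed
    next
      fix x assume x: "x \<in> carrier (fraction_field R) - {\<zero>\<^bsub>fraction_field R\<^esub>}"
      then have "x \<in> carrier (fraction_field R)" by blast
      then obtain a b where ab: "a \<in> carrier R" "nz b" "x = fraction R a b" by (rule fractionE)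
      have "a \<noteq> \<zero>" using ab x by (auto simp: one_zero_fraction fraction_eq_iff nz_simps)
      then have "nz a" using ab by (simp add: nz_def)
      then have y: "x \<otimes>\<^bsub>fraction_field R\<^esub> fraction R b a = \<one>\<^bsub>fraction_field R\<^esub>" "fraction R b a \<in> carrier (fraction_field R)"
        using ab by (simp_all add: mult_fraction nz_simps one_zero_fraction m_comm fraction_eq_iff fraction_closed)
      then have "fraction R b a \<otimes>\<^bsub>fraction_field R\<^esub> x = \<one>\<^bsub>fraction_field R\<^esub>"
        using K.m_comm[of x "fraction R b a"] x by simp
      then show "x \<in> Units (fraction_field R)" unfolding Units_def using x y by blast
    qed
  qed
qed

lemma frac_embed_hom: "frac_embed R \<in> ring_hom R (fraction_field R)"
  by (rule ring_hom_memI) (auto simp: frac_embed_def mult_fraction add_fraction nz_simps one_zero_fraction intro: fraction_closed)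

lemma frac_embed_inj: "a \<in> carrier R \<Longrightarrow> b \<in> carrier R \<Longrightarrow> frac_embed R a = frac_embed R b \<Longrightarrow> a = b"
  by (simp add: frac_embed_def fraction_eq_iff nz_simps)

lemma frac_embed_quotient:
  assumes "x \<in> carrier (fraction_field R)"
  shows "\<exists>a\<in>carrier R. \<exists>b\<in>carrier R. b \<noteq> \<zero> \<and> frac_embed R b \<otimes>\<^bsub>fraction_field R\<^esub> x = frac_embed R a"
  using assms
proof (rule fractionE)
  fix a b assume ab: "a \<in> carrier R" "nz b" "x = fraction R a b"
  then have "frac_embed R b \<otimes>\<^bsub>fraction_field R\<^esub> x = frac_embed R a"
    by (simp add: frac_embed_def mult_fraction nz_simps) (rule fraction_eqI, auto simp: nz_simps m_ac)
  then show ?thesis using ab nz_simps by blast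
qed

end

section \<open>Elementary theory of f-rings\<close>

context f_ring
begin

definition pp :: "'a \<Rightarrow> 'a" where "pp x = x \<curlyvee> \<zero>"
definition np :: "'a \<Rightarrow> 'a" where "np x = (\<ominus> x) \<curlyvee> \<zero>"

lemma join_ops_closed [simp]:
  "x \<in> carrier A \<Longrightarrow> y \<in> carrier A \<Longrightarrow> x \<curlyvee> y \<in> carrier A"
  "x \<in> carrier A \<Longrightarrow> y \<in> carrier A \<Longrightarrow> x \<curlywedge> y \<in> carrier A"
  "x \<in> carrier A \<Longrightarrow> pp x \<in> carrier A" "x \<in> carrier A \<Longrightarrow> np x \<in> carrier A"
  "x \<in> carrier A \<Longrightarrow> abs_val x \<in> carrier A"
  by (simp_all add: join_closed meet_def pp_def np_def abs_val_def)

lemma add_eq_self: "n \<in> carrier A \<Longrightarrow> y \<in> carrier A \<Longrightarrow> n \<oplus> y = n \<Longrightarrow> y = \<zero>"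
  using r_neg1[of n y] l_neg[of n] by simp

lemma le_refl: "x \<in> carrier A \<Longrightarrow> x \<preceq> x"
  by (simp add: le_def join_idem)

lemma le_antisym: "x \<in> carrier A \<Longrightarrow> y \<in> carrier A \<Longrightarrow> x \<preceq> y \<Longrightarrow> y \<preceq> x \<Longrightarrow> x = y"
  by (metis le_def join_comm)

lemma le_trans: "x \<in> carrier A \<Longrightarrow> y \<in> carrier A \<Longrightarrow> z \<in> carrier A \<Longrightarrow> x \<preceq> y \<Longrightarrow> y \<preceq> z \<Longrightarrow> x \<preceq> z"
  by (metis le_def join_assoc)

lemma join_ub: "x \<in> carrier A \<Longrightarrow> y \<in> carrier A \<Longrightarrow> x \<preceq> x \<curlyvee> y" "x \<in> carrier A \<Longrightarrow> y \<in> carrier A \<Longrightarrow> y \<preceq> x \<curlyvee> y"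
  unfolding le_def by (metis join_assoc join_comm join_idem)+

lemma join_least: "x \<in> carrier A \<Longrightarrow> y \<in> carrier A \<Longrightarrow> z \<in> carrier A \<Longrightarrow> x \<preceq> z \<Longrightarrow> y \<preceq> z \<Longrightarrow> x \<curlyvee> y \<preceq> z"
  unfolding le_def by (metis join_assoc)

lemma le_add: "x \<in> carrier A \<Longrightarrow> y \<in> carrier A \<Longrightarrow> z \<in> carrier A \<Longrightarrow> x \<preceq> y \<Longrightarrow> z \<oplus> x \<preceq> z \<oplus> y"
  unfolding le_def by (metis add_join)

lemma le_add_cancel: "x \<in> carrier A \<Longrightarrow> y \<in> carrier A \<Longrightarrow> z \<in> carrier A \<Longrightarrow> z \<oplus> x \<preceq> z \<oplus> y \<longleftrightarrow> x \<preceq> y"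
  using le_add[of x y z] le_add[of "z \<oplus> x" "z \<oplus> y" "\<ominus> z"] by (auto simp: r_neg1)

lemma le_iff_diff: "x \<in> carrier A \<Longrightarrow> y \<in> carrier A \<Longrightarrow> x \<preceq> y \<longleftrightarrow> \<zero> \<preceq> y \<ominus> x"
  using le_add_cancel[of \<zero> "y \<ominus> x" x] by (simp add: minus_eq a_lcomm[of x y] r_neg)

lemma le_neg: "x \<in> carrier A \<Longrightarrow> y \<in> carrier A \<Longrightarrow> \<ominus> y \<preceq> \<ominus> x \<longleftrightarrow> x \<preceq> y"
  using le_iff_diff[of x y] le_iff_diff[of "\<ominus> y" "\<ominus> x"] by (simp add: minus_eq a_comm)

lemma add_mono:
  assumes "x \<in> carrier A" "y \<in> carrier A" "z \<in> carrier A" "w \<in> carrier A" "x \<preceq> y" "z \<preceq> w"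
  shows "x \<oplus> z \<preceq> y \<oplus> w"
proof -
  have "x \<oplus> z \<preceq> x \<oplus> w" using assms by (intro le_add)
  moreover have "x \<oplus> w \<preceq> y \<oplus> w" using assms le_add[of x y w] by (simp add: a_comm)
  ultimately show ?thesis using assms le_trans[of "x \<oplus> z" "x \<oplus> w" "y \<oplus> w"] by simp
qed

lemma add_nonneg: "x \<in> carrier A \<Longrightarrow> y \<in> carrier A \<Longrightarrow> \<zero> \<preceq> x \<Longrightarrow> \<zero> \<preceq> y \<Longrightarrow> \<zero> \<preceq> x \<oplus> y"
  using add_mono[of \<zero> x \<zero> y] by simp

lemma meet_lb: "x \<in> carrier A \<Longrightarrow> y \<in> carrier A \<Longrightarrow> x \<curlywedge> y \<preceq> x" "x \<in> carrier A \<Longrightarrow> y \<in> carrier A \<Longrightarrow> x \<curlywedge> y \<preceq> y"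
  using join_ub[of "\<ominus> x" "\<ominus> y"] le_neg[of "x \<curlywedge> y" x] le_neg[of "x \<curlywedge> y" y] by (auto simp: meet_def)

lemma meet_greatest:
  "x \<in> carrier A \<Longrightarrow> y \<in> carrier A \<Longrightarrow> z \<in> carrier A \<Longrightarrow> z \<preceq> x \<Longrightarrow> z \<preceq> y \<Longrightarrow> z \<preceq> x \<curlywedge> y"
  using join_least[of "\<ominus> x" "\<ominus> y" "\<ominus> z"] le_neg[of z "x \<curlywedge> y"] by (auto simp: meet_def le_neg)

lemma meet_eq: "x \<in> carrier A \<Longrightarrow> y \<in> carrier A \<Longrightarrow> x \<preceq> y \<Longrightarrow> x \<curlywedge> y = x"
  by (meson le_antisym le_refl meet_greatest meet_lb(1) join_ops_closed(2))

lemma pp_nonneg [simp]: "x \<in> carrier A \<Longrightarrow> \<zero> \<preceq> pp x" "x \<in> carrier A \<Longrightarrow> \<zero> \<preceq> np x"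
  unfolding pp_def np_def by (simp_all add: join_ub)

lemma pp_eq: "\<zero> \<preceq> x \<Longrightarrow> pp x = x"
  unfolding pp_def le_def .

lemma np_eq_0: "x \<in> carrier A \<Longrightarrow> np x = \<zero> \<longleftrightarrow> \<zero> \<preceq> x"
  using le_neg[of \<zero> x] unfolding np_def le_def by (simp add: join_comm)

lemma np_minus: "x \<in> carrier A \<Longrightarrow> np (\<ominus> x) = pp x"
  unfolding pp_def np_def by simp

lemma pp_minus_np: "x \<in> carrier A \<Longrightarrow> x = pp x \<ominus> np x"
proof -
  assume x: "x \<in> carrier A"
  have "x \<oplus> np x = pp x" unfolding np_def pp_def using x by (simp add: add_join r_neg join_comm)
  then show ?thesis using x by (metis a_minus_def add.inv_solve_right join_ops_closed(3,4))
qed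

lemma pos_mult_join_nonneg:
  "a \<in> carrier A \<Longrightarrow> y \<in> carrier A \<Longrightarrow> z \<in> carrier A \<Longrightarrow> \<zero> \<preceq> a \<Longrightarrow> a \<otimes> (y \<curlyvee> z) = (a \<otimes> y) \<curlyvee> (a \<otimes> z)"
  using pos_mult_join[of a y z] pp_eq[of a] unfolding pp_def by simp

lemma pos_mult_meet:
  "a \<in> carrier A \<Longrightarrow> y \<in> carrier A \<Longrightarrow> z \<in> carrier A \<Longrightarrow> \<zero> \<preceq> a \<Longrightarrow> a \<otimes> (y \<curlywedge> z) = (a \<otimes> y) \<curlywedge> (a \<otimes> z)"
  unfolding meet_def by (simp add: r_minus pos_mult_join_nonneg)

lemma mult_mono: "a \<in> carrier A \<Longrightarrow> x \<in> carrier A \<Longrightarrow> y \<in> carrier A \<Longrightarrow> \<zero> \<preceq> a \<Longrightarrow> x \<preceq> y \<Longrightarrow> a \<otimes> x \<preceq> a \<otimes> y"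
  unfolding le_def by (metis le_def pos_mult_join_nonneg)

lemma mult_nonneg: "a \<in> carrier A \<Longrightarrow> b \<in> carrier A \<Longrightarrow> \<zero> \<preceq> a \<Longrightarrow> \<zero> \<preceq> b \<Longrightarrow> \<zero> \<preceq> a \<otimes> b"
  using mult_mono[of a \<zero> b] by simp

text \<open>Expanding the meet turns \<open>np x - (pp x \<curlywedge> np x)\<close> into \<open>(np
  x - pp x) \<curlyvee> \<zero> = (- x) \<curlyvee> \<zero>\<close>, which is \<open>np x\<close>
  again.\<close>

lemma pp_meet_np: "x \<in> carrier A \<Longrightarrow> pp x \<curlywedge> np x = \<zero>"
proof -
  assume x: "x \<in> carrier A"
  have "np x \<oplus> \<ominus> (pp x \<curlywedge> np x) = np x \<oplus> ((\<ominus> pp x) \<curlyvee> (\<ominus> np x))" using x by (simp add: meet_def)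
  also have "\<dots> = (np x \<oplus> \<ominus> pp x) \<curlyvee> \<zero>" using x by (simp add: add_join r_neg)
  also have "np x \<oplus> \<ominus> pp x = \<ominus> x"
  proof -
    have "\<ominus> (pp x \<ominus> np x) = np x \<oplus> \<ominus> pp x" using x by (simp add: minus_eq minus_add a_comm)
    then show ?thesis using pp_minus_np[OF x] by simp
  qed
  finally have "np x \<oplus> \<ominus> (pp x \<curlywedge> np x) = np x" unfolding np_def .
  then have "\<ominus> (pp x \<curlywedge> np x) = \<zero>" using x by (intro add_eq_self[of "np x"]) auto
  then have "\<ominus> (\<ominus> (pp x \<curlywedge> np x)) = \<zero>" by simp
  then show ?thesis using x by simp
qed

text \<open>In general \<open>p \<ominus> (p \<curlywedge> q) = \<zero> \<curlyvee> (p \<ominus>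
  q)\<close>. So an element is a difference of disjoint elements in only one way.\<close>

lemma disjoint_parts:
  assumes "p \<in> carrier A" "q \<in> carrier A" "p \<curlywedge> q = \<zero>"
  shows "p = pp (p \<ominus> q)"
proof -
  have "p = p \<oplus> \<ominus> (p \<curlywedge> q)" using assms by simp
  also have "\<dots> = p \<oplus> ((\<ominus> p) \<curlyvee> (\<ominus> q))" using assms(1,2) by (simp add: meet_def)
  also have "\<dots> = \<zero> \<curlyvee> (p \<ominus> q)" using assms(1,2) by (simp add: add_join r_neg minus_eq)
  finally show ?thesis using assms unfolding pp_def by (simp add: join_comm)
qed

text \<open>Write \<open>\<one> = e - e'\<close> with \<open>e\<close> and \<open>e'\<close> disjoint; then \<open>e = e\<^sup>2 - e e'\<close> is a disjoint
  decomposition of the nonnegative \<open>e\<close>, so \<open>e e' = \<zero>\<close>, and likewise \<open>e' = e e' - e'\<^sup>2\<close>.\<close>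
lemma one_nonneg: "\<zero> \<preceq> \<one>"
proof -
  define e where "e = pp \<one>"
  define e' where "e' = np \<one>"
  have c: "e \<in> carrier A" "e' \<in> carrier A" "\<zero> \<preceq> e" "\<zero> \<preceq> e'" by (auto simp: e_def e'_def)
  have one: "\<one> = e \<ominus> e'" and dis: "e \<curlywedge> e' = \<zero>" using pp_minus_np[of \<one>] pp_meet_np[of \<one>] by (auto simp: e_def e'_def)
  have d1: "(e \<otimes> e) \<curlywedge> (e \<otimes> e') = \<zero>" using pos_mult_meet[of e e e'] c dis by simp
  have d2: "(e' \<otimes> e) \<curlywedge> (e' \<otimes> e') = \<zero>" using pos_mult_meet[of e' e e'] c dis by simp
  have "e \<otimes> (e \<ominus> e') = (e \<otimes> e) \<ominus> (e \<otimes> e')" "e' \<otimes> (e \<ominus> e') = (e' \<otimes> e) \<ominus> (e' \<otimes> e')"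
    using c by algebra+
  then have e1: "e = (e \<otimes> e) \<ominus> (e \<otimes> e')" and e2: "e' = (e' \<otimes> e) \<ominus> (e' \<otimes> e')"
    unfolding one[symmetric] using c by simp_all
  have "e \<otimes> e = e" using disjoint_parts[OF _ _ d1] e1 c pp_eq[of e] by simp
  then have "e \<ominus> (e \<otimes> e') = e" using e1 by simp
  then have "\<ominus> (e \<otimes> e') = \<zero>" using c by (intro add_eq_self[of e]) (auto simp: minus_eq)
  then have "\<ominus> (\<ominus> (e \<otimes> e')) = \<zero>" by simp
  then have ee': "e \<otimes> e' = \<zero>" using c by simp
  have "e' \<otimes> e = e'" using disjoint_parts[OF _ _ d2] e2 c pp_eq[of e'] by simp
  then have "e' = \<zero>" using ee' c m_comm by simp
  then show ?thesis using c one by (simp add: minus_eq)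
qed

lemma nonneg_between_0: "x \<in> carrier A \<Longrightarrow> \<zero> \<preceq> x \<Longrightarrow> x \<preceq> \<zero> \<Longrightarrow> x = \<zero>"
  using le_antisym[of x \<zero>] by simp

text \<open>Multiplying \<open>a \<and> b = \<zero>\<close> by \<open>\<one> \<or> b\<close> gives \<open>ab \<and> b = \<zero>\<close>; multiplying that by \<open>\<one> \<or> a\<close>
  gives \<open>ab \<le> \<zero>\<close>.\<close>
lemma disjoint_mult:
  assumes "a \<in> carrier A" "b \<in> carrier A" "\<zero> \<preceq> a" "\<zero> \<preceq> b" "a \<curlywedge> b = \<zero>"
  shows "a \<otimes> b = \<zero>"
proof -
  have ab: "\<zero> \<preceq> a \<otimes> b" using assms by (simp add: mult_nonneg)
  have up: "\<zero> \<preceq> \<one> \<curlyvee> c" "c \<otimes> x \<preceq> (\<one> \<curlyvee> c) \<otimes> x" "x \<preceq> (\<one> \<curlyvee> c) \<otimes> x" if "c \<in> carrier A" "x \<in> carrier A" "\<zero> \<preceq> x" for c x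
  proof -
    show "\<zero> \<preceq> \<one> \<curlyvee> c" using le_trans[OF _ _ _ one_nonneg join_ub(1)] that by simp
    have "x \<otimes> c \<preceq> x \<otimes> (\<one> \<curlyvee> c)" using that by (intro mult_mono join_ub) auto
    moreover have "x \<otimes> \<one> \<preceq> x \<otimes> (\<one> \<curlyvee> c)" using that by (intro mult_mono join_ub) auto
    ultimately    show "c \<otimes> x \<preceq> (\<one> \<curlyvee> c) \<otimes> x" "x \<preceq> (\<one> \<curlyvee> c) \<otimes> x" using that by (simp_all add: m_comm)
  qed
  have "((\<one> \<curlyvee> b) \<otimes> a) \<curlywedge> ((\<one> \<curlyvee> b) \<otimes> b) = \<zero>"
    using pos_mult_meet[of "\<one> \<curlyvee> b" a b] up(1)[of b b] assms by simp
  moreover have "(a \<otimes> b) \<curlywedge> b \<preceq> ((\<one> \<curlyvee> b) \<otimes> a) \<curlywedge> ((\<one> \<curlyvee> b) \<otimes> b)"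
  proof (rule meet_greatest)
    show "(a \<otimes> b) \<curlywedge> b \<preceq> (\<one> \<curlyvee> b) \<otimes> a"
      using le_trans[OF _ _ _ meet_lb(1)[of "a \<otimes> b" b] up(2)[of b a, unfolded m_comm[OF assms(2,1)]]] assms by simp
    show "(a \<otimes> b) \<curlywedge> b \<preceq> (\<one> \<curlyvee> b) \<otimes> b"
      using le_trans[OF _ _ _ meet_lb(2)[of "a \<otimes> b" b] up(3)[of b b]] assms by simp
  qed (use assms in auto)
  ultimately have "(a \<otimes> b) \<curlywedge> b = \<zero>"
    using assms ab meet_greatest[of "a \<otimes> b" b \<zero>] by (intro nonneg_between_0) auto
  then have "((\<one> \<curlyvee> a) \<otimes> (a \<otimes> b)) \<curlywedge> ((\<one> \<curlyvee> a) \<otimes> b) = \<zero>"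
    using pos_mult_meet[of "\<one> \<curlyvee> a" "a \<otimes> b" b] up(1)[of a a] assms by simp
  moreover have "a \<otimes> b \<preceq> ((\<one> \<curlyvee> a) \<otimes> (a \<otimes> b)) \<curlywedge> ((\<one> \<curlyvee> a) \<otimes> b)"
    using up(3)[of a "a \<otimes> b"] up(2)[of a b] assms ab by (intro meet_greatest) auto
  ultimately show ?thesis using assms ab by (intro nonneg_between_0) auto
qed

lemma pp_mult_np: "x \<in> carrier A \<Longrightarrow> pp x \<otimes> np x = \<zero>"
  by (intro disjoint_mult pp_meet_np) auto

text \<open>The mixed products of \<open>pp x\<close> and \<open>np x\<close> vanish, so the square
  is a sum of two products of nonnegative elements.\<close>

lemma square_nonneg: "x \<in> carrier A \<Longrightarrow> \<zero> \<preceq> x \<otimes> x"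
proof -
  assume x: "x \<in> carrier A"
  have "(pp x \<ominus> np x) \<otimes> (pp x \<ominus> np x) = pp x \<otimes> pp x \<oplus> np x \<otimes> np x \<ominus> (pp x \<otimes> np x \<oplus> pp x \<otimes> np x)"
    using x join_ops_closed(3,4)[OF x] by algebra
  also have "\<dots> = pp x \<otimes> pp x \<oplus> np x \<otimes> np x" using x by (simp add: pp_mult_np minus_eq)
  finally have "x \<otimes> x = pp x \<otimes> pp x \<oplus> np x \<otimes> np x" using pp_minus_np[OF x] by simp
  then show ?thesis using x by (simp add: add_nonneg mult_nonneg)
qed

text \<open>Multiplication by the nonnegative \<open>\<one> \<oplus> \<one>\<close> distributes over
  joins, hence \<open>np y \<oplus> np y = np (y \<oplus> y) = \<zero>\<close>, while
  \<open>np y \<preceq> np y \<oplus> np y\<close>.\<close>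

lemma half_nonneg:
  assumes "y \<in> carrier A" "\<zero> \<preceq> y \<oplus> y"
  shows "\<zero> \<preceq> y"
proof -
  have two: "\<zero> \<preceq> \<one> \<oplus> \<one>" by (intro add_nonneg one_nonneg) auto
  have "(\<one> \<oplus> \<one>) \<otimes> np y = ((\<one> \<oplus> \<one>) \<otimes> (\<ominus> y)) \<curlyvee> ((\<one> \<oplus> \<one>) \<otimes> \<zero>)"
    unfolding np_def using assms two by (intro pos_mult_join_nonneg) auto
  also have "\<dots> = np (y \<oplus> y)" unfolding np_def using assms by (simp add: l_distr minus_add)
  also have "\<dots> = \<zero>" using assms by (simp add: np_eq_0)
  finally have "np y \<oplus> np y = \<zero>" using assms by (simp add: l_distr)
  then have "np y \<preceq> \<zero>" using le_add[of \<zero> "np y" "np y"] assms by simp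
  then have "np y = \<zero>" using assms by (intro nonneg_between_0) auto
  then show ?thesis using assms by (simp add: np_eq_0)
qed

lemma abs_nonneg: "x \<in> carrier A \<Longrightarrow> \<zero> \<preceq> abs_val x"
proof (rule half_nonneg)
  assume x: "x \<in> carrier A"
  have "x \<oplus> \<ominus> x \<preceq> abs_val x \<oplus> abs_val x" unfolding abs_val_def using x by (intro add_mono join_ub) auto
  then show "\<zero> \<preceq> abs_val x \<oplus> abs_val x" using x by (simp add: r_neg)
qed auto

lemma abs_ge: "x \<in> carrier A \<Longrightarrow> x \<preceq> abs_val x" "x \<in> carrier A \<Longrightarrow> \<ominus> x \<preceq> abs_val x"
  unfolding abs_val_def by (auto intro: join_ub)

lemma abs_eq: "x \<in> carrier A \<Longrightarrow> \<zero> \<preceq> x \<Longrightarrow> abs_val x = x"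
proof -
  assume x: "x \<in> carrier A" "\<zero> \<preceq> x"
  have "\<ominus> x \<preceq> \<zero>" using x le_neg[of \<zero> x] by simp
  then have "\<ominus> x \<preceq> x" using x le_trans[of "\<ominus> x" \<zero> x] by simp
  then show ?thesis unfolding abs_val_def le_def .
qed

text \<open>Translating one of the joins shows that \<open>pp x \<oplus> np x\<close> equals
  \<open>pp x \<curlyvee> np x\<close>, and this join is the absolute value.\<close>

lemma abs_pp_np: "x \<in> carrier A \<Longrightarrow> abs_val x = pp x \<oplus> np x"
proof -
  assume x: "x \<in> carrier A"
  have "pp x \<oplus> np x = np x \<oplus> (x \<curlyvee> \<zero>)" using x unfolding pp_def by (simp add: a_comm np_def)
  also have "\<dots> = (np x \<oplus> x) \<curlyvee> np x" using x by (simp add: add_join)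
  also have "np x \<oplus> x = pp x" unfolding np_def pp_def using x by (simp add: a_comm[of _ x] add_join r_neg join_comm)
  finally have eq: "pp x \<oplus> np x = pp x \<curlyvee> np x" .
  have "pp x \<curlyvee> np x \<preceq> abs_val x" unfolding pp_def np_def using x
    by (intro join_least abs_ge abs_nonneg) auto
  moreover have "abs_val x \<preceq> pp x \<curlyvee> np x"
  proof -
    have "x \<preceq> pp x" "\<ominus> x \<preceq> np x" unfolding pp_def np_def using x by (auto intro: join_ub)
    then have "x \<preceq> pp x \<curlyvee> np x" "\<ominus> x \<preceq> pp x \<curlyvee> np x"
      using x le_trans[OF _ _ _ _ join_ub(1)[of "pp x" "np x"], of x] le_trans[OF _ _ _ _ join_ub(2)[of "pp x" "np x"], of "\<ominus> x"] by auto
    then show ?thesis unfolding abs_val_def using x by (intro join_least) auto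
  qed
  ultimately show ?thesis using eq x by (intro le_antisym) auto
qed

lemma abs_square: "x \<in> carrier A \<Longrightarrow> abs_val x \<otimes> abs_val x = x \<otimes> x"
proof -
  assume x: "x \<in> carrier A"
  note c = join_ops_closed(3,4)[OF x]
  have "(pp x \<oplus> np x) \<otimes> (pp x \<oplus> np x) = pp x \<otimes> pp x \<oplus> np x \<otimes> np x \<oplus> (pp x \<otimes> np x \<oplus> pp x \<otimes> np x)"
    "(pp x \<ominus> np x) \<otimes> (pp x \<ominus> np x) = pp x \<otimes> pp x \<oplus> np x \<otimes> np x \<ominus> (pp x \<otimes> np x \<oplus> pp x \<otimes> np x)"
    using c by algebra+
  then show ?thesis using abs_pp_np[OF x] pp_minus_np[OF x] pp_mult_np[OF x] c by (simp add: minus_eq)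
qed

lemma of_nat_in_nonneg: "\<zero> \<preceq> of_nat_in A k"
  unfolding of_nat_in_def by (induction k) (auto simp: le_refl intro: add_nonneg one_nonneg)

lemma one_le_of_nat_in: "k > 0 \<Longrightarrow> \<one> \<preceq> of_nat_in A k"
proof (induction k)
  case (Suc k)
  have "\<zero> \<oplus> \<one> \<preceq> of_nat_in A k \<oplus> \<one>" using of_nat_in_nonneg[of k]
    by (intro add_mono le_refl) (auto simp: of_nat_in_def)
  then show ?case unfolding of_nat_in_def by simp
qed simp

end

section \<open>Prime ideals\<close>

lemma (in cring) in_ideal_sum:
  assumes "ideal I R" "a \<in> carrier R"
  shows "x \<in> I <+>\<^bsub>R\<^esub> (PIdl a) \<longleftrightarrow> (\<exists>m\<in>I. \<exists>r\<in>carrier R. x = m \<oplus> r \<otimes> a)"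
  unfolding set_add_def' cgenideal_def by blast

text \<open>An ideal maximal among those that contain \<open>I\<close> and miss \<open>S\<close> is
  prime: if it contains neither \<open>a\<close> nor \<open>b\<close>, both enlarged ideals meet
  \<open>S\<close>, and the product of the two elements found would lie in the ideal once
  \<open>a \<otimes> b\<close> does.\<close>

lemma (in cring) exists_prime_avoiding:
  assumes I: "ideal I R" and S: "\<one> \<in> S" "\<And>x y. x \<in> S \<Longrightarrow> y \<in> S \<Longrightarrow> x \<otimes> y \<in> S" "S \<subseteq> carrier R"
    and disj: "I \<inter> S = {}"
  shows "\<exists>P. primeideal P R \<and> I \<subseteq> P \<and> P \<inter> S = {}"
proof -
  define F where "F = {J. ideal J R \<and> I \<subseteq> J \<and> J \<inter> S = {}}"
  have "\<exists>M\<in>F. \<forall>J\<in>F. M \<subseteq> J \<longrightarrow> J = M"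
  proof (rule subset_Zorn_nonempty)
    show "F \<noteq> {}" using I disj unfolding F_def by blast
    fix C assume C: "C \<noteq> {}" "subset.chain F C"
    then have "subset.chain {J. ideal J R} C" unfolding F_def pred_on.chain_def by auto
    then have "ideal (\<Union>C) R" using chain_Union_is_ideal[of C] C by simp
    then show "\<Union>C \<in> F" using C unfolding F_def pred_on.chain_def by blast
  qed
  then obtain M where M: "M \<in> F" "\<And>J. J \<in> F \<Longrightarrow> M \<subseteq> J \<Longrightarrow> J = M" by blast
  have idM: "ideal M R" "I \<subseteq> M" "M \<inter> S = {}" using M(1) unfolding F_def by auto
  interpret M: ideal M R by (rule idM)
  have meets: "\<exists>m\<in>M. \<exists>r\<in>carrier R. m \<oplus> r \<otimes> a \<in> S" if a: "a \<in> carrier R" "a \<notin> M" for a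
  proof (rule ccontr)
    assume *: "\<not> ?thesis"
    let ?J = "M <+>\<^bsub>R\<^esub> (PIdl a)"
    have J: "ideal ?J R" by (intro add_ideals idM cgenideal_ideal a)
    have sub: "M \<subseteq> ?J"
    proof
      fix m assume m: "m \<in> M"
      then have "m = m \<oplus> \<zero> \<otimes> a" using a by simp
      then show "m \<in> ?J" unfolding in_ideal_sum[OF idM(1) a(1)] using m by blast
    qed
    have "a = \<zero> \<oplus> \<one> \<otimes> a" using a by simp
    then have "a \<in> ?J" unfolding in_ideal_sum[OF idM(1) a(1)] using M.zero_closed by blast
    moreover have "?J \<inter> S = {}"
    proof -
      have False if "x \<in> ?J" "x \<in> S" for x
        using that * unfolding in_ideal_sum[OF idM(1) a(1)] by blast
      then show ?thesis by blast
    qed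
    ultimately have "?J \<in> F" using J sub idM(2) unfolding F_def by blast
    then show False using M(2)[OF _ sub] \<open>a \<in> ?J\<close> a by blast
  qed
  have "primeideal M R"
  proof (rule primeidealI[OF idM(1) is_cring])
    show "carrier R \<noteq> M" using S idM by blast
    fix a b assume ab: "a \<in> carrier R" "b \<in> carrier R" "a \<otimes> b \<in> M"
    show "a \<in> M \<or> b \<in> M"
    proof (rule ccontr)
      assume "\<not> ?thesis"
      then obtain m r n s where *: "m \<in> M" "r \<in> carrier R" "m \<oplus> r \<otimes> a \<in> S" "n \<in> M" "s \<in> carrier R" "n \<oplus> s \<otimes> b \<in> S"
        using meets ab by meson
      have c: "m \<in> carrier R" "n \<in> carrier R" using * M.Icarr by auto
      have "(m \<oplus> r \<otimes> a) \<otimes> (n \<oplus> s \<otimes> b) = m \<otimes> (n \<oplus> s \<otimes> b) \<oplus> ((r \<otimes> a) \<otimes> n \<oplus> (r \<otimes> s) \<otimes> (a \<otimes> b))"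
        using c ab * by algebra
      also have "\<dots> \<in> M" using c ab *
        by (intro M.a_closed M.I_r_closed[OF *(1)] M.I_l_closed[OF *(4)] M.I_l_closed[OF ab(3)]) auto
      finally show False using S(2)[OF *(3,6)] idM by blast
    qed
  qed
  then show ?thesis using idM by blast
qed

section \<open>Reduced f-rings whose positive elements are squares\<close>

text \<open>Kept apart from \<open>square_f_ring\<close> because an equational real closed ring must
  be known to be a Q-algebra before the virtual roots of \<open>X^2 - a\<close>, which refer to
  \<open>f'/2\<close>, can provide square roots.\<close>

locale dividing_f_ring = f_ring +
  assumes divides_square: "a \<in> carrier A \<Longrightarrow> b \<in> carrier A \<Longrightarrow> \<zero> \<preceq> a \<Longrightarrow> a \<preceq> b \<Longrightarrow> \<exists>z\<in>carrier A. z \<otimes> b = a \<otimes> a"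
begin

text \<open>Condition (2) for \<open>\<one> \<preceq> k\<close> shows that \<open>k\<close> divides
  \<open>\<one>\<close>.\<close>

lemma rational_A: "rational_ring A"
  unfolding rational_ring_def
proof (intro allI impI)
  fix k :: nat assume "0 < k"
  then obtain z where z: "z \<in> carrier A" "z \<otimes> of_nat_in A k = \<one> \<otimes> \<one>"
    using divides_square[of \<one> "of_nat_in A k"] one_nonneg one_le_of_nat_in by (auto simp: of_nat_in_def)
  then show "of_nat_in A k \<in> Units A" unfolding Units_def using m_comm[of z "of_nat_in A k"] by (auto simp: of_nat_in_def)
qed

end

locale square_f_ring = dividing_f_ring +
  assumes reduced: "x \<in> carrier A \<Longrightarrow> x \<otimes> x = \<zero> \<Longrightarrow> x = \<zero>"
    and ex_sqrt: "x \<in> carrier A \<Longrightarrow> \<zero> \<preceq> x \<Longrightarrow> \<exists>s\<in>carrier A. s \<otimes> s = x"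
begin

text \<open>With \<open>m\<close> half of \<open>n\<close> rounded up, \<open>x^n = 0\<close> gives
  \<open>(x^m)^2 = 0\<close>; so absence of nonzero elements with square zero is enough.\<close>

lemma power_0: "x \<in> carrier A \<Longrightarrow> x [^] (n::nat) = \<zero> \<Longrightarrow> x = \<zero>"
proof (induction n rule: less_induct)
  case (less n)
  consider "n = 0" | "n = 1" | "n \<ge> 2" by linarith
  then show ?case
  proof cases
    case 1
    then have "\<one> = \<zero>" using less.prems by simp
    then show ?thesis using less.prems by (metis r_null r_one)
  next
    case 3
    define m where "m = (n + 1) div 2"
    have "m < n" "m + m \<ge> n" using 3 by (auto simp: m_def)
    have "x [^] m \<otimes> x [^] m = x [^] n \<otimes> x [^] (m + m - n)"
      using less.prems(1) \<open>m + m \<ge> n\<close> by (simp add: nat_pow_mult)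
    then have "x [^] m \<otimes> x [^] m = \<zero>" using less.prems by simp
    then have "x [^] m = \<zero>" using less.prems by (auto intro: reduced[of "x [^] m"])
    then show ?thesis using less.IH[OF \<open>m < n\<close>] less.prems by blast
  qed (use less.prems in auto)
qed

lemma radical_mem:
  assumes "ideal I A" "x \<in> carrier A" "\<And>P. primeideal P A \<Longrightarrow> I \<subseteq> P \<Longrightarrow> x \<in> P"
  shows "\<exists>n::nat. x [^] n \<in> I"
proof (rule ccontr)
  assume *: "\<not> ?thesis"
  define S where "S = {x [^] n | n::nat. True}"
  have "\<one> = x [^] (0::nat)" by simp
  then have "\<one> \<in> S" unfolding S_def by blast
  moreover have "a \<otimes> b \<in> S" if "a \<in> S" "b \<in> S" for a b
    using that assms(2) unfolding S_def by (auto simp: nat_pow_mult)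
  moreover have "S \<subseteq> carrier A" "I \<inter> S = {}" using assms(2) * unfolding S_def by auto
  ultimately obtain P where P: "primeideal P A" "I \<subseteq> P" "P \<inter> S = {}"
    using exists_prime_avoiding[OF assms(1), of S] by blast
  have "x [^] (1::nat) \<in> S" unfolding S_def by blast
  then have "x \<in> S" using assms(2) by simp
  then show False using P assms(3) by blast
qed

lemma in_all_primes: "x \<in> carrier A \<Longrightarrow> (\<And>P. primeideal P A \<Longrightarrow> x \<in> P) \<Longrightarrow> x = \<zero>"
proof -
  assume x: "x \<in> carrier A" "\<And>P. primeideal P A \<Longrightarrow> x \<in> P"
  have "\<exists>n::nat. x [^] n \<in> {\<zero>}" by (rule radical_mem[OF zeroideal x(1)]) (rule x(2))
  then show "x = \<zero>" using power_0[OF x(1)] by blast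
qed

lemma prime_square: "primeideal P A \<Longrightarrow> x \<in> carrier A \<Longrightarrow> x \<otimes> x \<in> P \<Longrightarrow> x \<in> P"
  using primeideal.I_prime[of P A x x] by blast

text \<open>From \<open>z b = a^2\<close> the square of \<open>a\<close> lies in \<open>P\<close>.
  This underlies the order on the residue fields and the splitting over closed sets.\<close>

lemma prime_convex:
  assumes "primeideal P A" "a \<in> carrier A" "b \<in> P" "\<zero> \<preceq> a" "a \<preceq> b"
  shows "a \<in> P"
proof -
  interpret P: primeideal P A by (rule assms(1))
  have b: "b \<in> carrier A" using assms(3) by (rule P.Icarr)
  obtain z where "z \<in> carrier A" "z \<otimes> b = a \<otimes> a" using divides_square[OF assms(2) b assms(4,5)] by blast
  then have "a \<otimes> a \<in> P" using P.I_l_closed[OF assms(3)] by metis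
  then show ?thesis using prime_square assms by blast
qed

lemma prime_add_nonneg:
  assumes "primeideal P A" "a \<in> carrier A" "b \<in> carrier A" "\<zero> \<preceq> a" "\<zero> \<preceq> b" "a \<oplus> b \<in> P"
  shows "a \<in> P"
proof -
  have "a \<oplus> \<zero> \<preceq> a \<oplus> b" by (rule le_add[OF zero_closed assms(3,2,5)])
  then have "a \<preceq> a \<oplus> b" using assms(2) by simp
  then show ?thesis by (rule prime_convex[OF assms(1,2,6,4)])
qed

section \<open>Residue fields at prime ideals and their order\<close>

definition residue_field :: "'a set \<Rightarrow> ('a set \<times> 'a set) set ring" where
  "residue_field P = fraction_field (A Quot P)"

definition res :: "'a set \<Rightarrow> 'a \<Rightarrow> ('a set \<times> 'a set) set" where
  "res P a = frac_embed (A Quot P) (P +> a)"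

lemma domain_quot: "primeideal P A \<Longrightarrow> domain (A Quot P)"
  by (rule primeideal.quotient_is_domain)

lemma quot_hom: "primeideal P A \<Longrightarrow> (+>) P \<in> ring_hom A (A Quot P)"
  by (rule ideal.rcos_ring_hom) (rule primeideal.axioms(1))

lemma carrier_quot: "carrier (A Quot P) = (\<lambda>a. P +> a) ` carrier A"
  unfolding FactRing_def A_RCOSETS_def' by auto

lemma res_hom: "primeideal P A \<Longrightarrow> ring_hom_cring A (residue_field P) (res P)"
proof (intro ring_hom_cring.intro ring_hom_cring_axioms.intro is_cring)
  assume P: "primeideal P A"
  have "field (residue_field P)" unfolding residue_field_def by (rule domain.field_fraction_field[OF domain_quot[OF P]])
  then show "cring (residue_field P)" by (simp add: field_def domain_def)
  have "frac_embed (A Quot P) \<circ> (+>) P \<in> ring_hom A (residue_field P)" unfolding residue_field_def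
    by (rule ring_hom_trans[OF quot_hom[OF P] domain.frac_embed_hom[OF domain_quot[OF P]]])
  then show "res P \<in> ring_hom A (residue_field P)" by (simp add: res_def[abs_def] o_def)
qed

lemma res_eq_0:
  assumes P: "primeideal P A" and a: "a \<in> carrier A"
  shows "res P a = \<zero>\<^bsub>residue_field P\<^esub> \<longleftrightarrow> a \<in> P"
proof -
  interpret P: primeideal P A by (rule P)
  interpret Q: domain "A Quot P" by (rule domain_quot[OF P])
  interpret E: ring_hom_cring "A Quot P" "residue_field P" "frac_embed (A Quot P)"
    using Q.frac_embed_hom Q.field_fraction_field unfolding residue_field_def
    by (intro ring_hom_cring.intro ring_hom_cring_axioms.intro Q.is_cring) (auto simp: field_def domain_def)
  have z: "\<zero>\<^bsub>A Quot P\<^esub> = P" by (simp add: FactRing_def)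
  have c: "P +> a \<in> carrier (A Quot P)" using a unfolding carrier_quot by blast
  have "res P a = \<zero>\<^bsub>residue_field P\<^esub> \<longleftrightarrow> P +> a = \<zero>\<^bsub>A Quot P\<^esub>"
    unfolding res_def using Q.frac_embed_inj[OF c Q.zero_closed] E.hom_zero by metis
  also have "\<dots> \<longleftrightarrow> a \<in> P" unfolding z using a P.rcos_const_imp_mem P.a_rcos_const by blast
  finally show ?thesis .
qed

lemma res_quotient:
  assumes P: "primeideal P A" and y: "y \<in> carrier (residue_field P)"
  shows "\<exists>a\<in>carrier A. \<exists>b\<in>carrier A. b \<notin> P \<and> res P b \<otimes>\<^bsub>residue_field P\<^esub> y = res P a"
proof -
  interpret P: primeideal P A by (rule P)
  interpret Q: domain "A Quot P" by (rule domain_quot[OF P])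
  obtain u v where uv: "u \<in> carrier (A Quot P)" "v \<in> carrier (A Quot P)" "v \<noteq> \<zero>\<^bsub>A Quot P\<^esub>"
    "frac_embed (A Quot P) v \<otimes>\<^bsub>residue_field P\<^esub> y = frac_embed (A Quot P) u"
    using Q.frac_embed_quotient[of y] y unfolding residue_field_def by blast
  then obtain a b where ab: "a \<in> carrier A" "b \<in> carrier A" "u = P +> a" "v = P +> b" unfolding carrier_quot by blast
  have "b \<notin> P" using uv(3) ab(4) P.a_rcos_const by (auto simp: FactRing_def)
  then show ?thesis using uv ab unfolding res_def by blast
qed

lemma field_residue_field: "primeideal P A \<Longrightarrow> field (residue_field P)"
  unfolding residue_field_def by (rule domain.field_fraction_field[OF domain_quot])

text \<open>\<open>pp a \<otimes> np a = \<zero>\<close> lies in \<open>P\<close>, so one of the two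
  parts does.\<close>

lemma res_total:
  assumes P: "primeideal P A" and a: "a \<in> carrier A"
  shows "res P a = res P (pp a) \<or> res P a = \<ominus>\<^bsub>residue_field P\<^esub> res P (np a)"
proof -
  interpret P: primeideal P A by (rule P)
  interpret H: ring_hom_cring A "residue_field P" "res P" by (rule res_hom[OF P])
  have eq: "res P a = res P (pp a) \<ominus>\<^bsub>residue_field P\<^esub> res P (np a)"
    using arg_cong[OF pp_minus_np[OF a], of "res P"] a by (simp add: minus_eq H.S.minus_eq)
  have "pp a \<otimes> np a \<in> P" using pp_mult_np[OF a] P.zero_closed by simp
  then have "pp a \<in> P \<or> np a \<in> P" using P.I_prime a by simp
  then have "res P (pp a) = \<zero>\<^bsub>residue_field P\<^esub> \<or> res P (np a) = \<zero>\<^bsub>residue_field P\<^esub>" using res_eq_0[OF P] a by simp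
  then show ?thesis using eq a by (auto simp: H.S.minus_eq)
qed

lemma quotient_square:
  assumes P: "primeideal P A" and y: "y \<in> carrier (residue_field P)"
    and b: "b \<in> carrier A" "b \<notin> P" and s: "s \<in> carrier A"
    and eq: "res P (b \<otimes> b) \<otimes>\<^bsub>residue_field P\<^esub> y = res P (s \<otimes> s)"
  shows "\<exists>z\<in>carrier (residue_field P). y = z \<otimes>\<^bsub>residue_field P\<^esub> z"
proof -
  interpret K: field "residue_field P" by (rule field_residue_field[OF P])
  interpret H: ring_hom_cring A "residue_field P" "res P" by (rule res_hom[OF P])
  define c where "c = inv\<^bsub>residue_field P\<^esub> (res P b)"
  have nb: "res P b \<noteq> \<zero>\<^bsub>residue_field P\<^esub>" using res_eq_0[OF P] b by simp
  then have u: "res P b \<in> Units (residue_field P)" using b K.field_Units by simp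
  then have c: "c \<in> carrier (residue_field P)" "res P b \<otimes>\<^bsub>residue_field P\<^esub> c = \<one>\<^bsub>residue_field P\<^esub>" unfolding c_def by auto
  define z where "z = c \<otimes>\<^bsub>residue_field P\<^esub> res P s"
  have z: "z \<in> carrier (residue_field P)" unfolding z_def using c s by simp
  have "z \<otimes>\<^bsub>residue_field P\<^esub> z = (c \<otimes>\<^bsub>residue_field P\<^esub> c) \<otimes>\<^bsub>residue_field P\<^esub> (res P b \<otimes>\<^bsub>residue_field P\<^esub> res P b \<otimes>\<^bsub>residue_field P\<^esub> y)"
    using eq c s b unfolding z_def by (simp add: K.m_ac)
  also have "\<dots> = (res P b \<otimes>\<^bsub>residue_field P\<^esub> c) \<otimes>\<^bsub>residue_field P\<^esub> ((res P b \<otimes>\<^bsub>residue_field P\<^esub> c) \<otimes>\<^bsub>residue_field P\<^esub> y)"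
    using c(1) b y by (simp add: K.m_ac)
  also have "\<dots> = y" using c y by simp
  finally show ?thesis using z by metis
qed

text \<open>A fraction \<open>a / b\<close> equals \<open>ab / b^2\<close>, so up to a square it is
  an element of \<open>A\<close>, whose positive and negative parts have square roots. Two fractions
  are put over a common denominator; a sum of squares then vanishes only trivially because
  \<open>P\<close> is convex.\<close>

lemma euclidean_residue_field:
  assumes P: "primeideal P A"
  shows "euclidean_field (residue_field P)"
proof (rule euclidean_fieldI[OF field_residue_field[OF P]])
  interpret P: primeideal P A by (rule P)
  interpret K: field "residue_field P" by (rule field_residue_field[OF P])
  interpret H: ring_hom_cring A "residue_field P" "res P" by (rule res_hom[OF P])
  fix y assume y: "y \<in> carrier (residue_field P)"
  obtain a b where ab: "a \<in> carrier A" "b \<in> carrier A" "b \<notin> P" "res P b \<otimes>\<^bsub>residue_field P\<^esub> y = res P a"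
    using res_quotient[OF P y] by blast
  define c where "c = a \<otimes> b"
  have c: "c \<in> carrier A" unfolding c_def using ab by simp
  have eq: "res P (b \<otimes> b) \<otimes>\<^bsub>residue_field P\<^esub> y = res P c" unfolding c_def
    using ab(1,2) y by (simp add: K.m_assoc ab(4)) (simp add: K.m_comm)
  obtain s t where st: "s \<in> carrier A" "s \<otimes> s = pp c" "t \<in> carrier A" "t \<otimes> t = np c"
    using ex_sqrt[of "pp c"] ex_sqrt[of "np c"] c by auto
  show "\<exists>z\<in>carrier (residue_field P). y = z \<otimes>\<^bsub>residue_field P\<^esub> z \<or> \<ominus>\<^bsub>residue_field P\<^esub> y = z \<otimes>\<^bsub>residue_field P\<^esub> z"
    using res_total[OF P c]
  proof
    assume "res P c = res P (pp c)"
    then show ?thesis using quotient_square[OF P y ab(2,3) st(1)] eq st by metis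
  next
    assume *: "res P c = \<ominus>\<^bsub>residue_field P\<^esub> res P (np c)"
    have "res P (b \<otimes> b) \<otimes>\<^bsub>residue_field P\<^esub> (\<ominus>\<^bsub>residue_field P\<^esub> y) = \<ominus>\<^bsub>residue_field P\<^esub> res P c"
      unfolding eq[symmetric] using y ab(2) by (simp add: K.r_minus)
    also have "\<dots> = res P (t \<otimes> t)" unfolding * st(4) using c by simp
    finally show ?thesis using quotient_square[OF P K.a_inv_closed[OF y] ab(2,3) st(3)] by blast
  qed
next
  interpret P: primeideal P A by (rule P)
  interpret K: field "residue_field P" by (rule field_residue_field[OF P])
  interpret H: ring_hom_cring A "residue_field P" "res P" by (rule res_hom[OF P])
  fix x y assume x: "x \<in> carrier (residue_field P)" and y: "y \<in> carrier (residue_field P)"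
  obtain a b where ab: "a \<in> carrier A" "b \<in> carrier A" "b \<notin> P" "res P b \<otimes>\<^bsub>residue_field P\<^esub> x = res P a"
    using res_quotient[OF P x] by blast
  obtain c d where cd: "c \<in> carrier A" "d \<in> carrier A" "d \<notin> P" "res P d \<otimes>\<^bsub>residue_field P\<^esub> y = res P c"
    using res_quotient[OF P y] by blast
  define p q e where "p = a \<otimes> d" and "q = c \<otimes> b" and "e = b \<otimes> d"
  have cl: "p \<in> carrier A" "q \<in> carrier A" "e \<in> carrier A" using ab cd by (auto simp: p_def q_def e_def)
  have e: "e \<notin> P" using P.I_prime ab cd unfolding e_def by blast
  have ex: "res P e \<otimes>\<^bsub>residue_field P\<^esub> x = res P p" and ey: "res P e \<otimes>\<^bsub>residue_field P\<^esub> y = res P q"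
    using ab(1,2) cd(1,2) x y unfolding p_def q_def e_def
    by (simp_all add: ab(4)[symmetric] cd(4)[symmetric] K.m_ac)
  have "res P (e \<otimes> e) \<otimes>\<^bsub>residue_field P\<^esub> (x \<otimes>\<^bsub>residue_field P\<^esub> x \<oplus>\<^bsub>residue_field P\<^esub> y \<otimes>\<^bsub>residue_field P\<^esub> y) =
    (res P e \<otimes>\<^bsub>residue_field P\<^esub> x) \<otimes>\<^bsub>residue_field P\<^esub> (res P e \<otimes>\<^bsub>residue_field P\<^esub> x) \<oplus>\<^bsub>residue_field P\<^esub>
    (res P e \<otimes>\<^bsub>residue_field P\<^esub> y) \<otimes>\<^bsub>residue_field P\<^esub> (res P e \<otimes>\<^bsub>residue_field P\<^esub> y)"
    using cl x y by (simp add: K.m_ac K.r_distr)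
  also have "\<dots> = res P (p \<otimes> p \<oplus> q \<otimes> q)" unfolding ex ey using cl by simp
  finally have sum: "res P (e \<otimes> e) \<otimes>\<^bsub>residue_field P\<^esub> (x \<otimes>\<^bsub>residue_field P\<^esub> x \<oplus>\<^bsub>residue_field P\<^esub> y \<otimes>\<^bsub>residue_field P\<^esub> y) =
    res P (p \<otimes> p \<oplus> q \<otimes> q)" .
  obtain s where s: "s \<in> carrier A" "s \<otimes> s = p \<otimes> p \<oplus> q \<otimes> q"
    using ex_sqrt[of "p \<otimes> p \<oplus> q \<otimes> q"] cl by (auto intro: add_nonneg square_nonneg)
  show "\<exists>z\<in>carrier (residue_field P). x \<otimes>\<^bsub>residue_field P\<^esub> x \<oplus>\<^bsub>residue_field P\<^esub> y \<otimes>\<^bsub>residue_field P\<^esub> y = z \<otimes>\<^bsub>residue_field P\<^esub> z"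
    using quotient_square[OF P _ cl(3) e s(1)] sum s(2) x y by simp
  assume "x \<otimes>\<^bsub>residue_field P\<^esub> x \<oplus>\<^bsub>residue_field P\<^esub> y \<otimes>\<^bsub>residue_field P\<^esub> y = \<zero>\<^bsub>residue_field P\<^esub>"
  then have "res P (p \<otimes> p \<oplus> q \<otimes> q) = \<zero>\<^bsub>residue_field P\<^esub>" using sum cl by simp
  then have "p \<otimes> p \<oplus> q \<otimes> q \<in> P" by (rule iffD1[OF res_eq_0[OF P], rotated]) (use cl in simp)
  then have "p \<otimes> p \<in> P"
    by (rule prime_add_nonneg[OF P _ _ square_nonneg square_nonneg, rotated -1]) (use cl in auto)
  then have "res P p = \<zero>\<^bsub>residue_field P\<^esub>" using prime_square[OF P cl(1)] res_eq_0[OF P cl(1)] by blast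
  then have "res P e = \<zero>\<^bsub>residue_field P\<^esub> \<or> x = \<zero>\<^bsub>residue_field P\<^esub>" using ex K.integral x cl by simp
  then show "x = \<zero>\<^bsub>residue_field P\<^esub>" using res_eq_0[OF P cl(3)] e by simp
qed

lemma res_le:
  assumes P: "primeideal P A" and "x \<in> carrier A" "y \<in> carrier A" "x \<preceq> y"
  shows "sq_le (residue_field P) (res P x) (res P y)"
proof -
  interpret H: ring_hom_cring A "residue_field P" "res P" by (rule res_hom[OF P])
  obtain s where s: "s \<in> carrier A" "s \<otimes> s = y \<ominus> x" using ex_sqrt[of "y \<ominus> x"] le_iff_diff assms by auto
  have "res P y \<ominus>\<^bsub>residue_field P\<^esub> res P x = res P (y \<ominus> x)" using assms by (simp add: minus_eq H.S.minus_eq)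
  also have "\<dots> = res P s \<otimes>\<^bsub>residue_field P\<^esub> res P s" unfolding s(2)[symmetric] using s(1) by simp
  finally have "res P y \<ominus>\<^bsub>residue_field P\<^esub> res P x = res P s \<otimes>\<^bsub>residue_field P\<^esub> res P s" .
  then show ?thesis unfolding sq_le_def using s by blast
qed

text \<open>One of \<open>pp x\<close> and \<open>np x\<close> is in \<open>P\<close>. If it is
  \<open>pp x\<close>, then modulo \<open>P\<close> the element \<open>x\<close> is
  \<open>- np x\<close>, and for \<open>x\<close> to be nonnegative \<open>np x\<close> must vanish
  too. Thus a sign condition modulo \<open>P\<close> becomes membership of one element of
  \<open>A\<close> in \<open>P\<close>.\<close>

lemma np_in_prime_iff:
  assumes P: "primeideal P A" and x: "x \<in> carrier A"
  shows "np x \<in> P \<longleftrightarrow> sq_le (residue_field P) \<zero>\<^bsub>residue_field P\<^esub> (res P x)"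
proof -
  interpret H: ring_hom_cring A "residue_field P" "res P" by (rule res_hom[OF P])
  interpret E: euclidean "residue_field P" by standard (rule euclidean_residue_field[OF P])
  have eq: "res P x = res P (pp x) \<ominus>\<^bsub>residue_field P\<^esub> res P (np x)"
    using arg_cong[OF pp_minus_np[OF x], of "res P"] x by (simp add: minus_eq H.S.minus_eq)
  have ppn: "sq_le (residue_field P) \<zero>\<^bsub>residue_field P\<^esub> (res P (pp x))" "sq_le (residue_field P) \<zero>\<^bsub>residue_field P\<^esub> (res P (np x))"
    using res_le[OF P, of \<zero>] x by auto
  show ?thesis
  proof
    assume "np x \<in> P"
    then have "res P (np x) = \<zero>\<^bsub>residue_field P\<^esub>" using res_eq_0[OF P] x by simp
    then show "sq_le (residue_field P) \<zero>\<^bsub>residue_field P\<^esub> (res P x)" using eq ppn x by (simp add: H.S.minus_eq)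
  next
    assume s: "sq_le (residue_field P) \<zero>\<^bsub>residue_field P\<^esub> (res P x)"
    have "pp x \<otimes> np x \<in> P" using pp_mult_np[OF x] additive_subgroup.zero_closed[OF ideal.axioms(1)[OF primeideal.axioms(1)[OF P]]] by simp
    then have "pp x \<in> P \<or> np x \<in> P" using primeideal.I_prime[OF P] x by simp
    moreover have "np x \<in> P" if "pp x \<in> P"
    proof -
      have "res P (pp x) = \<zero>\<^bsub>residue_field P\<^esub>" using that res_eq_0[OF P] x by simp
      then have "res P x = \<ominus>\<^bsub>residue_field P\<^esub> res P (np x)" using eq x by (simp add: H.S.minus_eq)
      then have "sq_le (residue_field P) (res P (np x) \<oplus>\<^bsub>residue_field P\<^esub> \<zero>\<^bsub>residue_field P\<^esub>) (res P (np x) \<oplus>\<^bsub>residue_field P\<^esub> \<ominus>\<^bsub>residue_field P\<^esub> res P (np x))"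
        using s x by (intro E.sq_le_add) auto
      then have "sq_le (residue_field P) (res P (np x)) \<zero>\<^bsub>residue_field P\<^esub>" using x by (simp add: H.S.r_neg)
      then have "res P (np x) = \<zero>\<^bsub>residue_field P\<^esub>" using ppn(2) x by (intro E.sq_le_antisym) auto
      then show ?thesis using res_eq_0[OF P] x by simp
    qed
    ultimately show "np x \<in> P" by blast
  qed
qed

end

section \<open>Equational real closed rings are real closed in the sense of Schwartz\<close>

lemma (in ring) pow_2: "x \<in> carrier R \<Longrightarrow> x [^] (2::nat) = x \<otimes> x"
  by (simp add: numeral_2_eq_2)

lemma real_closed_field_if_euclidean:
  assumes "euclidean_field K" "odd_polys_have_roots K"
  shows "real_closed_field K"
proof -
  interpret euclidean K by standard (rule assms(1))
  define r where "r = {(x, y). x \<in> carrier K \<and> y \<in> carrier K \<and> sq_le K x y}"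
  have "linear_order_on (carrier K) r"
    unfolding linear_order_on_def partial_order_on_def preorder_on_def
  proof (intro conjI)
    show "r \<subseteq> carrier K \<times> carrier K" unfolding r_def by auto
    show "refl_on (carrier K) r" unfolding refl_on_def r_def by (auto intro: sq_le_refl)
    show "trans r" unfolding trans_def r_def using sq_le_trans by blast
    show "antisym r" unfolding antisym_def r_def using sq_le_antisym by blast
    show "total_on (carrier K) r" unfolding total_on_def r_def using sq_le_linear by blast
  qed
  moreover have "(x \<oplus>\<^bsub>K\<^esub> z, y \<oplus>\<^bsub>K\<^esub> z) \<in> r" if "x \<in> carrier K" "y \<in> carrier K" "z \<in> carrier K" "(x, y) \<in> r" for x y z
    using that sq_le_add[of x y z] unfolding r_def by (simp add: a_comm)
  moreover have "(\<zero>\<^bsub>K\<^esub>, x \<otimes>\<^bsub>K\<^esub> y) \<in> r" if "x \<in> carrier K" "y \<in> carrier K" "(\<zero>\<^bsub>K\<^esub>, x) \<in> r" "(\<zero>\<^bsub>K\<^esub>, y) \<in> r" for x y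
    using that sq_le_mult[of "\<zero>\<^bsub>K\<^esub>" y x] unfolding r_def by simp
  ultimately have ord: "ordered_field_by K r" unfolding ordered_field_by_def using field_K by blast
  have sq: "\<exists>y\<in>carrier K. y [^]\<^bsub>K\<^esub> (2::nat) = x" if "x \<in> carrier K" "(\<zero>\<^bsub>K\<^esub>, x) \<in> r" for x
  proof -
    have "sq_le K \<zero>\<^bsub>K\<^esub> x" using that by (simp add: r_def)
    then obtain z where "z \<in> carrier K" "x \<ominus>\<^bsub>K\<^esub> \<zero>\<^bsub>K\<^esub> = z \<otimes>\<^bsub>K\<^esub> z" unfolding sq_le_def by blast
    then show ?thesis using that(1) by (intro bexI[of _ z]) (auto simp: pow_2 minus_eq)
  qed
  show ?thesis
    unfolding real_closed_field_def using ord sq assms(2) unfolding odd_polys_have_roots_def by blast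
qed

context f_ring
begin

definition order_rel :: "('a \<times> 'a) set" where
  "order_rel = {(x, y). x \<in> carrier A \<and> y \<in> carrier A \<and> x \<preceq> y}"

lemma f_ring_order_rel: "f_ring_order A order_rel"
  unfolding f_ring_order_def
proof (intro conjI exI[of _ "(\<curlyvee>)"])
  show "partial_order_on (carrier A) order_rel"
    unfolding partial_order_on_def preorder_on_def
  proof (intro conjI)
    show "order_rel \<subseteq> carrier A \<times> carrier A" unfolding order_rel_def by auto
    show "refl_on (carrier A) order_rel" unfolding refl_on_def order_rel_def by (auto intro: le_refl)
    show "trans order_rel" unfolding trans_def order_rel_def using le_trans by blast
    show "antisym order_rel" unfolding antisym_def order_rel_def using le_antisym by blast
  qed
  show "f_ring A (\<curlyvee>)" by (rule f_ring_axioms)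
qed (auto simp: order_rel_def)

end

lemma (in square_f_ring) schwartz_real_closed_if_residues:
  assumes "\<And>P. primeideal P A \<Longrightarrow> integrally_closed (A Quot P) \<and> real_closed_field (residue_field P)"
  shows "schwartz_real_closed A"
  unfolding schwartz_real_closed_def
proof (intro conjI allI impI)
  show "reduced_ring A" unfolding reduced_ring_def using is_cring power_0 by blast
  show "\<exists>r. f_ring_order A r \<and>
       {x [^] (2::nat) | x. x \<in> carrier A} = {x \<in> carrier A. (\<zero>, x) \<in> r} \<and>
       (\<forall>a \<in> carrier A. \<forall>b \<in> carrier A. (\<zero>, a) \<in> r \<longrightarrow> (a, b) \<in> r \<longrightarrow>
          (\<exists>z \<in> carrier A. z \<otimes> b = a [^] (2::nat)))"
  proof (intro exI[of _ order_rel] conjI ballI impI)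
    show "{x [^] (2::nat) | x. x \<in> carrier A} = {x \<in> carrier A. (\<zero>, x) \<in> order_rel}"
    proof (intro equalityI subsetI)
      fix y assume "y \<in> {x [^] (2::nat) | x. x \<in> carrier A}"
      then obtain x where "x \<in> carrier A" "y = x \<otimes> x" by (auto simp: pow_2)
      then show "y \<in> {x \<in> carrier A. (\<zero>, x) \<in> order_rel}" using square_nonneg by (auto simp: order_rel_def)
    next
      fix y assume y: "y \<in> {x \<in> carrier A. (\<zero>, x) \<in> order_rel}"
      then obtain s where "s \<in> carrier A" "s \<otimes> s = y" using ex_sqrt[of y] by (auto simp: order_rel_def)
      then have "y = s [^] (2::nat)" "s \<in> carrier A" by (auto simp: pow_2)
      then show "y \<in> {x [^] (2::nat) | x. x \<in> carrier A}" by blast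
    qed
    show "f_ring_order A order_rel" by (rule f_ring_order_rel)
    fix a b assume "a \<in> carrier A" "b \<in> carrier A" "(\<zero>, a) \<in> order_rel" "(a, b) \<in> order_rel"
    then show "\<exists>z\<in>carrier A. z \<otimes> b = a [^] (2::nat)" using divides_square by (auto simp: order_rel_def pow_2)
  qed
  fix P assume "primeideal P A"
  then show "integrally_closed (A Quot P)" "real_closed_field (fraction_field (A Quot P))"
    using assms unfolding residue_field_def by auto
qed

section \<open>Equational real closed rings satisfy the conditions of Schwartz\<close>

context real_closed_ring
begin

lemma abs_meet_eq:
  assumes "a \<in> carrier A" "b \<in> carrier A" "\<zero> \<preceq> a" "a \<preceq> b"
  shows "Fr a b \<otimes> b = a \<otimes> a"
proof -
  have "\<zero> \<preceq> b" using assms le_trans[of \<zero> a b] by simp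
  then show ?thesis using Fr_mult[OF assms(1,2)] assms by (simp add: abs_eq meet_eq pow_2)
qed

sublocale dividing_f_ring A "(\<curlyvee>)"
  by unfold_locales (use abs_meet_eq Fr_closed in blast)

text \<open>If \<open>x\<^sup>2 = \<zero>\<close>, then \<open>x, -x\<close> have the same sum and product as \<open>\<zero>, \<zero>\<close>.\<close>
lemma square_zero:
  assumes x: "x \<in> carrier A" "x \<otimes> x = \<zero>"
  shows "x = \<zero>"
proof -
  have "abs_val x = rho 2 2 [x \<oplus> \<ominus> x, \<ominus> (x \<otimes> \<ominus> x)]"
    unfolding abs_val_def using rho_quadratic[of x "\<ominus> x"] x by simp
  also have "\<dots> = rho 2 2 [\<zero> \<oplus> \<zero>, \<ominus> (\<zero> \<otimes> \<zero>)]" using x by (simp add: r_neg r_minus)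
  also have "\<dots> = \<zero>" using rho_quadratic[of \<zero> \<zero>] join_idem[of \<zero>] by simp
  finally have "x \<preceq> \<zero>" "\<ominus> x \<preceq> \<ominus> \<zero>" using abs_ge[OF x(1)] by simp_all
  then show ?thesis using x le_neg[of \<zero> x] by (intro le_antisym) auto
qed

definition vroot :: "nat \<Rightarrow> 'a list \<Rightarrow> nat \<Rightarrow> 'a" where
  "vroot n f j = virtual_root A rho n j f"

lemma vroot_closed: "monic_poly A n f \<Longrightarrow> j \<in> {1..n} \<Longrightarrow> vroot n f j \<in> carrier A"
  unfolding vroot_def virtual_root_def monic_poly_def by (force intro!: rho_closed a_inv_closed)

text \<open>(V2) covers \<open>d \<ge> 2\<close>; for \<open>d = 1\<close> the conditions hold
  because (V1) makes the virtual root a root.\<close>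

lemma vr_conds_vroot:
  assumes f: "monic_poly A (Suc n) f" and j: "j \<in> {1..Suc n}"
  shows "vr_conds A le (Suc n) f (vroot n (monic_deriv A f)) j (vroot (Suc n) f j)"
proof (cases n)
  case 0
  obtain c where c: "f = [\<one>, c]" "c \<in> carrier A"
    using f unfolding 0 monic_poly_def by (auto simp: length_Suc_conv)
  have "vroot 1 f 1 = \<ominus> c" using rho_linear[of "\<ominus> c"] c by (simp add: vroot_def)
  moreover have "eval f (\<ominus> c) = \<zero>" using c by (simp add: l_neg)
  ultimately show ?thesis using j unfolding 0 vr_conds_def by (auto simp: le_refl)
next
  case (Suc m)
  have j': "2 \<le> Suc n" "1 \<le> j" "j \<le> Suc n" using j Suc by auto
  show ?thesis using rho_bounds[unfolded virtual_root_bounds_def, rule_format, OF j' f]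
    unfolding vr_conds_def vroot_def Let_def by simp
qed

lemma vroots_vroot: "monic_poly A n f \<Longrightarrow> vroots A le n f (vroot n f)"
proof (induction n arbitrary: f)
  case (Suc n)
  have g: "monic_poly A n (monic_deriv A f)" by (rule monic_poly_deriv[OF rational_A Suc.prems])
  show ?case unfolding vroots.simps
    using Suc.IH[OF g] vroot_closed[OF g] vr_conds_vroot[OF Suc.prems] by blast
qed simp

text \<open>Let \<open>y\<close> be the upper virtual root of \<open>f = X^2 - a\<close> and
  \<open>w = y^2 - a\<close>. The virtual root of \<open>f'/2\<close> is \<open>\<zero>\<close>, so
  (V2) gives \<open>y \<ge> 0\<close>, \<open>w \<ge> 0\<close> and \<open>y w \<le> 0\<close>,
  whence \<open>y w = 0\<close>. Then \<open>w^2 = y (y w) - a w = - a w \<le> 0\<close>, so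
  \<open>w^2 = 0\<close> and \<open>w = 0\<close>.\<close>

lemma nonneg_square:
  assumes a: "a \<in> carrier A" "\<zero> \<preceq> a"
  shows "\<exists>s\<in>carrier A. s \<otimes> s = a"
proof -
  define f where "f = [\<one>, \<zero>, \<ominus> a]"
  have mf: "monic_poly A (Suc 1) f" unfolding f_def monic_poly_def using a by auto
  define y where "y = vroot 2 f 2"
  have y: "y \<in> carrier A" using vroot_closed[OF mf, of 2] by (simp add: y_def numeral_2_eq_2)
  define u where "u = vroot 1 (monic_deriv A f) 1"
  have "of_nat_in A 2 \<in> Units A" using rational_A unfolding rational_ring_def by auto
  then have n2: "inv (of_nat_in A 2) \<in> carrier A" "inv (of_nat_in A 2) \<otimes> of_nat_in A 2 = \<one>" by auto
  have "poly_deriv A f = [of_nat_in A (Suc (Suc 0)), [Suc 0] \<cdot> \<zero>]" unfolding f_def of_nat_in_def by simp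
  then have "poly_deriv A f = [of_nat_in A 2, \<zero>]" by (simp add: numeral_2_eq_2)
  then have "monic_deriv A f = map (\<lambda>c. inv (of_nat_in A 2) \<otimes> c) [of_nat_in A 2, \<zero>]"
    unfolding monic_deriv_def of_nat_in_def by (simp add: f_def numeral_2_eq_2)
  also have "\<dots> = [\<one>, \<ominus> \<zero>]" using n2 by simp
  finally have "monic_deriv A f = [\<one>, \<ominus> \<zero>]" .
  then have u: "u = \<zero>" using rho_linear[of \<zero>] by (simp add: u_def vroot_def)
  have ev: "eval f x = x \<otimes> x \<ominus> a" if "x \<in> carrier A" for x
    unfolding f_def using that a by (simp add: numeral_2_eq_2 minus_eq)
  have V: "vr_conds A le 2 f (vroot 1 (monic_deriv A f)) 2 y"
    using vr_conds_vroot[OF mf, of 2] by (simp add: y_def numeral_2_eq_2)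
  then have c: "u \<preceq> y" "y \<otimes> eval f y \<preceq> \<zero>" "\<zero> \<preceq> eval f y"
    unfolding vr_conds_def Let_def using u y ev[OF y] a by (auto simp: u_def minus_eq)
  define w where "w = eval f y"
  have w: "w \<in> carrier A" "w = y \<otimes> y \<ominus> a" using ev[OF y] y a by (auto simp: w_def)
  have "\<zero> \<preceq> y \<otimes> w" using c u y w(1) by (intro mult_nonneg) (auto simp: w_def)
  then have yw: "y \<otimes> w = \<zero>" using c y w(1) by (intro nonneg_between_0) (auto simp: w_def)
  have "w \<otimes> w = y \<otimes> (y \<otimes> w) \<ominus> a \<otimes> w" using w y a(1) by algebra
  then have "w \<otimes> w = \<ominus> (a \<otimes> w)" using yw y w(1) a(1) by (simp add: minus_eq)
  moreover have "\<ominus> (a \<otimes> w) \<preceq> \<zero>"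
    using le_neg[of \<zero> "a \<otimes> w"] mult_nonneg[of a w] a w(1) c by (simp add: w_def)
  ultimately have "w \<otimes> w = \<zero>" using w(1) a(1) square_nonneg[OF w(1)] by (intro nonneg_between_0) auto
  then have "w = \<zero>" using square_zero w(1) by blast
  then have "y \<otimes> y = a" using w(2) y a by (metis m_closed r_right_minus_eq)
  then show ?thesis using y by blast
qed

sublocale square_f_ring A "(\<curlyvee>)"
  by unfold_locales (use square_zero nonneg_square in blast)+

text \<open>The coefficients are lifted to \<open>A\<close>, where virtual roots are given;
  \<open>res P\<close> preserves the order, so the images are virtual roots in the residue
  field.\<close>

lemma virtual_root_subring_residue:
  assumes P: "primeideal P A"
  shows "virtual_root_subring (residue_field P) (res P ` carrier A)"
  unfolding virtual_root_subring_def
proof (intro conjI ballI allI impI)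
  interpret H: ring_hom_cring A "residue_field P" "res P" by (rule res_hom[OF P])
  show "res P ` carrier A \<subseteq> carrier (residue_field P)" by auto
  show "\<one>\<^bsub>residue_field P\<^esub> \<in> res P ` carrier A" using H.hom_one by (metis imageI one_closed)
  {
    fix a b assume "a \<in> res P ` carrier A" "b \<in> res P ` carrier A"
    then obtain x y where xy: "x \<in> carrier A" "y \<in> carrier A" "a = res P x" "b = res P y" by blast
    then have "a \<oplus>\<^bsub>residue_field P\<^esub> b = res P (x \<oplus> y)" "a \<otimes>\<^bsub>residue_field P\<^esub> b = res P (x \<otimes> y)"
      "\<ominus>\<^bsub>residue_field P\<^esub> a = res P (\<ominus> x)" by auto
    then show "a \<oplus>\<^bsub>residue_field P\<^esub> b \<in> res P ` carrier A" "a \<otimes>\<^bsub>residue_field P\<^esub> b \<in> res P ` carrier A"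
      "\<ominus>\<^bsub>residue_field P\<^esub> a \<in> res P ` carrier A" using xy by blast+
  }
  show "\<exists>s\<in>res P ` carrier A. s \<noteq> \<zero>\<^bsub>residue_field P\<^esub> \<and> s \<otimes>\<^bsub>residue_field P\<^esub> x \<in> res P ` carrier A"
    if "x \<in> carrier (residue_field P)" for x
    using res_quotient[OF P that] res_eq_0[OF P] by (metis imageI)
  fix n f assume f: "monic_poly (residue_field P) n f" and sub: "set f \<subseteq> res P ` carrier A"
  obtain cs where cs: "f = \<one>\<^bsub>residue_field P\<^esub> # cs" "length cs = n" using f unfolding monic_poly_def by blast
  have "\<forall>c\<in>set cs. \<exists>x. x \<in> carrier A \<and> res P x = c" using sub cs(1) by force
  then obtain g where g: "\<And>c. c \<in> set cs \<Longrightarrow> g c \<in> carrier A \<and> res P (g c) = c" by metis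
  define F where "F = \<one> # map g cs"
  have F: "monic_poly A n F" unfolding F_def monic_poly_def using g cs(2) by auto
  have "map (res P) (map g cs) = cs" using g by (induction cs) auto
  then have mF: "map (res P) F = f" unfolding F_def cs(1) by simp
  have "vroots (residue_field P) (sq_le (residue_field P)) n (map (res P) F) (res P \<circ> vroot n F)"
    using vroots_vroot[OF F] vroot_closed[OF F] F
    by (intro H.vroots_map[where Le = le] res_le[OF P] rational_A) (auto simp: monic_poly_def)
  then show "\<exists>W. (\<forall>j\<in>{1..n}. W j \<in> res P ` carrier A) \<and> vroots (residue_field P) (sq_le (residue_field P)) n f W"
    unfolding mF using vroot_closed[OF F] by (intro exI[of _ "res P \<circ> vroot n F"]) auto
qed

theorem schwartz: "schwartz_real_closed A"
proof (rule schwartz_real_closed_if_residues)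
  fix P assume P: "primeideal P A"
  interpret Q: domain "A Quot P" by (rule domain_quot[OF P])
  note E = euclidean_residue_field[OF P]
  note D = virtual_roots_of_euclidean_field(1)[OF E, unfolded virtual_roots_detect_roots_def, rule_format,
    OF virtual_root_subring_residue[OF P]]
  have "real_closed_field (residue_field P)"
    using real_closed_field_if_euclidean[OF E] D by blast
  moreover have "integrally_closed (A Quot P)"
    unfolding integrally_closed_def
  proof (intro conjI ballI allI impI)
    show "domain (A Quot P)" by (rule domain_quot[OF P])
    have img: "frac_embed (A Quot P) ` carrier (A Quot P) = res P ` carrier A"
      unfolding carrier_quot res_def by auto
    have sub: "res P ` carrier A \<subseteq> carrier (residue_field P)"
      by (rule conjunct1[OF virtual_root_subring_residue[OF P, unfolded virtual_root_subring_def]])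
    fix x cs
    assume x: "x \<in> carrier (fraction_field (A Quot P))" and cs: "set cs \<subseteq> carrier (A Quot P)"
      and ev: "ring.eval (fraction_field (A Quot P)) (map (frac_embed (A Quot P)) (\<one>\<^bsub>A Quot P\<^esub> # cs)) x = \<zero>\<^bsub>fraction_field (A Quot P)\<^esub>"
    define f where "f = map (frac_embed (A Quot P)) (\<one>\<^bsub>A Quot P\<^esub> # cs)"
    have one: "frac_embed (A Quot P) \<one>\<^bsub>A Quot P\<^esub> = \<one>\<^bsub>residue_field P\<^esub>"
      unfolding residue_field_def using ring_hom_one[OF Q.frac_embed_hom] .
    have sf: "set f \<subseteq> res P ` carrier A" unfolding f_def img[symmetric] using cs by auto
    have "set f \<subseteq> carrier (residue_field P)" using sf sub by (rule subset_trans)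
    then have "monic_poly (residue_field P) (length cs) f"
      unfolding monic_poly_def by (intro exI[of _ "map (frac_embed (A Quot P)) cs"]) (auto simp: f_def one)
    then show "x \<in> frac_embed (A Quot P) ` carrier (A Quot P)"
      unfolding img using D x ev sf unfolding residue_field_def f_def by blast
  qed
  ultimately show "integrally_closed (A Quot P) \<and> real_closed_field (residue_field P)" by blast
qed

end

section \<open>Gluing along closed subsets of the prime spectrum\<close>

context square_f_ring
begin

text \<open>Let \<open>p\<close> be the positive part of \<open>w - t\<close>. Then
  \<open>p (w^2 - t^2) = p^2 (w + t)\<close> is both nonpositive and nonnegative, hence zero, and
  \<open>p \<le> w + t\<close> gives \<open>p^3 = 0\<close>.\<close>

lemma square_le_imp_le:
  assumes "w \<in> carrier A" "t \<in> carrier A" "\<zero> \<preceq> w" "\<zero> \<preceq> t" "w \<otimes> w \<preceq> t \<otimes> t"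
  shows "w \<preceq> t"
proof -
  define d where "d = w \<ominus> t"
  define p where "p = pp d"
  define q where "q = np d"
  have d: "d \<in> carrier A" using assms by (simp add: d_def)
  have p: "p \<in> carrier A" "\<zero> \<preceq> p" and q: "q \<in> carrier A" using d by (auto simp: p_def q_def)
  have dpq: "d = p \<ominus> q" and pq: "p \<otimes> q = \<zero>" using pp_minus_np[OF d] pp_mult_np[OF d] by (auto simp: p_def q_def)
  have wt: "\<zero> \<preceq> w \<oplus> t" using assms by (intro add_nonneg) auto
  have wd: "w = d \<oplus> t" using assms unfolding d_def by algebra
  have "p \<otimes> (w \<otimes> w \<ominus> t \<otimes> t) = (p \<otimes> d) \<otimes> (w \<oplus> t)" unfolding d_def using assms p(1) by algebra
  also have "p \<otimes> d = p \<otimes> p" unfolding dpq using p(1) q pq by (simp add: minus_eq r_distr r_minus)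
  finally have e: "p \<otimes> (w \<otimes> w \<ominus> t \<otimes> t) = (p \<otimes> p) \<otimes> (w \<oplus> t)" .
  have "w \<otimes> w \<ominus> t \<otimes> t \<preceq> \<zero>"
    using assms le_iff_diff[of "w \<otimes> w \<ominus> t \<otimes> t" \<zero>] le_iff_diff[of "w \<otimes> w" "t \<otimes> t"]
    by (simp add: minus_eq minus_add a_comm)
  then have "p \<otimes> (w \<otimes> w \<ominus> t \<otimes> t) \<preceq> p \<otimes> \<zero>" using assms p by (intro mult_mono) auto
  then have "(p \<otimes> p) \<otimes> (w \<oplus> t) \<preceq> \<zero>" using e p by simp
  moreover have pp2: "\<zero> \<preceq> p \<otimes> p" using p by (simp add: mult_nonneg)
  ultimately have z: "(p \<otimes> p) \<otimes> (w \<oplus> t) = \<zero>" using p assms wt by (intro nonneg_between_0 mult_nonneg) auto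
  have "d \<preceq> w \<oplus> t"
  proof -
    have "\<zero> \<preceq> t \<oplus> t" using assms by (intro add_nonneg) auto
    moreover have "(w \<oplus> t) \<ominus> d = t \<oplus> t" unfolding d_def using assms by algebra
    ultimately show ?thesis using le_iff_diff[OF d, of "w \<oplus> t"] assms by simp
  qed
  then have "p \<preceq> w \<oplus> t" unfolding p_def pp_def using d assms wt by (intro join_least) auto
  then have "(p \<otimes> p) \<otimes> p \<preceq> (p \<otimes> p) \<otimes> (w \<oplus> t)" using p assms pp2 by (intro mult_mono) auto
  then have "(p \<otimes> p) \<otimes> p = \<zero>" using z p pp2 by (intro nonneg_between_0 mult_nonneg) auto
  then have "p [^] (3::nat) = \<zero>" using p by (simp add: numeral_3_eq_3)
  then have "p = \<zero>" using power_0 p by blast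
  then have "np (\<ominus> d) = \<zero>" using np_minus[OF d] by (simp add: p_def)
  then have "\<zero> \<preceq> \<ominus> d" using np_eq_0[of "\<ominus> d"] d by simp
  moreover have "\<ominus> d = t \<ominus> w" unfolding d_def using assms by algebra
  ultimately show ?thesis using le_iff_diff[of w t] assms by simp
qed

lemma nonneg_sqrt:
  assumes "x \<in> carrier A" "\<zero> \<preceq> x"
  shows "\<exists>s\<in>carrier A. \<zero> \<preceq> s \<and> s \<otimes> s = x"
proof -
  obtain s where "s \<in> carrier A" "s \<otimes> s = x" using ex_sqrt assms by blast
  then show ?thesis using abs_square[of s] abs_nonneg[of s] by (intro bexI[of _ "abs_val s"]) auto
qed

lemma pow_nonneg: "w \<in> carrier A \<Longrightarrow> \<zero> \<preceq> w \<Longrightarrow> \<zero> \<preceq> w [^] (n::nat)"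
proof (induction n)
  case (Suc n)
  then show ?case using mult_nonneg[of "w [^] n" w] by simp
qed (simp add: one_nonneg)

text \<open>From \<open>z^2 \<le> u + v\<close> follows \<open>z \<le> sqrt u + sqrt v\<close>;
  repeating this strips the exponent \<open>2^k\<close>, and a square root lies in every prime ideal
  that contains its square.\<close>

lemma root_split:
  assumes "w \<in> carrier A" "\<zero> \<preceq> w" "u \<in> carrier A" "\<zero> \<preceq> u" "v \<in> carrier A" "\<zero> \<preceq> v"
    and "w [^] ((2::nat) ^ k) \<preceq> u \<oplus> v"
  shows "\<exists>u'\<in>carrier A. \<exists>v'\<in>carrier A. \<zero> \<preceq> u' \<and> \<zero> \<preceq> v' \<and> w \<preceq> u' \<oplus> v' \<and>
    (\<forall>P. primeideal P A \<longrightarrow> (u \<in> P \<longrightarrow> u' \<in> P) \<and> (v \<in> P \<longrightarrow> v' \<in> P))"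
  using assms(3-)
proof (induction k arbitrary: u v)
  case 0
  then show ?case using assms(1,2) by (intro bexI[of _ u] bexI[of _ v]) auto
next
  case (Suc k)
  define z where "z = w [^] ((2::nat) ^ k)"
  have z: "z \<in> carrier A" "\<zero> \<preceq> z" using assms(1,2) by (auto simp: z_def pow_nonneg)
  have "w [^] ((2::nat) ^ Suc k) = z \<otimes> z" unfolding z_def using assms(1) by (simp add: nat_pow_mult mult_2)
  then have zz: "z \<otimes> z \<preceq> u \<oplus> v" using Suc.prems by simp
  obtain s t where s: "s \<in> carrier A" "\<zero> \<preceq> s" "s \<otimes> s = u" and t: "t \<in> carrier A" "\<zero> \<preceq> t" "t \<otimes> t = v"
    using nonneg_sqrt Suc.prems by metis
  have "(s \<oplus> t) \<otimes> (s \<oplus> t) \<ominus> (u \<oplus> v) = s \<otimes> t \<oplus> s \<otimes> t" unfolding s(3)[symmetric] t(3)[symmetric]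
    using s(1) t(1) by algebra
  moreover have "\<zero> \<preceq> s \<otimes> t \<oplus> s \<otimes> t" using s t by (intro add_nonneg mult_nonneg) auto
  ultimately have "u \<oplus> v \<preceq> (s \<oplus> t) \<otimes> (s \<oplus> t)"
    using le_iff_diff[of "u \<oplus> v" "(s \<oplus> t) \<otimes> (s \<oplus> t)"] s t Suc.prems by simp
  then have "z \<otimes> z \<preceq> (s \<oplus> t) \<otimes> (s \<oplus> t)"
    using le_trans[OF _ _ _ zz, of "(s \<oplus> t) \<otimes> (s \<oplus> t)"] z s t Suc.prems by simp
  then have "z \<preceq> s \<oplus> t"
    by (rule square_le_imp_le[OF z(1) a_closed[OF s(1) t(1)] z(2) add_nonneg[OF s(1) t(1) s(2) t(2)]])
  then obtain u' v' where "u' \<in> carrier A" "v' \<in> carrier A" "\<zero> \<preceq> u'" "\<zero> \<preceq> v'" "w \<preceq> u' \<oplus> v'"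
    "\<forall>P. primeideal P A \<longrightarrow> (s \<in> P \<longrightarrow> u' \<in> P) \<and> (t \<in> P \<longrightarrow> v' \<in> P)"
    using Suc.IH[OF s(1,2) t(1,2)] unfolding z_def by blast
  moreover have "s \<in> P" if "primeideal P A" "u \<in> P" for P using prime_square[OF that(1) s(1)] s(3) that(2) by simp
  moreover have "t \<in> P" if "primeideal P A" "v \<in> P" for P using prime_square[OF that(1) t(1)] t(3) that(2) by simp
  ultimately show ?case by blast
qed

text \<open>The Riesz decomposition with \<open>p = g \<curlywedge> u\<close>: the rest is the
  positive part of \<open>g \<ominus> u\<close>, hence below \<open>v\<close>.\<close>

lemma riesz_split:
  assumes "g \<in> carrier A" "\<zero> \<preceq> g" "u \<in> carrier A" "\<zero> \<preceq> u" "v \<in> carrier A" "\<zero> \<preceq> v" "g \<preceq> u \<oplus> v"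
  shows "\<exists>p\<in>carrier A. \<exists>q\<in>carrier A. g = p \<oplus> q \<and> \<zero> \<preceq> p \<and> p \<preceq> u \<and> \<zero> \<preceq> q \<and> q \<preceq> v"
proof -
  define p where "p = g \<curlywedge> u"
  define q where "q = g \<ominus> p"
  have c: "p \<in> carrier A" "q \<in> carrier A" using assms by (auto simp: p_def q_def)
  have p: "\<zero> \<preceq> p" "p \<preceq> u" "p \<preceq> g" unfolding p_def using assms by (auto intro: meet_greatest meet_lb)
  have "q = g \<oplus> ((\<ominus> g) \<curlyvee> (\<ominus> u))" using assms by (simp add: q_def p_def meet_def minus_eq)
  also have "\<dots> = \<zero> \<curlyvee> (g \<ominus> u)" using assms by (simp add: add_join r_neg minus_eq)
  finally have q: "q = \<zero> \<curlyvee> (g \<ominus> u)" .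
  have "(u \<oplus> v) \<ominus> g = v \<ominus> (g \<ominus> u)" using assms by algebra
  then have "g \<ominus> u \<preceq> v" using le_iff_diff[of "g \<ominus> u" v] le_iff_diff[of g "u \<oplus> v"] assms by simp
  then have "q \<preceq> v" unfolding q using assms by (intro join_least) auto
  moreover have "\<zero> \<preceq> q" unfolding q using assms by (intro join_ub) auto
  moreover have "g = p \<oplus> q" unfolding q_def using assms c by algebra
  ultimately show ?thesis using c p by blast
qed

lemma abs_in_prime: "primeideal P A \<Longrightarrow> x \<in> P \<Longrightarrow> abs_val x \<in> P"
proof -
  assume P: "primeideal P A" "x \<in> P"
  interpret P: primeideal P A by (rule P(1))
  have x: "x \<in> carrier A" using P by (simp add: P.Icarr)
  have "abs_val x \<otimes> abs_val x \<in> P" unfolding abs_square[OF x] using P.I_l_closed[OF P(2) x] .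
  then show ?thesis by (rule prime_square[OF P(1) join_ops_closed(5)[OF x]])
qed

text \<open>An element vanishing on \<open>V(a) \<inter> V(b)\<close> is a sum of two elements vanishing on \<open>V(a)\<close> and
  on \<open>V(b)\<close>.\<close>
lemma split_over_closed_sets:
  assumes a: "a \<in> carrier A" and b: "b \<in> carrier A" and h: "h \<in> carrier A"
    and van: "\<And>P. primeideal P A \<Longrightarrow> a \<in> P \<Longrightarrow> b \<in> P \<Longrightarrow> h \<in> P"
  shows "\<exists>p\<in>carrier A. \<exists>q\<in>carrier A. h = p \<oplus> q \<and>
    (\<forall>P. primeideal P A \<longrightarrow> (a \<in> P \<longrightarrow> p \<in> P) \<and> (b \<in> P \<longrightarrow> q \<in> P))"
proof -
  have I: "ideal ((PIdl a) <+>\<^bsub>A\<^esub> (PIdl b)) A" by (intro add_ideals cgenideal_ideal a b)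
  have memI: "x \<in> (PIdl a) <+>\<^bsub>A\<^esub> (PIdl b) \<longleftrightarrow> (\<exists>\<alpha>\<in>carrier A. \<exists>\<beta>\<in>carrier A. x = \<alpha> \<otimes> a \<oplus> \<beta> \<otimes> b)" for x
    unfolding in_ideal_sum[OF cgenideal_ideal[OF a] b] by (auto simp: cgenideal_def)
  have "h \<in> P" if P: "primeideal P A" "(PIdl a) <+>\<^bsub>A\<^esub> (PIdl b) \<subseteq> P" for P
  proof -
    have "a = \<one> \<otimes> a \<oplus> \<zero> \<otimes> b" "b = \<zero> \<otimes> a \<oplus> \<one> \<otimes> b" using a b by simp_all
    then have "a \<in> (PIdl a) <+>\<^bsub>A\<^esub> (PIdl b)" "b \<in> (PIdl a) <+>\<^bsub>A\<^esub> (PIdl b)" unfolding memI by blast+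
    then show ?thesis using van[OF P(1)] P(2) by blast
  qed
  then obtain n :: nat where "h [^] n \<in> (PIdl a) <+>\<^bsub>A\<^esub> (PIdl b)" using radical_mem[OF I h] by blast
  \<comment> \<open>The exponent must be a power of two because \<open>root_split\<close> takes
    square roots, and even so that \<open>h\<close> can be replaced by
    \<open>abs_val h\<close>.\<close>
  then have "h [^] ((2::nat) ^ Suc n) \<in> (PIdl a) <+>\<^bsub>A\<^esub> (PIdl b)"
  proof -
    have "n \<le> 2 ^ Suc n" by (metis Suc_leD le_refl less_exp less_imp_le_nat order_trans power_increasing_iff one_less_numeral_iff semiring_norm(76))
    then have "h [^] ((2::nat) ^ Suc n) = h [^] (2 ^ Suc n - n) \<otimes> h [^] n" using h by (simp add: nat_pow_mult)
    moreover assume "h [^] n \<in> (PIdl a) <+>\<^bsub>A\<^esub> (PIdl b)"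
    ultimately show ?thesis using ideal.I_l_closed[OF I] h by simp
  qed
  then obtain \<alpha> \<beta> where ab: "\<alpha> \<in> carrier A" "\<beta> \<in> carrier A" "h [^] ((2::nat) ^ Suc n) = \<alpha> \<otimes> a \<oplus> \<beta> \<otimes> b"
    unfolding memI by blast
  define u v w where "u = abs_val (\<alpha> \<otimes> a)" and "v = abs_val (\<beta> \<otimes> b)" and "w = abs_val h"
  have c: "u \<in> carrier A" "\<zero> \<preceq> u" "v \<in> carrier A" "\<zero> \<preceq> v" "w \<in> carrier A" "\<zero> \<preceq> w"
    using ab a b h by (auto simp: u_def v_def w_def abs_nonneg)
  have "w [^] ((2::nat) ^ Suc n) = (w \<otimes> w) [^] ((2::nat) ^ n)"
    using c by (simp add: nat_pow_distrib nat_pow_mult mult_2)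
  also have "\<dots> = (h \<otimes> h) [^] ((2::nat) ^ n)" unfolding w_def abs_square[OF h] ..
  also have "\<dots> = \<alpha> \<otimes> a \<oplus> \<beta> \<otimes> b" unfolding ab(3)[symmetric]
    using h by (simp add: nat_pow_distrib nat_pow_mult mult_2)
  finally have "w [^] ((2::nat) ^ Suc n) = \<alpha> \<otimes> a \<oplus> \<beta> \<otimes> b" .
  moreover have "\<alpha> \<otimes> a \<oplus> \<beta> \<otimes> b \<preceq> u \<oplus> v" unfolding u_def v_def using ab a b by (intro add_mono abs_ge) auto
  ultimately have "w [^] ((2::nat) ^ Suc n) \<preceq> u \<oplus> v" by simp
  from root_split[OF c(5,6,1-4) this]
  obtain u' v' where uv: "u' \<in> carrier A" "v' \<in> carrier A" "\<zero> \<preceq> u'" "\<zero> \<preceq> v'" "w \<preceq> u' \<oplus> v'"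
    and uv6: "\<forall>P. primeideal P A \<longrightarrow> (u \<in> P \<longrightarrow> u' \<in> P) \<and> (v \<in> P \<longrightarrow> v' \<in> P)"
    by blast
  have au: "u' \<in> P" if "primeideal P A" "a \<in> P" for P
  proof -
    have "u \<in> P" unfolding u_def
      by (rule abs_in_prime[OF that(1) ideal.I_l_closed[OF primeideal.axioms(1)[OF that(1)] that(2) ab(1)]])
    then show ?thesis using uv6 that(1) by blast
  qed
  have bv: "v' \<in> P" if "primeideal P A" "b \<in> P" for P
  proof -
    have "v \<in> P" unfolding v_def
      by (rule abs_in_prime[OF that(1) ideal.I_l_closed[OF primeideal.axioms(1)[OF that(1)] that(2) ab(2)]])
    then show ?thesis using uv6 that(1) by blast
  qed
  \<comment> \<open>Both parts of \<open>h\<close> lie below \<open>abs_val h\<close>; they are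
    split separately, and the differences of the pieces give \<open>p\<close> and
    \<open>q\<close>.\<close>
  have wpp: "w = pp h \<oplus> np h" unfolding w_def by (rule abs_pp_np[OF h])
  have "pp h \<preceq> w" "np h \<preceq> w" unfolding wpp
    using le_add[of \<zero> "np h" "pp h"] le_add[of \<zero> "pp h" "np h"] h by (simp_all add: a_comm)
  then have le: "pp h \<preceq> u' \<oplus> v'" "np h \<preceq> u' \<oplus> v'" using le_trans[OF _ _ _ _ uv(5)] h c uv by auto
  obtain p1 q1 where 1: "p1 \<in> carrier A" "q1 \<in> carrier A" "pp h = p1 \<oplus> q1" "\<zero> \<preceq> p1" "p1 \<preceq> u'" "\<zero> \<preceq> q1" "q1 \<preceq> v'"
    using riesz_split[OF _ _ uv(1,3,2,4) le(1)] h by auto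
  obtain p2 q2 where 2: "p2 \<in> carrier A" "q2 \<in> carrier A" "np h = p2 \<oplus> q2" "\<zero> \<preceq> p2" "p2 \<preceq> u'" "\<zero> \<preceq> q2" "q2 \<preceq> v'"
    using riesz_split[OF _ _ uv(1,3,2,4) le(2)] h by auto
  have diff: "x \<ominus> y \<in> P" if "primeideal P A" "x \<in> P" "y \<in> P" for x y P
  proof -
    interpret P: primeideal P A by (rule that(1))
    show ?thesis using that by (simp add: minus_eq P.a_closed P.a_inv_closed)
  qed
  have "h = (p1 \<ominus> p2) \<oplus> (q1 \<ominus> q2)"
  proof -
    have "h = (p1 \<oplus> q1) \<ominus> (p2 \<oplus> q2)" using pp_minus_np[OF h] 1 2 by simp
    also have "\<dots> = (p1 \<ominus> p2) \<oplus> (q1 \<ominus> q2)" using 1(1,2) 2(1,2) by algebra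
    finally show ?thesis .
  qed
  moreover have "p1 \<ominus> p2 \<in> P" if "primeideal P A" "a \<in> P" for P

    by (rule diff[OF that(1) prime_convex[OF that(1) 1(1) au[OF that] 1(4,5)] prime_convex[OF that(1) 2(1) au[OF that] 2(4,5)]])
  moreover have "q1 \<ominus> q2 \<in> P" if "primeideal P A" "b \<in> P" for P

    by (rule diff[OF that(1) prime_convex[OF that(1) 1(2) bv[OF that] 1(6,7)] prime_convex[OF that(1) 2(2) bv[OF that] 2(6,7)]])
  ultimately show ?thesis using 1(1,2) 2(1,2) by (intro bexI[of _ "p1 \<ominus> p2"] bexI[of _ "q1 \<ominus> q2"]) auto
qed

text \<open>The \<open>a\<close> over whose zero set \<open>V(a)\<close> the equation \<open>F x = \<zero>\<close> has a solution form a
  multiplicative set; a prime avoiding it would violate local solvability.\<close>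
lemma glue:
  assumes F: "\<And>x. x \<in> carrier A \<Longrightarrow> F x \<in> carrier A"
    and uniq: "\<And>P x y. primeideal P A \<Longrightarrow> x \<in> carrier A \<Longrightarrow> y \<in> carrier A \<Longrightarrow> F x \<in> P \<Longrightarrow> F y \<in> P \<Longrightarrow> x \<ominus> y \<in> P"
    and local: "\<And>P. primeideal P A \<Longrightarrow> \<exists>x\<in>carrier A. F x \<in> P"
    and cong: "\<And>P x y. primeideal P A \<Longrightarrow> x \<in> carrier A \<Longrightarrow> y \<in> carrier A \<Longrightarrow> x \<ominus> y \<in> P \<Longrightarrow> F x \<in> P \<Longrightarrow> F y \<in> P"
  shows "\<exists>x\<in>carrier A. F x = \<zero>"
proof -
  define G where "G = {a \<in> carrier A. \<exists>x\<in>carrier A. \<forall>P. primeideal P A \<longrightarrow> a \<in> P \<longrightarrow> F x \<in> P}"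
  have one: "\<one> \<in> G"
  proof -
    have "\<one> \<notin> P" if "primeideal P A" for P
    proof
      assume "\<one> \<in> P"
      then have "P = carrier A" using ideal.one_imp_carrier primeideal.axioms(1)[OF that] by blast
      then show False using primeideal.I_notcarr[OF that] by simp
    qed
    then show ?thesis unfolding G_def by auto
  qed
  have mult: "a \<otimes> b \<in> G" if ab: "a \<in> G" "b \<in> G" for a b
  proof -
    have c: "a \<in> carrier A" "b \<in> carrier A" using ab unfolding G_def by auto
    obtain x where x: "x \<in> carrier A" "\<And>P. primeideal P A \<Longrightarrow> a \<in> P \<Longrightarrow> F x \<in> P" using ab(1) unfolding G_def by blast
    obtain y where y: "y \<in> carrier A" "\<And>P. primeideal P A \<Longrightarrow> b \<in> P \<Longrightarrow> F y \<in> P" using ab(2) unfolding G_def by blast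
    have h: "x \<ominus> y \<in> carrier A" using x y by simp
    have van: "x \<ominus> y \<in> P" if "primeideal P A" "a \<in> P" "b \<in> P" for P
      by (rule uniq[OF that(1) x(1) y(1) x(2)[OF that(1,2)] y(2)[OF that(1,3)]])
    from split_over_closed_sets[OF c h van]
    obtain p q where pq: "p \<in> carrier A" "q \<in> carrier A" "x \<ominus> y = p \<oplus> q"
      and pqP: "\<forall>P. primeideal P A \<longrightarrow> (a \<in> P \<longrightarrow> p \<in> P) \<and> (b \<in> P \<longrightarrow> q \<in> P)"
      by blast
    \<comment> \<open>\<open>z = x - p = y + q\<close> agrees with \<open>x\<close> wherever
      \<open>a\<close> vanishes and with \<open>y\<close> wherever \<open>b\<close>
      vanishes.\<close>
    define z where "z = x \<ominus> p"
    have z: "z \<in> carrier A" unfolding z_def using x pq by simp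
    have "x \<ominus> z = p" unfolding z_def using x(1) pq(1) by algebra
    have "y = x \<ominus> (p \<oplus> q)" unfolding pq(3)[symmetric] using x(1) y(1) by algebra
    then have "y \<ominus> z = \<ominus> q" unfolding z_def using x(1) pq(1,2) by algebra
    have "F z \<in> P" if P: "primeideal P A" "a \<otimes> b \<in> P" for P
    proof -
      consider "a \<in> P" | "b \<in> P" using primeideal.I_prime[OF P(1) c P(2)] by blast
      then show ?thesis
      proof cases
        case 1
        then show ?thesis using cong[OF P(1) x(1) z] x(2) pqP P(1) \<open>x \<ominus> z = p\<close> by simp
      next
        case 2
        then have "q \<in> P" using pqP P(1) by blast
        then have "\<ominus> q \<in> P"
          by (rule additive_subgroup.a_inv_closed[OF ideal.axioms(1)[OF primeideal.axioms(1)[OF P(1)]]])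
        then show ?thesis using cong[OF P(1) y(1) z] y(2) P(1) 2 \<open>y \<ominus> z = \<ominus> q\<close> by simp
      qed
    qed
    then show ?thesis unfolding G_def using c z by blast
  qed
  have "\<zero> \<in> G"
  proof (rule ccontr)
    assume "\<zero> \<notin> G"
    then have "{\<zero>} \<inter> G = {}" by blast
    then obtain P where P: "primeideal P A" "P \<inter> G = {}"
      using exists_prime_avoiding[OF zeroideal one mult] unfolding G_def by blast
    \<comment> \<open>A solution \<open>x\<close> at \<open>P\<close> is a solution wherever
      \<open>F x\<close> vanishes, so \<open>F x\<close> itself belongs to \<open>G\<close> as well
      as to \<open>P\<close>.\<close>
    obtain x where x: "x \<in> carrier A" "F x \<in> P" using local[OF P(1)] by blast
    then have "F x \<in> G" unfolding G_def using F by blast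
    then show False using x P by blast
  qed
  then obtain x where "x \<in> carrier A" "\<forall>P. primeideal P A \<longrightarrow> \<zero> \<in> P \<longrightarrow> F x \<in> P" unfolding G_def by blast
  then have "x \<in> carrier A" "\<And>P. primeideal P A \<Longrightarrow> F x \<in> P"
    using additive_subgroup.zero_closed ideal.axioms(1) primeideal.axioms(1) by blast+
  then show ?thesis using in_all_primes[OF F] by blast
qed

end

section \<open>Virtual roots in a real closed ring in the sense of Schwartz\<close>

text \<open>The conditions of \<open>vr_conds\<close> as a list of elements that have to be
  nonnegative; a list can be mapped along homomorphisms and summed up.\<close>

definition cond_list :: "('r, 'm) ring_scheme \<Rightarrow> nat \<Rightarrow> 'r list \<Rightarrow> (nat \<Rightarrow> 'r) \<Rightarrow> nat \<Rightarrow> 'r \<Rightarrow> 'r list" where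
  "cond_list R d f U j x =
    (let \<sigma> = (\<ominus>\<^bsub>R\<^esub> \<one>\<^bsub>R\<^esub>) [^]\<^bsub>R\<^esub> (d - j); u = U (j - 1); v = U j
     in (if 2 \<le> j then [x \<ominus>\<^bsub>R\<^esub> u, \<ominus>\<^bsub>R\<^esub> (\<sigma> \<otimes>\<^bsub>R\<^esub> (x \<ominus>\<^bsub>R\<^esub> u) \<otimes>\<^bsub>R\<^esub> ring.eval R f u),
           \<ominus>\<^bsub>R\<^esub> (\<sigma> \<otimes>\<^bsub>R\<^esub> (x \<ominus>\<^bsub>R\<^esub> u) \<otimes>\<^bsub>R\<^esub> ring.eval R f x)] else []) @
        (if j \<le> d - 1 then [v \<ominus>\<^bsub>R\<^esub> x, \<sigma> \<otimes>\<^bsub>R\<^esub> (v \<ominus>\<^bsub>R\<^esub> x) \<otimes>\<^bsub>R\<^esub> ring.eval R f v,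
           \<sigma> \<otimes>\<^bsub>R\<^esub> (v \<ominus>\<^bsub>R\<^esub> x) \<otimes>\<^bsub>R\<^esub> ring.eval R f x] else []) @
        (if j = d then [ring.eval R f x] else []) @
        (if j = 1 then [(\<ominus>\<^bsub>R\<^esub> \<one>\<^bsub>R\<^esub>) [^]\<^bsub>R\<^esub> d \<otimes>\<^bsub>R\<^esub> ring.eval R f x] else []))"

lemma (in cring) cond_list_closed:
  assumes "set f \<subseteq> carrier R" "x \<in> carrier R" "\<And>j. j \<in> {1..d - 1} \<Longrightarrow> U j \<in> carrier R" "1 \<le> j" "j \<le> d"
  shows "set (cond_list R d f U j x) \<subseteq> carrier R"
proof -
  have u: "U (j - 1) \<in> carrier R" if "2 \<le> j" using that assms(4,5) by (intro assms(3)) auto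
  have v: "U j \<in> carrier R" if "j \<le> d - 1" using that assms(4,5) by (intro assms(3)) auto
  have s: "(\<ominus> \<one>) [^] (k::nat) \<in> carrier R" for k by simp
  have ifs: "set (if b then [p, q, r] else []) \<subseteq> carrier R \<longleftrightarrow> (b \<longrightarrow> p \<in> carrier R \<and> q \<in> carrier R \<and> r \<in> carrier R)"
    "set (if b then [p] else []) \<subseteq> carrier R \<longleftrightarrow> (b \<longrightarrow> p \<in> carrier R)" for b p q r
    by (cases b; auto)+
  show ?thesis unfolding cond_list_def Let_def set_append Un_subset_iff ifs
    by (intro conjI impI minus_closed a_inv_closed m_closed s u v assms(2) eval_in_carrier[OF assms(1)])
qed

lemma (in cring) vr_conds_iff_cond_list:
  assumes Le: "\<And>x y. x \<in> carrier R \<Longrightarrow> y \<in> carrier R \<Longrightarrow> Le x y \<longleftrightarrow> Le \<zero> (y \<ominus> x)"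
    and *: "set f \<subseteq> carrier R" "x \<in> carrier R" "\<And>j. j \<in> {1..d - 1} \<Longrightarrow> U j \<in> carrier R" "1 \<le> j" "j \<le> d"
  shows "vr_conds R Le d f U j x \<longleftrightarrow> (\<forall>c\<in>set (cond_list R d f U j x). Le \<zero> c)"
proof -
  have u: "U (j - 1) \<in> carrier R" if "2 \<le> j" using that *(4,5) by (intro *(3)) auto
  have v: "U j \<in> carrier R" if "j \<le> d - 1" using that *(4,5) by (intro *(3)) auto
  have neg: "Le a \<zero> \<longleftrightarrow> Le \<zero> (\<ominus> a)" if "a \<in> carrier R" for a
    using Le[OF that zero_closed] that by (simp add: minus_eq)
  have 1: "(2 \<le> j \<longrightarrow> Le a x \<and> Le (\<sigma> \<otimes> (x \<ominus> a) \<otimes> eval f a) \<zero> \<and>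
      Le (\<sigma> \<otimes> (x \<ominus> a) \<otimes> eval f x) \<zero>) \<longleftrightarrow>
    (\<forall>c\<in>set (if 2 \<le> j then [x \<ominus> a, \<ominus> (\<sigma> \<otimes> (x \<ominus> a) \<otimes> eval f a),
           \<ominus> (\<sigma> \<otimes> (x \<ominus> a) \<otimes> eval f x)] else []). Le \<zero> c)"
    if "\<sigma> \<in> carrier R" "2 \<le> j \<Longrightarrow> a \<in> carrier R" for \<sigma> a
    using that *(1,2) by (cases "2 \<le> j") (simp_all add: neg Le[of a x] eval_in_carrier)
  have 2: "(j \<le> d - 1 \<longrightarrow> Le x (U j) \<and> Le \<zero> (\<sigma> \<otimes> (U j \<ominus> x) \<otimes> eval f (U j)) \<and>
      Le \<zero> (\<sigma> \<otimes> (U j \<ominus> x) \<otimes> eval f x)) \<longleftrightarrow>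
    (\<forall>c\<in>set (if j \<le> d - 1 then [U j \<ominus> x, \<sigma> \<otimes> (U j \<ominus> x) \<otimes> eval f (U j),
           \<sigma> \<otimes> (U j \<ominus> x) \<otimes> eval f x] else []). Le \<zero> c)" for \<sigma>
    using v Le[OF *(2), of "U j"] by (cases "j \<le> d - 1") simp_all
  have 3: "((\<ominus> \<one>) [^] (d - j)) \<in> carrier R" by simp
  have if1: "(\<forall>c\<in>set (if b then [p] else []). Le \<zero> c) \<longleftrightarrow> (b \<longrightarrow> Le \<zero> p)" for b p
    by simp
  show ?thesis unfolding vr_conds_def cond_list_def Let_def set_append ball_Un by (simp only: 1[OF 3 u] 2 if1)
qed

lemma (in ring_hom_cring) cond_list_map:
  assumes "set f \<subseteq> carrier R" "x \<in> carrier R" "\<And>j. j \<in> {1..d - 1} \<Longrightarrow> U j \<in> carrier R" "1 \<le> j" "j \<le> d"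
  shows "cond_list S d (map h f) (h \<circ> U) j (h x) = map h (cond_list R d f U j x)"
proof -
  have u: "U (j - 1) \<in> carrier R" if "2 \<le> j" using that assms(4,5) by (intro assms(3)) auto
  have v: "U j \<in> carrier R" if "j \<le> d - 1" using that assms(4,5) by (intro assms(3)) auto
  note ev = eval_map[OF assms(1)] R.eval_in_carrier[OF assms(1)]
  have 1: "(if 2 \<le> j then [h x \<ominus>\<^bsub>S\<^esub> h a, \<ominus>\<^bsub>S\<^esub> (h \<sigma> \<otimes>\<^bsub>S\<^esub> (h x \<ominus>\<^bsub>S\<^esub> h a) \<otimes>\<^bsub>S\<^esub> ring.eval S (map h f) (h a)),
           \<ominus>\<^bsub>S\<^esub> (h \<sigma> \<otimes>\<^bsub>S\<^esub> (h x \<ominus>\<^bsub>S\<^esub> h a) \<otimes>\<^bsub>S\<^esub> ring.eval S (map h f) (h x))] else []) =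
      map h (if 2 \<le> j then [x \<ominus>\<^bsub>R\<^esub> a, \<ominus>\<^bsub>R\<^esub> (\<sigma> \<otimes>\<^bsub>R\<^esub> (x \<ominus>\<^bsub>R\<^esub> a) \<otimes>\<^bsub>R\<^esub> ring.eval R f a),
           \<ominus>\<^bsub>R\<^esub> (\<sigma> \<otimes>\<^bsub>R\<^esub> (x \<ominus>\<^bsub>R\<^esub> a) \<otimes>\<^bsub>R\<^esub> ring.eval R f x)] else [])"
    if "\<sigma> \<in> carrier R" "2 \<le> j \<Longrightarrow> a \<in> carrier R" for \<sigma> a
    using that assms(2) by (cases "2 \<le> j") (simp_all add: ev R.minus_eq S.minus_eq)
  have 2: "(if j \<le> d - 1 then [h b \<ominus>\<^bsub>S\<^esub> h x, h \<sigma> \<otimes>\<^bsub>S\<^esub> (h b \<ominus>\<^bsub>S\<^esub> h x) \<otimes>\<^bsub>S\<^esub> ring.eval S (map h f) (h b),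
           h \<sigma> \<otimes>\<^bsub>S\<^esub> (h b \<ominus>\<^bsub>S\<^esub> h x) \<otimes>\<^bsub>S\<^esub> ring.eval S (map h f) (h x)] else []) =
      map h (if j \<le> d - 1 then [b \<ominus>\<^bsub>R\<^esub> x, \<sigma> \<otimes>\<^bsub>R\<^esub> (b \<ominus>\<^bsub>R\<^esub> x) \<otimes>\<^bsub>R\<^esub> ring.eval R f b,
           \<sigma> \<otimes>\<^bsub>R\<^esub> (b \<ominus>\<^bsub>R\<^esub> x) \<otimes>\<^bsub>R\<^esub> ring.eval R f x] else [])"
    if "\<sigma> \<in> carrier R" "j \<le> d - 1 \<Longrightarrow> b \<in> carrier R" for \<sigma> b
    using that assms(2) by (cases "j \<le> d - 1") (simp_all add: ev R.minus_eq S.minus_eq)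
  have s: "(\<ominus>\<^bsub>R\<^esub> \<one>\<^bsub>R\<^esub>) [^]\<^bsub>R\<^esub> k \<in> carrier R" "(\<ominus>\<^bsub>S\<^esub> \<one>\<^bsub>S\<^esub>) [^]\<^bsub>S\<^esub> k = h ((\<ominus>\<^bsub>R\<^esub> \<one>\<^bsub>R\<^esub>) [^]\<^bsub>R\<^esub> k)" for k :: nat
    by simp_all
  have 3: "(if j = d then [ring.eval S (map h f) (h x)] else []) = map h (if j = d then [ring.eval R f x] else [])"
    using assms(2) by (simp add: ev)
  have 4: "(if j = 1 then [h \<sigma> \<otimes>\<^bsub>S\<^esub> ring.eval S (map h f) (h x)] else []) =
     map h (if j = 1 then [\<sigma> \<otimes>\<^bsub>R\<^esub> ring.eval R f x] else [])" if "\<sigma> \<in> carrier R" for \<sigma>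
    using assms(2) that by (simp add: ev)
  show ?thesis unfolding cond_list_def Let_def o_apply s(2) map_append
    by (simp only: 1[OF s(1) u] 2[OF s(1) v] 3 4[OF s(1)])
qed

context f_ring
begin

definition np_sum :: "'a list \<Rightarrow> 'a" where "np_sum cs = foldr (\<lambda>c s. np c \<oplus> s) cs \<zero>"

lemma np_sum_closed: "set cs \<subseteq> carrier A \<Longrightarrow> np_sum cs \<in> carrier A \<and> \<zero> \<preceq> np_sum cs"
  unfolding np_sum_def by (induction cs) (auto intro: add_nonneg le_refl)

lemma np_sum_zero: "\<forall>c\<in>set cs. np c = \<zero> \<Longrightarrow> np_sum cs = \<zero>"
  unfolding np_sum_def by (induction cs) auto

end

context square_f_ring
begin

text \<open>The terms are nonnegative and \<open>P\<close> is convex, so a sum in \<open>P\<close>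
  has all its terms in \<open>P\<close>.\<close>

lemma np_sum_in_prime:
  assumes P: "primeideal P A"
  shows "set cs \<subseteq> carrier A \<Longrightarrow> np_sum cs \<in> P \<longleftrightarrow> (\<forall>c\<in>set cs. np c \<in> P)"
proof (induction cs)
  case Nil
  then show ?case using additive_subgroup.zero_closed[OF ideal.axioms(1)[OF primeideal.axioms(1)[OF P]]]
    by (simp add: np_sum_def)
next
  case (Cons c cs)
  interpret P: primeideal P A by (rule P)
  have c: "np c \<in> carrier A" "\<zero> \<preceq> np c" "np_sum cs \<in> carrier A" "\<zero> \<preceq> np_sum cs"
    using Cons.prems np_sum_closed[of cs] by auto
  have "np_sum (c # cs) = np c \<oplus> np_sum cs" by (simp add: np_sum_def)
  moreover have "np c \<oplus> np_sum cs \<in> P \<longleftrightarrow> np c \<in> P \<and> np_sum cs \<in> P"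
  proof
    assume *: "np c \<oplus> np_sum cs \<in> P"
    then have "np_sum cs \<oplus> np c \<in> P" using c by (simp add: a_comm)
    then show "np c \<in> P \<and> np_sum cs \<in> P"
      using prime_add_nonneg[OF P c(1,3,2,4) *] prime_add_nonneg[OF P c(3,1,4,2)] by blast
  qed (auto intro: P.a_closed)
  ultimately show ?case using Cons by simp
qed

lemma sq_le_iff_diff:
  assumes "cring K" "x \<in> carrier K" "y \<in> carrier K"
  shows "sq_le K x y \<longleftrightarrow> sq_le K \<zero>\<^bsub>K\<^esub> (y \<ominus>\<^bsub>K\<^esub> x)"
proof -
  interpret K: cring K by (rule assms(1))
  have "y \<ominus>\<^bsub>K\<^esub> x \<ominus>\<^bsub>K\<^esub> \<zero>\<^bsub>K\<^esub> = y \<ominus>\<^bsub>K\<^esub> x" using assms by (simp add: K.minus_eq)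
  then show ?thesis unfolding sq_le_def by simp
qed

context
  fixes n :: nat and f U j
  assumes f: "set f \<subseteq> carrier A" and U: "\<And>i. i \<in> {1..n} \<Longrightarrow> U i \<in> carrier A" and j: "1 \<le> j" "j \<le> Suc n"
begin

lemma U_closed: "\<And>i. i \<in> {1..Suc n - 1} \<Longrightarrow> U i \<in> carrier A" using U by simp

lemma vr_conds_iff_np_sum:
  assumes x: "x \<in> carrier A"
  shows "vr_conds A le (Suc n) f U j x \<longleftrightarrow> np_sum (cond_list A (Suc n) f U j x) = \<zero>"
proof -
  have cl: "set (cond_list A (Suc n) f U j x) \<subseteq> carrier A"
    by (rule cond_list_closed[OF f x _ j]) (rule U_closed)
  have "vr_conds A le (Suc n) f U j x \<longleftrightarrow> (\<forall>c\<in>set (cond_list A (Suc n) f U j x). np c = \<zero>)"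
  proof -
    have "vr_conds A le (Suc n) f U j x \<longleftrightarrow> (\<forall>c\<in>set (cond_list A (Suc n) f U j x). \<zero> \<preceq> c)"
      by (rule vr_conds_iff_cond_list[where Le = le, OF le_iff_diff f x _ j]) (auto intro: U)
    also have "\<dots> \<longleftrightarrow> (\<forall>c\<in>set (cond_list A (Suc n) f U j x). np c = \<zero>)"
    proof (rule ball_cong[OF refl])
      fix c assume "c \<in> set (cond_list A (Suc n) f U j x)"
      then show "\<zero> \<preceq> c \<longleftrightarrow> np c = \<zero>" using np_eq_0 cl by blast
    qed
    finally show ?thesis .
  qed
  also have "\<dots> \<longleftrightarrow> np_sum (cond_list A (Suc n) f U j x) = \<zero>"
  proof
    assume "\<forall>c\<in>set (cond_list A (Suc n) f U j x). np c = \<zero>"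
    then show "np_sum (cond_list A (Suc n) f U j x) = \<zero>" by (rule np_sum_zero)
  next
    assume *: "np_sum (cond_list A (Suc n) f U j x) = \<zero>"
    show "\<forall>c\<in>set (cond_list A (Suc n) f U j x). np c = \<zero>"
    proof
      fix c assume c: "c \<in> set (cond_list A (Suc n) f U j x)"
      show "np c = \<zero>"
      proof (rule in_all_primes)
        fix P assume P: "primeideal P A"
        have "np_sum (cond_list A (Suc n) f U j x) \<in> P" unfolding *
          by (rule additive_subgroup.zero_closed[OF ideal.axioms(1)[OF primeideal.axioms(1)[OF P]]])
        then show "np c \<in> P" using np_sum_in_prime[OF P cl] c by blast
      qed (use c cl in auto)
    qed
  qed
  finally show ?thesis .
qed

text \<open>\<open>cond_list\<close> commutes with \<open>res P\<close>, and
  \<open>np_in_prime_iff\<close> handles each entry; so one element of \<open>A\<close> decides the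
  conditions modulo every prime.\<close>

lemma vr_conds_residue_iff:
  assumes x: "x \<in> carrier A" and P: "primeideal P A"
  shows "vr_conds (residue_field P) (sq_le (residue_field P)) (Suc n) (map (res P) f) (res P \<circ> U) j (res P x) \<longleftrightarrow>
    np_sum (cond_list A (Suc n) f U j x) \<in> P"
proof -
  interpret H: ring_hom_cring A "residue_field P" "res P" by (rule res_hom[OF P])
  have cl: "set (cond_list A (Suc n) f U j x) \<subseteq> carrier A"
    by (rule cond_list_closed[OF f x _ j]) (rule U_closed)
  have "vr_conds (residue_field P) (sq_le (residue_field P)) (Suc n) (map (res P) f) (res P \<circ> U) j (res P x) \<longleftrightarrow>
    (\<forall>c\<in>set (cond_list (residue_field P) (Suc n) (map (res P) f) (res P \<circ> U) j (res P x)). sq_le (residue_field P) \<zero>\<^bsub>residue_field P\<^esub> c)"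
    using f x U_closed j by (intro H.S.vr_conds_iff_cond_list sq_le_iff_diff H.S.is_cring) auto
  also have "\<dots> \<longleftrightarrow> (\<forall>c\<in>set (cond_list A (Suc n) f U j x). np c \<in> P)"

  proof -
    have *: "np c \<in> P \<longleftrightarrow> sq_le (residue_field P) \<zero>\<^bsub>residue_field P\<^esub> (res P c)"
      if "c \<in> set (cond_list A (Suc n) f U j x)" for c
      by (rule np_in_prime_iff[OF P subsetD[OF cl that]])
    have eq: "cond_list (residue_field P) (Suc n) (map (res P) f) (res P \<circ> U) j (res P x) =
        map (res P) (cond_list A (Suc n) f U j x)"
      by (rule H.cond_list_map[OF f x _ j]) (rule U_closed)
    show ?thesis unfolding eq using * by auto
  qed
  also have "\<dots> \<longleftrightarrow> np_sum (cond_list A (Suc n) f U j x) \<in> P" using np_sum_in_prime[OF P cl] ..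
  finally show ?thesis .
qed

end

end

locale schwartz_f_ring = square_f_ring +
  assumes integrally_closed_residue: "primeideal P A \<Longrightarrow> integrally_closed (A Quot P)"
    and real_closed_residue: "primeideal P A \<Longrightarrow> real_closed_field (residue_field P)"
begin

lemma integral_in_image:
  assumes P: "primeideal P A" and f: "monic_poly A n f" and x: "x \<in> carrier (residue_field P)"
    and ev: "ring.eval (residue_field P) (map (res P) f) x = \<zero>\<^bsub>residue_field P\<^esub>"
  shows "\<exists>a\<in>carrier A. x = res P a"
proof -
  obtain cs where cs: "f = \<one> # cs" "set cs \<subseteq> carrier A" using f unfolding monic_poly_def by blast
  have one: "P +> \<one> = \<one>\<^bsub>A Quot P\<^esub>" using ring_hom_one[OF quot_hom[OF P]] .
  have "map (res P) f = map (frac_embed (A Quot P)) (\<one>\<^bsub>A Quot P\<^esub> # map ((+>) P) cs)"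
    unfolding cs(1) by (simp add: res_def one)
  moreover have "set (map ((+>) P) cs) \<subseteq> carrier (A Quot P)" using cs(2) unfolding carrier_quot by auto
  ultimately have "x \<in> frac_embed (A Quot P) ` carrier (A Quot P)"
    using integrally_closed_residue[OF P] x ev unfolding integrally_closed_def residue_field_def by metis
  then show ?thesis unfolding carrier_quot res_def by blast
qed

context
  fixes n :: nat and f U j
  assumes f: "monic_poly A (Suc n) f" and U: "\<And>i. i \<in> {1..n} \<Longrightarrow> U i \<in> carrier A"
    and vr: "vroots A le n (monic_deriv A f) U" and j: "j \<in> {1..Suc n}"
begin

text \<open>The virtual root in the residue field is one of the \<open>res P (U i)\<close>, which
  come from \<open>A\<close>, or a root of \<open>f\<close>; in the latter case it is integral over
  \<open>A/P\<close>, and integral closedness puts it in the image of \<open>A\<close>.\<close>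

lemma residue_conds:
  assumes P: "primeideal P A"
  shows "\<exists>x\<in>carrier A. vr_conds (residue_field P) (sq_le (residue_field P)) (Suc n) (map (res P) f) (res P \<circ> U) j (res P x)"
    and "\<And>x y. x \<in> carrier (residue_field P) \<Longrightarrow> y \<in> carrier (residue_field P) \<Longrightarrow>
       vr_conds (residue_field P) (sq_le (residue_field P)) (Suc n) (map (res P) f) (res P \<circ> U) j x \<Longrightarrow>
       vr_conds (residue_field P) (sq_le (residue_field P)) (Suc n) (map (res P) f) (res P \<circ> U) j y \<Longrightarrow> x = y"
proof -
  interpret H: ring_hom_cring A "residue_field P" "res P" by (rule res_hom[OF P])
  have f_closed: "set f \<subseteq> carrier A" using f unfolding monic_poly_def by auto
  have odd: "odd_polys_have_roots (residue_field P)"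
    using real_closed_residue[OF P] unfolding real_closed_field_def odd_polys_have_roots_def by blast
  have mf: "monic_poly (residue_field P) (Suc n) (map (res P) f)" by (rule H.monic_poly_map[OF f])
  have "vroots (residue_field P) (sq_le (residue_field P)) n (map (res P) (monic_deriv A f)) (res P \<circ> U)"
    using vr U by (intro H.vroots_map[where Le = le] res_le[OF P] rational_A monic_deriv_closed[OF rational_A f_closed]) auto
  then have vK: "vroots (residue_field P) (sq_le (residue_field P)) n (monic_deriv (residue_field P) (map (res P) f)) (res P \<circ> U)"
    unfolding H.monic_deriv_map[OF rational_A f_closed] .
  have UK: "\<forall>i\<in>{1..n}. (res P \<circ> U) i \<in> carrier (residue_field P)" using U by simp
  note T = virtual_roots_of_euclidean_field(2)[OF euclidean_residue_field[OF P],
      unfolded virtual_roots_exist_uniquely_def, rule_format, OF odd mf UK[rule_format] vK j]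
  from conjunct1[OF T] obtain x where x: "x \<in> carrier (residue_field P)"
    "vr_conds (residue_field P) (sq_le (residue_field P)) (Suc n) (map (res P) f) (res P \<circ> U) j x"
    "x \<in> (res P \<circ> U) ` {1..n} \<or> ring.eval (residue_field P) (map (res P) f) x = \<zero>\<^bsub>residue_field P\<^esub>" by blast
  have "\<exists>a\<in>carrier A. x = res P a" using x(3)
  proof
    assume "x \<in> (res P \<circ> U) ` {1..n}"
    then show ?thesis using U by auto
  qed (rule integral_in_image[OF P f x(1)])
  then show "\<exists>x\<in>carrier A. vr_conds (residue_field P) (sq_le (residue_field P)) (Suc n) (map (res P) f) (res P \<circ> U) j (res P x)"
    using x(2) by blast
  show "x = y" if "x \<in> carrier (residue_field P)" "y \<in> carrier (residue_field P)"
       "vr_conds (residue_field P) (sq_le (residue_field P)) (Suc n) (map (res P) f) (res P \<circ> U) j x"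
       "vr_conds (residue_field P) (sq_le (residue_field P)) (Suc n) (map (res P) f) (res P \<circ> U) j y" for x y
    using conjunct2[OF T] that by blast
qed

lemma res_eq_iff:
  assumes P: "primeideal P A" and "x \<in> carrier A" "y \<in> carrier A"
  shows "res P x = res P y \<longleftrightarrow> x \<ominus> y \<in> P"
proof -
  interpret H: ring_hom_cring A "residue_field P" "res P" by (rule res_hom[OF P])
  have "res P (x \<ominus> y) = res P x \<ominus>\<^bsub>residue_field P\<^esub> res P y" using assms by (simp add: minus_eq H.S.minus_eq)
  moreover have "x \<ominus> y \<in> P \<longleftrightarrow> res P (x \<ominus> y) = \<zero>\<^bsub>residue_field P\<^esub>" using res_eq_0[OF P, of "x \<ominus> y"] assms by simp
  ultimately show ?thesis using assms by (simp add: H.S.r_right_minus_eq)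
qed

lemma f_closed: "set f \<subseteq> carrier A"
  using f unfolding monic_poly_def by auto

lemma j_bounds: "1 \<le> j" "j \<le> Suc n"
  using j by auto

lemma conds_iff: "x \<in> carrier A \<Longrightarrow> vr_conds A le (Suc n) f U j x \<longleftrightarrow> np_sum (cond_list A (Suc n) f U j x) = \<zero>"
  by (rule vr_conds_iff_np_sum[OF f_closed _ j_bounds]) (rule U)

lemma conds_residue_iff:
  assumes "x \<in> carrier A" "primeideal P A"
  shows "vr_conds (residue_field P) (sq_le (residue_field P)) (Suc n) (map (res P) f) (res P \<circ> U) j (res P x) \<longleftrightarrow>
    np_sum (cond_list A (Suc n) f U j x) \<in> P"
  by (rule vr_conds_residue_iff[OF f_closed _ j_bounds assms]) (rule U)

lemma vr_conds_exists: "\<exists>x\<in>carrier A. vr_conds A le (Suc n) f U j x"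
proof -
  define F where "F = (\<lambda>x. np_sum (cond_list A (Suc n) f U j x))"
  have F_iff: "vr_conds (residue_field P) (sq_le (residue_field P)) (Suc n) (map (res P) f) (res P \<circ> U) j (res P x) \<longleftrightarrow> F x \<in> P"
    if "x \<in> carrier A" "primeideal P A" for x P
    unfolding F_def by (rule conds_residue_iff[OF that])
  have "\<exists>x\<in>carrier A. F x = \<zero>"
  proof (rule glue)
    fix x assume x: "x \<in> carrier A"
    have "set (cond_list A (Suc n) f U j x) \<subseteq> carrier A"
      by (rule cond_list_closed[OF f_closed x _ j_bounds]) (simp add: U)
    then show "F x \<in> carrier A" unfolding F_def using np_sum_closed by blast
  next
    fix P x y assume P: "primeideal P A" and x: "x \<in> carrier A" "y \<in> carrier A" "F x \<in> P" "F y \<in> P"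
    interpret H: ring_hom_cring A "residue_field P" "res P" by (rule res_hom[OF P])
    have "res P x = res P y"
      by (rule residue_conds(2)[OF P H.hom_closed[OF x(1)] H.hom_closed[OF x(2)]
          F_iff[OF x(1) P, THEN iffD2, OF x(3)] F_iff[OF x(2) P, THEN iffD2, OF x(4)]])
    then show "x \<ominus> y \<in> P" using res_eq_iff[OF P x(1,2)] by blast
  next
    fix P assume P: "primeideal P A"
    then show "\<exists>x\<in>carrier A. F x \<in> P" using residue_conds(1)[OF P] F_iff by blast
  next
    fix P x y assume P: "primeideal P A" and x: "x \<in> carrier A" "y \<in> carrier A" "x \<ominus> y \<in> P" "F x \<in> P"
    have "res P x = res P y" using res_eq_iff[OF P x(1,2)] x(3) by blast
    then show "F y \<in> P" using F_iff[OF x(1) P] F_iff[OF x(2) P] x(4) by simp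
  qed
  then show ?thesis using conds_iff unfolding F_def by blast
qed

lemma vr_conds_unique:
  assumes x: "x \<in> carrier A" "vr_conds A le (Suc n) f U j x" and y: "y \<in> carrier A" "vr_conds A le (Suc n) f U j y"
  shows "x = y"
proof -
  have z: "np_sum (cond_list A (Suc n) f U j x) = \<zero>" "np_sum (cond_list A (Suc n) f U j y) = \<zero>"
    using conds_iff x y by blast+
  have "x \<ominus> y = \<zero>"
  proof (rule in_all_primes)
    fix P assume P: "primeideal P A"
    interpret H: ring_hom_cring A "residue_field P" "res P" by (rule res_hom[OF P])
    have z0: "\<zero> \<in> P" by (rule additive_subgroup.zero_closed[OF ideal.axioms(1)[OF primeideal.axioms(1)[OF P]]])
    have "res P x = res P y"
      by (rule residue_conds(2)[OF P H.hom_closed[OF x(1)] H.hom_closed[OF y(1)]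
          conds_residue_iff[OF x(1) P, THEN iffD2] conds_residue_iff[OF y(1) P, THEN iffD2]])
        (simp_all add: z z0)
    then show "x \<ominus> y \<in> P" using res_eq_iff[OF P x(1) y(1)] by blast
  qed (use x y in auto)
  then show ?thesis using x y by simp
qed

end

section \<open>The operations \<open>rho\<close> and \<open>Fr\<close> on a Schwartz real closed
  ring\<close>

lemma vroots_unique:
  assumes "monic_poly A n f" "\<And>j. j \<in> {1..n} \<Longrightarrow> W j \<in> carrier A" "\<And>j. j \<in> {1..n} \<Longrightarrow> W' j \<in> carrier A"
    "vroots A le n f W" "vroots A le n f W'" "j \<in> {1..n}"
  shows "W j = W' j"
  using assms
proof (induction n arbitrary: f W W' j)
  case (Suc n)
  have g: "monic_poly A n (monic_deriv A f)" by (rule monic_poly_deriv[OF rational_A Suc.prems(1)])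
  obtain U where U: "\<forall>j\<in>{1..n}. U j \<in> carrier A" "vroots A le n (monic_deriv A f) U"
    "\<forall>j\<in>{1..Suc n}. vr_conds A le (Suc n) f U j (W j)" using Suc.prems(4) unfolding vroots.simps by blast
  \<comment> \<open>Here \<open>U_closed\<close> is a function, the family for the derivative that
    belongs to \<open>W'\<close>; the induction hypothesis identifies it with
    \<open>U\<close>.\<close>
  obtain U_closed where U_closed: "\<forall>j\<in>{1..n}. U_closed j \<in> carrier A" "vroots A le n (monic_deriv A f) U_closed"
    "\<forall>j\<in>{1..Suc n}. vr_conds A le (Suc n) f U_closed j (W' j)" using Suc.prems(5) unfolding vroots.simps by blast
  have UU: "U_closed i = U i" if "i \<in> {1..n}" for i
    by (rule Suc.IH[OF g _ _ U_closed(2) U(2) that]) (use U(1) U_closed(1) in auto)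
  have "vr_conds A le (Suc n) f U j (W' j)"
    using U_closed(3) vr_conds_cong[of "Suc n" U_closed U j A le f "W' j"] UU Suc.prems(6) by auto
  then show ?case
    using vr_conds_unique[OF Suc.prems(1) _ U(2) Suc.prems(6)] U(1,3) Suc.prems(2,3,6) by blast
qed auto

lemma vroots_exist: "monic_poly A n f \<Longrightarrow> \<exists>W. (\<forall>j\<in>{1..n}. W j \<in> carrier A) \<and> vroots A le n f W"
proof (induction n arbitrary: f)
  case (Suc n)
  have g: "monic_poly A n (monic_deriv A f)" by (rule monic_poly_deriv[OF rational_A Suc.prems])
  obtain U where U: "\<forall>j\<in>{1..n}. U j \<in> carrier A" "vroots A le n (monic_deriv A f) U" using Suc.IH[OF g] by blast
  have "\<forall>j\<in>{1..Suc n}. \<exists>x. x \<in> carrier A \<and> vr_conds A le (Suc n) f U j x"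
    using vr_conds_exists[OF Suc.prems _ U(2)] U(1) by blast
  then obtain W where "\<forall>j\<in>{1..Suc n}. W j \<in> carrier A \<and> vr_conds A le (Suc n) f U j (W j)" by (auto dest!: bchoice)
  then show ?case unfolding vroots.simps using U by blast
qed simp

definition vroot_fun :: "nat \<Rightarrow> 'a list \<Rightarrow> nat \<Rightarrow> 'a" where
  "vroot_fun n f = (SOME W. (\<forall>j\<in>{1..n}. W j \<in> carrier A) \<and> vroots A le n f W)"

lemma vroot_fun:
  assumes "monic_poly A n f"
  shows "\<And>j. j \<in> {1..n} \<Longrightarrow> vroot_fun n f j \<in> carrier A" "vroots A le n f (vroot_fun n f)"
  using someI_ex[OF vroots_exist[OF assms]] unfolding vroot_fun_def by blast+

definition rho :: "nat \<Rightarrow> nat \<Rightarrow> 'a list \<Rightarrow> 'a" where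
  "rho d j as = vroot_fun d (\<one> # map (\<lambda>c. \<ominus> c) as) j"

lemma virtual_root_rho:
  assumes "monic_poly A d f"
  shows "virtual_root A rho d j f = vroot_fun d f j"
proof -
  obtain cs where cs: "f = \<one> # cs" "set cs \<subseteq> carrier A" using assms unfolding monic_poly_def by blast
  have "map (\<lambda>c. \<ominus> c) (map (\<lambda>c. \<ominus> c) cs) = cs" using cs(2) by (induction cs) auto
  then show ?thesis unfolding virtual_root_def rho_def cs(1) by simp
qed

text \<open>\<open>vroots\<close> provides only some family for the derivative; uniqueness
  identifies it with the family that \<open>vroot_fun\<close> picks for the derivative on its own,
  as (V2) demands.\<close>

lemma vr_conds_rho:
  assumes f: "monic_poly A (Suc n) f" and j: "j \<in> {1..Suc n}"
  shows "vr_conds A le (Suc n) f (vroot_fun n (monic_deriv A f)) j (vroot_fun (Suc n) f j)"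
proof -
  have g: "monic_poly A n (monic_deriv A f)" by (rule monic_poly_deriv[OF rational_A f])
  obtain U where U: "\<forall>j\<in>{1..n}. U j \<in> carrier A" "vroots A le n (monic_deriv A f) U"
    "\<forall>j\<in>{1..Suc n}. vr_conds A le (Suc n) f U j (vroot_fun (Suc n) f j)"
    using vroot_fun(2)[OF f] unfolding vroots.simps by blast
  have "U i = vroot_fun n (monic_deriv A f) i" if "i \<in> {1..n}" for i
    by (rule vroots_unique[OF g _ vroot_fun(1)[OF g] U(2) vroot_fun(2)[OF g] that]) (use U(1) in auto)
  then show ?thesis
    using U(3) j vr_conds_cong[of "Suc n" U "vroot_fun n (monic_deriv A f)" j A le f "vroot_fun (Suc n) f j"] by auto
qed

lemma linear_root:
  assumes "a \<in> carrier A"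
  shows "vroot_fun 1 [\<one>, \<ominus> a] 1 = a"
proof -
  have f: "monic_poly A (Suc 0) [\<one>, \<ominus> a]" unfolding monic_poly_def using assms by auto
  define x where "x = vroot_fun 1 [\<one>, \<ominus> a] 1"
  have x: "x \<in> carrier A" unfolding x_def using vroot_fun(1)[OF f, of 1] by simp
  have ev: "eval [\<one>, \<ominus> a] x = x \<ominus> a" using x assms by (simp add: minus_eq)
  have "\<zero> \<preceq> x \<ominus> a" "\<zero> \<preceq> (\<ominus> \<one>) [^] (1::nat) \<otimes> (x \<ominus> a)"
    using vr_conds_rho[OF f, of 1] unfolding vr_conds_def Let_def x_def[symmetric] ev[symmetric] by (simp_all add: x_def)
  moreover have "(\<ominus> \<one>) [^] (1::nat) \<otimes> (x \<ominus> a) = \<ominus> (x \<ominus> a)" using x assms by (simp add: l_minus)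
  ultimately have "x \<ominus> a = \<zero>" using le_neg[of \<zero> "\<ominus> (x \<ominus> a)"] x assms by (intro nonneg_between_0) auto
  then show ?thesis using x assms unfolding x_def[symmetric] by simp
qed

text \<open>For \<open>f = (X - a)(X - b)\<close> the derivative has the virtual root
  \<open>u = (a + b)/2\<close>. The join \<open>m\<close> satisfies (V2): \<open>m - a\<close> and
  \<open>m - b\<close> are the positive and the negative part of \<open>b - a\<close>, so
  \<open>f(m) = 0\<close>; moreover \<open>f(u) = - (u - a)^2 \<le> 0\<close> and
  \<open>u \<le> m\<close>. Uniqueness does the rest.\<close>

lemma quadratic_root:
  assumes a: "a \<in> carrier A" and b: "b \<in> carrier A"
  shows "rho 2 2 [a \<oplus> b, \<ominus> (a \<otimes> b)] = a \<curlyvee> b"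
proof -
  define f where "f = [\<one>, \<ominus> (a \<oplus> b), \<ominus> (\<ominus> (a \<otimes> b))]"
  have f: "monic_poly A (Suc 1) f" unfolding f_def monic_poly_def using a b by auto
  have g: "monic_poly A 1 (monic_deriv A f)" using monic_poly_deriv[OF rational_A f] .
  define U where "U = vroot_fun 1 (monic_deriv A f)"
  have U: "vroots A le 1 (monic_deriv A f) U" "\<And>i. i \<in> {1..1} \<Longrightarrow> U i \<in> carrier A"
    using vroot_fun[OF g] unfolding U_def by auto
  define m where "m = a \<curlyvee> b"
  have m: "m \<in> carrier A" using a b by (simp add: m_def)
  have two: "of_nat_in A 2 \<in> Units A" using rational_A unfolding rational_ring_def by auto
  define i2 where "i2 = inv (of_nat_in A 2)"
  have i2: "i2 \<in> carrier A" "i2 \<otimes> of_nat_in A 2 = \<one>" using two by (auto simp: i2_def)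
  have n2: "of_nat_in A 2 = \<one> \<oplus> \<one>" by (simp add: of_nat_in_def numeral_2_eq_2)
  define u where "u = i2 \<otimes> (a \<oplus> b)"
  have u: "u \<in> carrier A" using i2 a b by (simp add: u_def)
  have uu: "u \<oplus> u = a \<oplus> b"
  proof -
    have "u \<oplus> u = (i2 \<otimes> of_nat_in A 2) \<otimes> (a \<oplus> b)" unfolding u_def n2 using i2(1) a b by algebra
    then show ?thesis using i2 a b by simp
  qed
  have "poly_deriv A f = [of_nat_in A (Suc (Suc 0)), [Suc 0] \<cdot> (\<ominus> (a \<oplus> b))]" unfolding f_def of_nat_in_def by simp
  then have "poly_deriv A f = [of_nat_in A 2, \<ominus> (a \<oplus> b)]" using a b by (simp add: numeral_2_eq_2)
  then have "monic_deriv A f = map (\<lambda>c. i2 \<otimes> c) [of_nat_in A 2, \<ominus> (a \<oplus> b)]"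
    unfolding monic_deriv_def i2_def of_nat_in_def by (simp add: f_def numeral_2_eq_2)
  also have "\<dots> = [\<one>, \<ominus> u]" using i2 a b by (simp add: u_def r_minus)
  finally have "U 1 = u" using linear_root[OF u] by (simp add: U_def)
  have ev: "eval f y = (y \<ominus> a) \<otimes> (y \<ominus> b)" if y: "y \<in> carrier A" for y
  proof -
    have "eval f y = y \<otimes> y \<oplus> (\<ominus> (a \<oplus> b) \<otimes> y \<oplus> a \<otimes> b)" unfolding f_def using a b y by (simp add: numeral_2_eq_2)
    also have "\<dots> = (y \<ominus> a) \<otimes> (y \<ominus> b)" using a b y by algebra
    finally show ?thesis .
  qed
  have "m \<ominus> a = pp (b \<ominus> a)"
    using add_join[of "\<ominus> a" a b] a b unfolding m_def pp_def by (simp add: minus_eq a_comm r_neg join_comm)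
  moreover have "m \<ominus> b = np (b \<ominus> a)"
    using add_join[of "\<ominus> b" a b] a b unfolding m_def np_def by (simp add: minus_eq a_comm r_neg minus_add)
  ultimately have fm: "eval f m = \<zero>" using ev[OF m] pp_mult_np[of "b \<ominus> a"] a b by simp
  have "u \<ominus> b = \<ominus> (u \<ominus> a)"
  proof -
    have "u \<ominus> b = (u \<oplus> u) \<ominus> u \<ominus> b" using u b by algebra
    also have "\<dots> = \<ominus> (u \<ominus> a)" unfolding uu using u a b by algebra
    finally show ?thesis .
  qed
  then have "eval f u = \<ominus> ((u \<ominus> a) \<otimes> (u \<ominus> a))" using ev[OF u] u a by (simp add: r_minus)
  then have fu: "eval f u \<in> carrier A" "eval f u \<preceq> \<zero>"
    using square_nonneg[of "u \<ominus> a"] le_neg[of \<zero> "(u \<ominus> a) \<otimes> (u \<ominus> a)"] u a by simp_all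
  have "\<zero> \<preceq> (m \<ominus> u) \<oplus> (m \<ominus> u)"
  proof -
    have "a \<preceq> m" "b \<preceq> m" using join_ub[OF a b] unfolding m_def by auto
    then have "\<zero> \<preceq> m \<ominus> a" "\<zero> \<preceq> m \<ominus> b" using le_iff_diff[OF a m] le_iff_diff[OF b m] by blast+
    then have "\<zero> \<preceq> (m \<ominus> a) \<oplus> (m \<ominus> b)" using m a b by (intro add_nonneg) auto
    also have "(m \<ominus> a) \<oplus> (m \<ominus> b) = (m \<oplus> m) \<ominus> (a \<oplus> b)" using m a b by algebra
    also have "\<dots> = (m \<ominus> u) \<oplus> (m \<ominus> u)" unfolding uu[symmetric] using m u by algebra
    finally show ?thesis .
  qed
  then have mu: "\<zero> \<preceq> m \<ominus> u" using half_nonneg[of "m \<ominus> u"] m u by blast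
  then have um: "u \<preceq> m" using le_iff_diff[OF u m] by blast
  have "(m \<ominus> u) \<otimes> eval f u \<preceq> (m \<ominus> u) \<otimes> \<zero>" by (rule mult_mono[OF _ fu(1) _ mu fu(2)]) (use m u in auto)
  then have "vr_conds A le (Suc 1) f U (Suc 1) m"
    unfolding vr_conds_def Let_def using \<open>U 1 = u\<close> um fm m u by (simp add: le_refl)
  moreover have "vr_conds A le (Suc 1) f U (Suc 1) (vroot_fun (Suc 1) f (Suc 1))"
    unfolding U_def using vr_conds_rho[OF f, of "Suc 1"] by simp
  moreover have "vroot_fun (Suc 1) f (Suc 1) \<in> carrier A" using vroot_fun(1)[OF f] by simp
  ultimately have "vroot_fun (Suc 1) f (Suc 1) = m"
    using vr_conds_unique[OF f U(2) U(1), of "Suc 1"] m by simp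
  then show ?thesis by (simp add: rho_def f_def m_def numeral_2_eq_2)
qed

lemma virtual_root_bounds_rho: "virtual_root_bounds rho"
  unfolding virtual_root_bounds_def
proof (intro allI impI)
  fix d j f assume d: "2 \<le> d" "1 \<le> j" "j \<le> d" and f: "monic_poly A d f"
  obtain n where n: "d = Suc n" using d by (cases d) auto
  have g: "monic_poly A (d - 1) (monic_deriv A f)" using monic_poly_deriv[OF rational_A] f n by simp
  have "vr_conds A le (Suc n) f (vroot_fun n (monic_deriv A f)) j (vroot_fun (Suc n) f j)"
    using vr_conds_rho f d n by auto
  then have V: "vr_conds A le d f (vroot_fun (d - 1) (monic_deriv A f)) j (vroot_fun d f j)" using n by simp
  show "let g = monic_deriv A f; \<sigma> = (\<ominus> \<one>) [^] (d - j); x = virtual_root A rho d j f;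
           u = virtual_root A rho (d - 1) (j - 1) g; v = virtual_root A rho (d - 1) j g
       in (2 \<le> j \<longrightarrow> u \<preceq> x \<and> \<sigma> \<otimes> (x \<ominus> u) \<otimes> eval f u \<preceq> \<zero> \<and> \<sigma> \<otimes> (x \<ominus> u) \<otimes> eval f x \<preceq> \<zero>) \<and>
          (j \<le> d - 1 \<longrightarrow> x \<preceq> v \<and> \<zero> \<preceq> \<sigma> \<otimes> (v \<ominus> x) \<otimes> eval f v \<and> \<zero> \<preceq> \<sigma> \<otimes> (v \<ominus> x) \<otimes> eval f x) \<and>
          (j = d \<longrightarrow> \<zero> \<preceq> eval f x) \<and> (j = 1 \<longrightarrow> \<zero> \<preceq> (\<ominus> \<one>) [^] d \<otimes> eval f x)"
    unfolding Let_def virtual_root_rho[OF f] virtual_root_rho[OF g] using V unfolding vr_conds_def Let_def .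
qed

text \<open>Condition (2) yields a \<open>z0\<close> without bounds. Its truncation
  \<open>pp z0 \<curlywedge> m\<close> satisfies the same equation, because multiplication by
  \<open>c \<ge> 0\<close> distributes over joins and meets and
  \<open>0 \<le> m^2 \<le> c m\<close>.\<close>

lemma exists_Fr:
  assumes a: "a \<in> carrier A" and b: "b \<in> carrier A"
  shows "\<exists>z\<in>carrier A. z \<otimes> abs_val b = (abs_val a \<curlywedge> abs_val b) [^] (2::nat) \<and> \<zero> \<preceq> z \<and> z \<preceq> abs_val a \<curlywedge> abs_val b"
proof -
  define m where "m = abs_val a \<curlywedge> abs_val b"
  define c where "c = abs_val b"
  have m: "m \<in> carrier A" "\<zero> \<preceq> m" "m \<preceq> c" and c: "c \<in> carrier A" "\<zero> \<preceq> c"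
    using a b by (auto simp: m_def c_def abs_nonneg intro: meet_lb meet_greatest)
  obtain z0 where z0: "z0 \<in> carrier A" "z0 \<otimes> c = m \<otimes> m" using divides_square[OF m(1) c(1) m(2,3)] by blast
  define z where "z = pp z0 \<curlywedge> m"
  have z: "z \<in> carrier A" using z0 m by (simp add: z_def)
  have "c \<otimes> pp z0 = (c \<otimes> z0) \<curlyvee> (c \<otimes> \<zero>)" unfolding pp_def using c z0 by (intro pos_mult_join_nonneg) auto
  also have "\<dots> = m \<otimes> m" using z0 c m square_nonneg[OF m(1)] by (simp add: m_comm le_def)
  finally have "c \<otimes> pp z0 = m \<otimes> m" .
  moreover have "c \<otimes> z = (c \<otimes> pp z0) \<curlywedge> (c \<otimes> m)" unfolding z_def using c z0 m by (intro pos_mult_meet) auto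
  moreover have "m \<otimes> m \<preceq> c \<otimes> m" using mult_mono[OF m(1) m(1) c(1) m(2,3)] m c by (simp add: m_comm)
  ultimately have "z \<otimes> c = m \<otimes> m" using meet_eq[of "m \<otimes> m" "c \<otimes> m"] c m z by (simp add: m_comm)
  moreover have "\<zero> \<preceq> z" "z \<preceq> m" unfolding z_def using z0 m by (auto intro: meet_greatest meet_lb)
  ultimately have "z \<otimes> c = m [^] (2::nat) \<and> \<zero> \<preceq> z \<and> z \<preceq> m" using m(1) by (simp add: pow_2)
  then show ?thesis using z unfolding m_def c_def by blast
qed

theorem real_closed_ring_structure: "\<exists>Fr rho. real_closed_ring A (\<curlyvee>) Fr rho"
proof -
  have "\<exists>Fr. \<forall>a b. a \<in> carrier A \<longrightarrow> b \<in> carrier A \<longrightarrow> Fr a b \<in> carrier A \<and>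
      Fr a b \<otimes> abs_val b = (abs_val a \<curlywedge> abs_val b) [^] (2::nat) \<and> \<zero> \<preceq> Fr a b \<and> Fr a b \<preceq> abs_val a \<curlywedge> abs_val b"
    by (intro choice allI) (use exists_Fr in blast)
  then obtain Fr where Fr: "\<And>a b. a \<in> carrier A \<Longrightarrow> b \<in> carrier A \<Longrightarrow> Fr a b \<in> carrier A \<and>
      Fr a b \<otimes> abs_val b = (abs_val a \<curlywedge> abs_val b) [^] (2::nat) \<and> \<zero> \<preceq> Fr a b \<and> Fr a b \<preceq> abs_val a \<curlywedge> abs_val b"
    by blast
  have "real_closed_ring A (\<curlyvee>) Fr rho"
  proof
    fix j d as assume "1 \<le> j" "j \<le> d" "length (as :: 'a list) = d" "set as \<subseteq> carrier A"
    then have "monic_poly A d (\<one> # map (\<lambda>c. \<ominus> c) as)" unfolding monic_poly_def by (auto simp: subset_iff)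
    then show "rho d j as \<in> carrier A" unfolding rho_def using vroot_fun(1) \<open>1 \<le> j\<close> \<open>j \<le> d\<close> by simp
  next
    fix a assume a: "a \<in> carrier A"
    then have "monic_poly A 1 [\<one>, \<ominus> a]" unfolding monic_poly_def by auto
    then show "virtual_root A rho 1 1 [\<one>, \<ominus> a] = a" using virtual_root_rho linear_root[OF a] by simp
  qed (use Fr virtual_root_bounds_rho quadratic_root in auto)
  then show ?thesis by blast
qed

end

lemma schwartz_f_ring_if_schwartz:
  assumes "schwartz_real_closed A"
  shows "\<exists>join. schwartz_f_ring A join"
proof -
  obtain r where red: "reduced_ring A" and r: "f_ring_order A r"
    "{x [^]\<^bsub>A\<^esub> (2::nat) | x. x \<in> carrier A} = {x \<in> carrier A. (\<zero>\<^bsub>A\<^esub>, x) \<in> r}"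
    "\<forall>a \<in> carrier A. \<forall>b \<in> carrier A. (\<zero>\<^bsub>A\<^esub>, a) \<in> r \<longrightarrow> (a, b) \<in> r \<longrightarrow>
          (\<exists>z \<in> carrier A. z \<otimes>\<^bsub>A\<^esub> b = a [^]\<^bsub>A\<^esub> (2::nat))"
    and primes: "\<And>P. primeideal P A \<Longrightarrow> integrally_closed (A Quot P) \<and> real_closed_field (fraction_field (A Quot P))"
    using assms unfolding schwartz_real_closed_def by blast
  obtain join where fr: "f_ring A join" and le: "\<And>x y. x \<in> carrier A \<Longrightarrow> y \<in> carrier A \<Longrightarrow> (x, y) \<in> r \<longleftrightarrow> f_ring.le join x y"
    using r(1) unfolding f_ring_order_def by blast
  interpret f_ring A join by (rule fr)
  interpret square_f_ring A join
  proof
    show "x = \<zero>\<^bsub>A\<^esub>" if "x \<in> carrier A" "x \<otimes>\<^bsub>A\<^esub> x = \<zero>\<^bsub>A\<^esub>" for x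
      using red that pow_2[of x] unfolding reduced_ring_def by metis
    show "\<exists>s\<in>carrier A. s \<otimes>\<^bsub>A\<^esub> s = x" if "x \<in> carrier A" "f_ring.le join \<zero>\<^bsub>A\<^esub> x" for x
    proof -
      have "x \<in> {x \<in> carrier A. (\<zero>\<^bsub>A\<^esub>, x) \<in> r}" using that le by simp
      then obtain s where "s \<in> carrier A" "x = s [^]\<^bsub>A\<^esub> (2::nat)" unfolding r(2)[symmetric] by blast
      then show ?thesis using pow_2 by auto
    qed
    show "\<exists>z\<in>carrier A. z \<otimes>\<^bsub>A\<^esub> b = a \<otimes>\<^bsub>A\<^esub> a"
      if "a \<in> carrier A" "b \<in> carrier A" "f_ring.le join \<zero>\<^bsub>A\<^esub> a" "f_ring.le join a b" for a b
      using r(3) that le pow_2 by simp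
  qed
  have "schwartz_f_ring A join"
    by unfold_locales (use primes in \<open>auto simp: residue_field_def\<close>)
  then show ?thesis by blast
qed

theorem mainTheorem1:
  fixes A :: "('a, 'm) ring_scheme"
  assumes "cring A"
  shows "(\<exists>join Fr rho. real_closed_ring A join Fr rho) \<longleftrightarrow> schwartz_real_closed A"
proof
  assume "\<exists>join Fr rho. real_closed_ring A join Fr rho"
  then show "schwartz_real_closed A" using real_closed_ring.schwartz by blast
next
  assume "schwartz_real_closed A"
  then obtain join where "schwartz_f_ring A join" using schwartz_f_ring_if_schwartz by blast
  then show "\<exists>join Fr rho. real_closed_ring A join Fr rho"
    using schwartz_f_ring.real_closed_ring_structure by blast
qed

end
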